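(* Let $Z^H\in\mathfrak h$ and let $\Lambda_1(z),\dots,\Lambda_r(z)$ be monic polynomials. There is a one-to-one correspondence between nondegenerate $Z^H$-twisted Miura-Plücker opers and solutions of the Bethe Ansatz equations $$\langle\alpha_i,Z^H\rangle+\partial_z\log\Big[\Lambda_i(z)\prod_{j}q^j_+(z)^{-a_{ji}}(z-w^i_\ell)^2\Big]\Big|_{z=w^i_\ell}=0,\qquad i=1,\dots,r,\ \ \ell=1,\dots,\deg q^i_+,$$ where $q^i_+(z)=\prod_\ell(z-w^i_\ell)$.
   Context: Let $G$ be a connected, simply connected, simple algebraic group over $\mathbb C$ of rank $r$ with Lie algebra $\mathfrak g$, opposite Borel subgroups $B_\pm$, maximal torus $H=B_+\cap B_-$, with Lie algebras $\mathfrak b_\pm,\mathfrak h$. Let $\alpha_i,\check\alpha_i$ be the simple roots and coroots (for $H\subset B_+$), $e_i,f_i,\check\alpha_i$ Chevalley generators, $a_{ij}=\langle\alpha_j,\check\alpha_i\rangle$. For an algebraic group $K$, $K(z)$ denotes its $\mathbb C(z)$-points. The gauge action of $g\in G(z)$ on $\partial_z+A(z)$ is $g(\partial_z+A)g^{-1}=\partial_z+gAg^{-1}+g\,\partial_z(g^{-1})$. Miura opers. The monic polynomials $\Lambda_1,\dots,\Lambda_r$ are fixed. A Miura $G$-oper on $\mathbb P^1$ with regular singularities determined by the $\Lambda_i$ can be written as a connection $\nabla=\partial_z+\sum_i\Lambda_i(z)e_i+\sum_i g_i(z)\check\alpha_i$ with $g_i\in\mathbb C(z)$ (with $B_\pm$-reductions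 the standard ones in this trivialization), and it is identified with this connection. Miura-Plücker opers. Write $Z^H=\sum_i\zeta_i\check\alpha_i\in\mathfrak h$. Let $V_i$ be the irreducible representation of highest weight $\omega_i$ (fundamental weight), with highest weight vector $\nu_{\omega_i}$, and let $W_i=\mathrm{span}(\nu_{\omega_i},f_i\nu_{\omega_i})\subset V_i$, which is $B_+$-stable. The Miura oper $\nabla$ is a $Z^H$-twisted Miura-Plücker oper if there is $v(z)\in B_+(z)$ with $\nabla|_{W_i}=v(z)(\partial_z+Z^H)v(z)^{-1}|_{W_i}$ for all $i=1,\dots,r$. In that case $g_i=\zeta_i-y_i^{-1}\partial_z y_i$ for some $y_i\in\mathbb C(z)^\times$, unique up to scalars. It is nondegenerate if the $y_i$ may be chosen to be monic polynomials such that: (a) no $y_i$ has a multiple root; (b) for each $i$, $y_i$ and $\Lambda_i$ have no common root; (c) if $i\ne j$ and $a_{ij}\neq0$, then $y_i$ and $y_j$ have no common root. A solution of the Bethe Ansatz equations is a family of finite unordered collections $\{w^i_\ell\}_{\ell}$ of complex numbers, $i=1,\dots,r$ (equivalently, a family of monic polynomials $q^i_+(z)=\prod_\ell(z-w^i_\ell)$), for which the equations make sense, i.e. $w^i_\ell$ is not a root of $\Lambda_i$ and $w^i_\ell\neq w^j_s$ whenever $a_{ji}\neq0$ and $(i,\ell)\neq(j,s)$, and for which the equations hold. *)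

theory Defs
  imports
    "HOL-Analysis.Homotopy"
    "HOL-Analysis.Derivative"
    "HOL-Analysis.Function_Topology"
    "HOL-Library.Poly_Mapping"
    "HOL-Algebra.Solvable_Groups"
    "HOL-Computational_Algebra.Computational_Algebra"
    "Jordan_Normal_Form.VS_Connect"
begin

hide_const (open) Finite_Cartesian_Product.mat Finite_Cartesian_Product.vec
hide_type (open) Finite_Cartesian_Product.vec

section \<open>The differential field of rational functions\<close>

type_synonym ratfun = "complex poly fract"

definition ratfun_deriv :: "ratfun \<Rightarrow> ratfun" where
  "ratfun_deriv F = (let (p, q) = (SOME (p, q). q \<noteq> 0 \<and> F = Fraction_Field.Fract p q)
     in Fraction_Field.Fract (pderiv p * q - p * pderiv q) (q * q))"

text \<open>The quotient rule holds for every representation as a fraction.\<close>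

lemma ratfun_deriv_Fract:
  assumes q: "q \<noteq> 0"
  shows "ratfun_deriv (Fraction_Field.Fract p q)
       = Fraction_Field.Fract (pderiv p * q - p * pderiv q) (q * q)"
proof -
  define P where "P = (\<lambda>(p', q'). q' \<noteq> 0 \<and> Fraction_Field.Fract p q = Fraction_Field.Fract p' q')"
  obtain p' q' where some: "(SOME x. P x) = (p', q')" by fastforce
  have "P (p, q)" using q by (simp add: P_def)
  then have "P (p', q')" using some by (metis someI)
  then have q': "q' \<noteq> 0" and eq: "p * q' = p' * q"
    using q by (auto simp: P_def eq_fract)
  have d: "pderiv p * q' + p * pderiv q' = pderiv p' * q + p' * pderiv q"
    using arg_cong[OF eq, of pderiv] by (simp add: pderiv_mult algebra_simps)
  have "(pderiv p * q - p * pderiv q) * (q' * q') - (pderiv p' * q' - p' * pderiv q') * (q * q)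
      = ((pderiv p * q' + p * pderiv q') - (pderiv p' * q + p' * pderiv q)) * (q * q')
        + (p' * q - p * q') * (pderiv q * q' + pderiv q' * q)"
    by (simp add: algebra_simps)
  then have "(pderiv p * q - p * pderiv q) * (q' * q') = (pderiv p' * q' - p' * pderiv q') * (q * q)"
    using d eq by simp
  then show ?thesis
    using q q' some by (simp add: ratfun_deriv_def P_def eq_fract)
qed

definition ratfun_const :: "complex \<Rightarrow> ratfun" where
  "ratfun_const c = to_fract [:c:]"

definition log_deriv :: "ratfun \<Rightarrow> ratfun" where
  "log_deriv F = ratfun_deriv F / F"

text \<open>The value of a rational function at a point where it is regular; it is unspecified
  at a pole.\<close>

definition ratfun_value :: "ratfun \<Rightarrow> complex \<Rightarrow> complex" where
  "ratfun_value F x =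
    (THE c. \<exists>p q. F = Fraction_Field.Fract p q \<and> poly q x \<noteq> 0 \<and> c = poly p x / poly q x)"


section \<open>Linear algebraic groups over the complex numbers\<close>

text \<open>The coordinate ring of \<open>GL\<^sub>n\<close> is generated by the matrix entries and the inverse of the
  determinant. Accordingly a regular function is given by a polynomial in variables indexed
  by \<^typ>\<open>(nat \<times> nat) option\<close>, where \<^const>\<open>None\<close> stands for the inverse determinant.
  Such a polynomial can be evaluated at invertible matrices over any field that
  contains the complex numbers; \<open>\<iota>\<close> below denotes the embedding of the constants.\<close>

type_synonym gl_fun = "((nat \<times> nat) option \<Rightarrow>\<^sub>0 nat) \<Rightarrow>\<^sub>0 complex"

definition gl_coord :: "'a::field mat \<Rightarrow> (nat \<times> nat) option \<Rightarrow> 'a" where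
  "gl_coord g v = (case v of
      None \<Rightarrow> inverse (det g)
    | Some (a, b) \<Rightarrow> if a < dim_row g \<and> b < dim_col g then g $$ (a, b) else 0)"

definition gl_eval :: "(complex \<Rightarrow> 'a::field) \<Rightarrow> gl_fun \<Rightarrow> 'a mat \<Rightarrow> 'a" where
  "gl_eval \<iota> p g =
    (\<Sum>m \<in> Poly_Mapping.keys p. \<iota> (Poly_Mapping.lookup p m) *
      (\<Prod>v \<in> Poly_Mapping.keys m. gl_coord g v ^ Poly_Mapping.lookup m v))"

abbreviation reg :: "gl_fun \<Rightarrow> complex mat \<Rightarrow> complex" where
  "reg \<equiv> gl_eval (\<lambda>c. c)"

definition GL :: "nat \<Rightarrow> 'a::comm_ring_1 mat monoid" where
  "GL n = units_of (ring_mat TYPE('a) n ())"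

abbreviation GL_sub :: "nat \<Rightarrow> complex mat set \<Rightarrow> complex mat monoid" where
  "GL_sub n K \<equiv> GL n\<lparr>carrier := K\<rparr>"

definition zariski_closed :: "nat \<Rightarrow> complex mat set \<Rightarrow> bool" where
  "zariski_closed n K \<longleftrightarrow> (\<exists>S. K = {g \<in> carrier (GL n). \<forall>p\<in>S. reg p g = 0})"

definition zariski_connected :: "nat \<Rightarrow> complex mat set \<Rightarrow> bool" where
  "zariski_connected n K \<longleftrightarrow>
    \<not> (\<exists>A B. zariski_closed n A \<and> zariski_closed n B \<and> A \<noteq> {} \<and> B \<noteq> {} \<and>
          A \<inter> B = {} \<and> A \<union> B = K)"

definition alg_group :: "nat \<Rightarrow> complex mat set \<Rightarrow> bool" where
  "alg_group n K \<longleftrightarrow> subgroup K (GL n) \<and> zariski_closed n K"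

definition vanishing :: "complex mat set \<Rightarrow> gl_fun set" where
  "vanishing K = {p. \<forall>g\<in>K. reg p g = 0}"

text \<open>The group \<open>K(z)\<close> of points of \<open>K\<close> over the field of rational functions.\<close>

definition ratfun_points :: "nat \<Rightarrow> complex mat set \<Rightarrow> ratfun mat set" where
  "ratfun_points n K = {g \<in> carrier (GL n). \<forall>p\<in>vanishing K. gl_eval ratfun_const p g = 0}"

text \<open>The differential of a regular function at the identity, extended linearly to matrices
  over a field containing the complex numbers.\<close>

definition unit_mat :: "nat \<Rightarrow> nat \<Rightarrow> nat \<Rightarrow> complex mat" where
  "unit_mat n a b = mat n n (\<lambda>(i, j). if i = a \<and> j = b then 1 else 0)"

definition gl_diff :: "(complex \<Rightarrow> 'a::field) \<Rightarrow> gl_fun \<Rightarrow> 'a mat \<Rightarrow> 'a" where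
  "gl_diff \<iota> p X = (let n = dim_row X in
    \<Sum>a<n. \<Sum>b<n. \<iota> (deriv (\<lambda>t. reg p (1\<^sub>m n + t \<cdot>\<^sub>m unit_mat n a b)) 0) * X $$ (a, b))"

definition lie_algebra :: "nat \<Rightarrow> complex mat set \<Rightarrow> complex mat set" where
  "lie_algebra n K = {X \<in> carrier_mat n n. \<forall>p\<in>vanishing K. gl_diff (\<lambda>c. c) p X = 0}"

text \<open>A morphism to \<open>GL\<^sub>m\<close> is presented by regular functions for its matrix entries. The
  presentation is not unique, but the map on \<open>K\<close> and the differential on the Lie algebra
  of \<open>K\<close> do not depend on it.\<close>

type_synonym gl_mor = "nat \<Rightarrow> nat \<Rightarrow> gl_fun"

definition mor_map :: "nat \<Rightarrow> gl_mor \<Rightarrow> complex mat \<Rightarrow> complex mat" where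
  "mor_map m P g = mat m m (\<lambda>(a, b). reg (P a b) g)"

definition mor_diff :: "(complex \<Rightarrow> 'a::field) \<Rightarrow> nat \<Rightarrow> gl_mor \<Rightarrow> 'a mat \<Rightarrow> 'a mat" where
  "mor_diff \<iota> m P X = mat m m (\<lambda>(a, b). gl_diff \<iota> (P a b) X)"

definition alg_hom ::
  "nat \<Rightarrow> complex mat set \<Rightarrow> nat \<Rightarrow> complex mat set \<Rightarrow> gl_mor \<Rightarrow> bool" where
  "alg_hom n K m L P \<longleftrightarrow> mor_map m P \<in> hom (GL_sub n K) (GL_sub m L)"

text \<open>Simplicity is meant in the sense of algebraic groups: finite normal subgroups are allowed.\<close>

definition simple_alg_group :: "nat \<Rightarrow> complex mat set \<Rightarrow> bool" where
  "simple_alg_group n G \<longleftrightarrow>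
    alg_group n G \<and> zariski_connected n G \<and> (\<exists>g\<in>G. \<exists>h\<in>G. g * h \<noteq> h * g) \<and>
    (\<forall>N. alg_group n N \<and> zariski_connected n N \<and> N \<lhd> GL_sub n G \<longrightarrow> N = {1\<^sub>m n} \<or> N = G)"

text \<open>Simple connectedness refers to the analytic topology, i.e. the topology of the matrix
  entries.\<close>

definition simply_connected_group :: "complex mat set \<Rightarrow> bool" where
  "simply_connected_group G \<longleftrightarrow> simply_connected ((\<lambda>g ab. gl_coord g (Some ab)) ` G)"

definition connected_solvable :: "nat \<Rightarrow> complex mat set \<Rightarrow> bool" where
  "connected_solvable n B \<longleftrightarrow>
    alg_group n B \<and> zariski_connected n B \<and> solvable (GL_sub n B)"

definition borel_subgroup :: "nat \<Rightarrow> complex mat set \<Rightarrow> complex mat set \<Rightarrow> bool" where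
  "borel_subgroup n G B \<longleftrightarrow> connected_solvable n B \<and> B \<subseteq> G \<and>
    (\<forall>B'. connected_solvable n B' \<and> B \<subseteq> B' \<and> B' \<subseteq> G \<longrightarrow> B' = B)"

definition diag_group :: "nat \<Rightarrow> complex mat set" where
  "diag_group k = {g \<in> carrier (GL k). diagonal_mat g}"

definition alg_torus :: "nat \<Rightarrow> complex mat set \<Rightarrow> bool" where
  "alg_torus n T \<longleftrightarrow> alg_group n T \<and>
    (\<exists>k P Q. alg_hom n T k (diag_group k) P \<and> alg_hom k (diag_group k) n T Q \<and>
      (\<forall>g\<in>T. mor_map n Q (mor_map k P g) = g) \<and>
      (\<forall>d\<in>diag_group k. mor_map k P (mor_map n Q d) = d))"

definition maximal_torus :: "nat \<Rightarrow> complex mat set \<Rightarrow> complex mat set \<Rightarrow> bool" where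
  "maximal_torus n G T \<longleftrightarrow> alg_torus n T \<and> T \<subseteq> G \<and>
    (\<forall>T'. alg_torus n T' \<and> T \<subseteq> T' \<and> T' \<subseteq> G \<longrightarrow> T' = T)"


section \<open>Roots, coroots and Chevalley generators\<close>

definition alg_character :: "complex mat set \<Rightarrow> gl_fun \<Rightarrow> bool" where
  "alg_character H \<psi> \<longleftrightarrow>
    (\<forall>g\<in>H. reg \<psi> g \<noteq> 0) \<and> (\<forall>g\<in>H. \<forall>h\<in>H. reg \<psi> (g * h) = reg \<psi> g * reg \<psi> h)"

text \<open>The nontrivial weights of \<open>H\<close> in the adjoint action on the Lie algebra of \<open>K\<close>, where \<open>K\<close>
  contains \<open>H\<close>. A character of \<open>H\<close> may be represented by several regular functions.\<close>

definition is_root :: "nat \<Rightarrow> complex mat set \<Rightarrow> complex mat set \<Rightarrow> gl_fun \<Rightarrow> bool" where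
  "is_root n H K \<psi> \<longleftrightarrow> alg_character H \<psi> \<and> (\<exists>h\<in>H. reg \<psi> h \<noteq> 1) \<and>
    (\<exists>X\<in>lie_algebra n K. X \<noteq> 0\<^sub>m n n \<and> (\<forall>h\<in>H. h * X * inv\<^bsub>GL n\<^esub> h = reg \<psi> h \<cdot>\<^sub>m X))"

text \<open>\<open>\<alpha>\<close> enumerates the base of the root system of \<open>(G, H)\<close> for which the positive roots are
  the roots of \<open>B\<close>. The character lattice is written multiplicatively.\<close>

definition simple_roots ::
  "nat \<Rightarrow> complex mat set \<Rightarrow> complex mat set \<Rightarrow> complex mat set \<Rightarrow> ('i::finite \<Rightarrow> gl_fun) \<Rightarrow> bool"
where
  "simple_roots n G B H \<alpha> \<longleftrightarrow>
    (\<forall>i. is_root n H B (\<alpha> i)) \<and>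
    (\<forall>k :: 'i \<Rightarrow> int.
      (\<forall>h\<in>H. (\<Prod>i\<in>UNIV. reg (\<alpha> i) h powi k i) = 1) \<longrightarrow> (\<forall>i. k i = 0)) \<and>
    (\<forall>\<beta>. is_root n H B \<beta> \<longrightarrow>
      (\<exists>k :: 'i \<Rightarrow> nat. \<forall>h\<in>H. reg \<beta> h = (\<Prod>i\<in>UNIV. reg (\<alpha> i) h ^ k i))) \<and>
    (\<forall>\<beta>. is_root n H G \<beta> \<and> \<not> is_root n H B \<beta> \<longrightarrow>
      (\<exists>k :: 'i \<Rightarrow> nat. \<forall>h\<in>H. reg \<beta> h = inverse (\<Prod>i\<in>UNIV. reg (\<alpha> i) h ^ k i)))"

definition SL2 :: "complex mat set" where
  "SL2 = {g \<in> carrier_mat 2 2. det g = 1}"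

definition mat2 :: "complex \<Rightarrow> complex \<Rightarrow> complex \<Rightarrow> complex \<Rightarrow> complex mat" where
  "mat2 a b c d = mat_of_rows_list 2 [[a, b], [c, d]]"

text \<open>Chevalley generators are given through a homomorphism \<open>\<phi>\<close> from \<open>SL\<^sub>2\<close> for each simple root
  \<open>\<alpha>\<close>: it maps the upper and lower unipotent one-parameter groups onto the root subgroups of
  \<open>\<alpha>\<close> and \<open>-\<alpha>\<close>, so that \<open>t \<mapsto> \<phi>(diag(t, t\<inverse>))\<close> is the coroot of \<open>\<alpha>\<close>, and the images of the
  standard basis of \<open>sl\<^sub>2\<close> under its differential are \<open>e\<close>, the coroot as an element of the
  Cartan subalgebra, and \<open>f\<close>. The last condition excludes the trivial homomorphism.\<close>

definition root_sl2 ::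
  "nat \<Rightarrow> complex mat set \<Rightarrow> complex mat set \<Rightarrow> complex mat set \<Rightarrow> complex mat set \<Rightarrow>
   gl_fun \<Rightarrow> gl_mor \<Rightarrow> bool"
where
  "root_sl2 n G Bp Bm H \<alpha> \<phi> \<longleftrightarrow>
    alg_hom 2 SL2 n G \<phi> \<and>
    (\<forall>t. t \<noteq> 0 \<longrightarrow> mor_map n \<phi> (mat2 t 0 0 (inverse t)) \<in> H) \<and>
    (\<forall>s. mor_map n \<phi> (mat2 1 s 0 1) \<in> Bp \<and> mor_map n \<phi> (mat2 1 0 s 1) \<in> Bm) \<and>
    (\<forall>h\<in>H. \<forall>s.
      h * mor_map n \<phi> (mat2 1 s 0 1) * inv\<^bsub>GL n\<^esub> h = mor_map n \<phi> (mat2 1 (reg \<alpha> h * s) 0 1) \<and>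
      h * mor_map n \<phi> (mat2 1 0 s 1) * inv\<^bsub>GL n\<^esub> h
        = mor_map n \<phi> (mat2 1 0 (inverse (reg \<alpha> h) * s) 1)) \<and>
    mor_diff (\<lambda>c. c) n \<phi> (mat2 0 1 0 0) \<noteq> 0\<^sub>m n n"

text \<open>The index type \<open>'i\<close> is the set of vertices of the Dynkin diagram; its cardinality is the
  rank.\<close>

record 'i pinned_group =
  gsize :: nat
  grp :: "complex mat set"
  borel_plus :: "complex mat set"
  borel_minus :: "complex mat set"
  torus :: "complex mat set"
  sroot :: "'i \<Rightarrow> gl_fun"
  sl2_map :: "'i \<Rightarrow> gl_mor"

definition pinned_simple_group :: "('i::finite) pinned_group \<Rightarrow> bool" where
  "pinned_simple_group G \<longleftrightarrow>
    simple_alg_group (gsize G) (grp G) \<and>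
    simply_connected_group (grp G) \<and>
    borel_subgroup (gsize G) (grp G) (borel_plus G) \<and>
    borel_subgroup (gsize G) (grp G) (borel_minus G) \<and>
    torus G = borel_plus G \<inter> borel_minus G \<and>
    maximal_torus (gsize G) (grp G) (torus G) \<and>
    simple_roots (gsize G) (grp G) (borel_plus G) (torus G) (sroot G) \<and>
    (\<forall>i. root_sl2 (gsize G) (grp G) (borel_plus G) (borel_minus G) (torus G)
           (sroot G i) (sl2_map G i))"

definition chev_e :: "'i pinned_group \<Rightarrow> 'i \<Rightarrow> complex mat" where
  "chev_e G i = mor_diff (\<lambda>c. c) (gsize G) (sl2_map G i) (mat2 0 1 0 0)"

definition chev_f :: "'i pinned_group \<Rightarrow> 'i \<Rightarrow> complex mat" where
  "chev_f G i = mor_diff (\<lambda>c. c) (gsize G) (sl2_map G i) (mat2 0 0 1 0)"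

definition chev_h :: "'i pinned_group \<Rightarrow> 'i \<Rightarrow> complex mat" where
  "chev_h G i = mor_diff (\<lambda>c. c) (gsize G) (sl2_map G i) (mat2 1 0 0 (-1))"

definition coroot :: "'i pinned_group \<Rightarrow> 'i \<Rightarrow> complex \<Rightarrow> complex mat" where
  "coroot G i t = mor_map (gsize G) (sl2_map G i) (mat2 t 0 0 (inverse t))"

text \<open>\<open>a\<^sub>i\<^sub>j\<close> is the pairing of the root \<open>\<alpha>\<^sub>j\<close> with the coroot of \<open>\<alpha>\<^sub>i\<close>.\<close>

definition cartan :: "'i pinned_group \<Rightarrow> 'i \<Rightarrow> 'i \<Rightarrow> int" where
  "cartan G i j = (THE k. \<forall>t. t \<noteq> 0 \<longrightarrow> reg (sroot G j) (coroot G i t) = t powi k)"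

definition root_pairing :: "'i pinned_group \<Rightarrow> 'i \<Rightarrow> complex mat \<Rightarrow> complex" where
  "root_pairing G i Z = gl_diff (\<lambda>c. c) (sroot G i) Z"

definition coroot_sum :: "('i::finite) pinned_group \<Rightarrow> ('i \<Rightarrow> complex) \<Rightarrow> complex mat" where
  "coroot_sum G \<zeta> = mat (gsize G) (gsize G) (\<lambda>ab. \<Sum>i\<in>UNIV. \<zeta> i * chev_h G i $$ ab)"


section \<open>Fundamental representations\<close>

record hw_rep =
  rdim :: nat
  rmap :: gl_mor
  hwvec :: "complex vec"

definition irreducible_rep :: "nat \<Rightarrow> complex mat set \<Rightarrow> nat \<Rightarrow> gl_mor \<Rightarrow> bool" where
  "irreducible_rep n G m P \<longleftrightarrow> m > 0 \<and>
    (\<forall>U. subspace class_ring U (module_vec TYPE(complex) m) \<and>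
         (\<forall>g\<in>G. \<forall>u\<in>U. mor_map m P g *\<^sub>v u \<in> U) \<longrightarrow> U = {0\<^sub>v m} \<or> U = carrier_vec m)"

definition fundamental_weight :: "'i pinned_group \<Rightarrow> 'i \<Rightarrow> gl_fun \<Rightarrow> bool" where
  "fundamental_weight G i \<omega> \<longleftrightarrow> alg_character (torus G) \<omega> \<and>
    (\<forall>j t. t \<noteq> 0 \<longrightarrow> reg \<omega> (coroot G j t) = (if j = i then t else 1))"

definition fundamental_rep :: "'i pinned_group \<Rightarrow> 'i \<Rightarrow> hw_rep \<Rightarrow> bool" where
  "fundamental_rep G i V \<longleftrightarrow>
    alg_hom (gsize G) (grp G) (rdim V) (carrier (GL (rdim V))) (rmap V) \<and>
    irreducible_rep (gsize G) (grp G) (rdim V) (rmap V) \<and>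
    hwvec V \<in> carrier_vec (rdim V) \<and> hwvec V \<noteq> 0\<^sub>v (rdim V) \<and>
    (\<forall>b\<in>borel_plus G. \<exists>c. mor_map (rdim V) (rmap V) b *\<^sub>v hwvec V = c \<cdot>\<^sub>v hwvec V) \<and>
    (\<exists>\<omega>. fundamental_weight G i \<omega> \<and>
      (\<forall>h\<in>torus G. mor_map (rdim V) (rmap V) h *\<^sub>v hwvec V = reg \<omega> h \<cdot>\<^sub>v hwvec V))"

text \<open>\<open>W\<^sub>i(z)\<close>, the span over the rational functions of the highest weight vector and its image
  under \<open>f\<^sub>i\<close>.\<close>

definition W_space :: "'i pinned_group \<Rightarrow> 'i \<Rightarrow> hw_rep \<Rightarrow> ratfun vec set" where
  "W_space G i V =
    {a \<cdot>\<^sub>v map_vec ratfun_const (hwvec V) +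
     b \<cdot>\<^sub>v map_vec ratfun_const (mor_diff (\<lambda>c. c) (rdim V) (rmap V) (chev_f G i) *\<^sub>v hwvec V)
     | a b. True}"


section \<open>Connections and Miura-Pluecker opers\<close>

text \<open>A connection \<open>\<partial>\<^sub>z + A\<close> is represented by the matrix \<open>A\<close>.\<close>

definition gauge :: "nat \<Rightarrow> ratfun mat \<Rightarrow> ratfun mat \<Rightarrow> ratfun mat" where
  "gauge n g A = g * A * inv\<^bsub>GL n\<^esub> g + g * map_mat ratfun_deriv (inv\<^bsub>GL n\<^esub> g)"

definition connection_on :: "hw_rep \<Rightarrow> ratfun mat \<Rightarrow> ratfun vec \<Rightarrow> ratfun vec" where
  "connection_on V A s =
    map_vec ratfun_deriv s + mor_diff ratfun_const (rdim V) (rmap V) A *\<^sub>v s"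

definition miura_oper ::
  "('i::finite) pinned_group \<Rightarrow> ('i \<Rightarrow> complex poly) \<Rightarrow> ('i \<Rightarrow> ratfun) \<Rightarrow> ratfun mat" where
  "miura_oper G \<Lambda> g = mat (gsize G) (gsize G) (\<lambda>ab.
     (\<Sum>i\<in>UNIV. to_fract (\<Lambda> i) * ratfun_const (chev_e G i $$ ab)) +
     (\<Sum>i\<in>UNIV. g i * ratfun_const (chev_h G i $$ ab)))"

definition miura_pluecker ::
  "('i::finite) pinned_group \<Rightarrow> ('i \<Rightarrow> hw_rep) \<Rightarrow> complex mat \<Rightarrow> ('i \<Rightarrow> complex poly) \<Rightarrow>
   ratfun mat \<Rightarrow> bool"
where
  "miura_pluecker G V Z \<Lambda> A \<longleftrightarrow>
    A \<in> range (miura_oper G \<Lambda>) \<and>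
    (\<exists>v\<in>ratfun_points (gsize G) (borel_plus G). \<forall>i. \<forall>s\<in>W_space G i (V i).
      connection_on (V i) A s =
      connection_on (V i) (gauge (gsize G) v (map_mat ratfun_const Z)) s)"

definition nondegenerate ::
  "('i::finite) pinned_group \<Rightarrow> ('i \<Rightarrow> complex) \<Rightarrow> ('i \<Rightarrow> complex poly) \<Rightarrow> ratfun mat \<Rightarrow> bool"
where
  "nondegenerate G \<zeta> \<Lambda> A \<longleftrightarrow>
    (\<exists>g y. A = miura_oper G \<Lambda> g \<and>
      (\<forall>i. g i = ratfun_const (\<zeta> i) - log_deriv (to_fract (y i))) \<and>
      (\<forall>i. lead_coeff (y i) = 1) \<and>
      (\<forall>i. rsquarefree (y i)) \<and>
      (\<forall>i x. \<not> (poly (y i) x = 0 \<and> poly (\<Lambda> i) x = 0)) \<and>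
      (\<forall>i j x. i \<noteq> j \<and> cartan G i j \<noteq> 0 \<longrightarrow> \<not> (poly (y i) x = 0 \<and> poly (y j) x = 0)))"


section \<open>Bethe Ansatz equations\<close>

definition root_poly :: "complex multiset \<Rightarrow> complex poly" where
  "root_poly w = (\<Prod>x\<in>#w. [:- x, 1:])"

text \<open>In the second condition \<open>w i - {#x#}\<close> collects the \<open>w\<^sup>i\<^sub>s\<close> with \<open>s \<noteq> l\<close>, where \<open>x = w\<^sup>i\<^sub>l\<close>. Under
  the first two conditions the logarithmic derivative in the third is regular at \<open>x\<close>.\<close>

definition bethe_solution ::
  "('i::finite) pinned_group \<Rightarrow> complex mat \<Rightarrow> ('i \<Rightarrow> complex poly) \<Rightarrow>
   ('i \<Rightarrow> complex multiset) \<Rightarrow> bool"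
where
  "bethe_solution G Z \<Lambda> w \<longleftrightarrow>
    (\<forall>i. \<forall>x\<in>#w i. poly (\<Lambda> i) x \<noteq> 0) \<and>
    (\<forall>i j. cartan G j i \<noteq> 0 \<longrightarrow>
      (\<forall>x\<in>#w i. x \<notin># (if j = i then w i - {#x#} else w j))) \<and>
    (\<forall>i. \<forall>x\<in>#w i.
      root_pairing G i Z +
      ratfun_value
        (log_deriv (to_fract (\<Lambda> i) *
          (\<Prod>j\<in>UNIV. to_fract (root_poly (w j)) powi (- cartan G j i)) *
          to_fract [:- x, 1:] ^ 2)) x = 0)"

end

theory Submission
  imports Defs
begin

text \<open>A matrix of rational functions lies in \<open>K(z)\<close> if and only if its values lie in \<open>K\<close> at all but
  finitely many points, so the gauge action can be computed pointwise with holomorphic curves in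
  the complex group. For \<open>v \<in> B\<^sub>+(z)\<close> the Pluecker condition says that \<open>v\<^sup>-\<^sup>1\<close> carries the action of
  the oper on \<open>W\<^sub>i\<close> into that of \<open>\<partial>\<^sub>z + Z\<close>. Its component on the highest weight line gives
  \<open>y\<^sub>i\<close>. Writing \<open>P\<^sub>i\<close> for the product of the \<open>y\<^sub>j\<close> to the powers \<open>a\<^sub>j\<^sub>i\<close> and \<open>\<kappa>\<^sub>i = \<langle>\<alpha>\<^sub>i, Z\<rangle>\<close>,
  the image of \<open>f\<^sub>i \<nu>\<close> provides a rational solution \<open>T\<close> of \<open>T' + \<kappa>\<^sub>i T = c \<Lambda>\<^sub>i / P\<^sub>i\<close> with \<open>c \<noteq> 0\<close>.
  The right-hand side has a double pole at every root of \<open>y\<^sub>i\<close>, and a solution without a logarithm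
  exists there exactly when the Bethe equation holds. Conversely, as \<open>a\<^sub>j\<^sub>i \<le> 0\<close> for \<open>j \<noteq> i\<close> there are
  no further poles, so the Bethe equations give rational solutions for all \<open>i\<close>, from which \<open>v\<close>
  is assembled out of coroots and simple root subgroups.\<close>

text \<open>The relations behind the Bethe equations (a_ii = 2, a_ji \<le> 0 for i \<noteq> j, and
  f_i being fixed by the positive root subgroup of \<alpha>_j for i \<noteq> j) are not part of
  \<open>pinned_simple_group\<close>. They are extracted from the homomorphisms from SL2 by
  comparing polynomial and Laurent identities in the group parameter. In the forward direction v is
  an arbitrary point of B_+(z), so the image of f_i \<nu> under its inverse cannot be written down.
  A linear form that is 1 on \<nu> and transforms under all coroots by the weight \<omega>_i is
  applied instead: it turns Z into the scalar \<zeta>_i and leaves two scalar equations. Dividing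
  the second unknown by d_i = P_i / y_i, the factor by which the torus element with coordinates 1 /
  y_j scales f_i \<nu>, removes the logarithmic derivatives of the y_j and leaves the constant
  coefficient \<kappa>_i. In the backward direction triangular 2x2 blocks on all W_i must be
  realised by one group element. Coroots give the diagonal entries 1 / y_i and d_i; the root
  subgroup of \<alpha>_i gives the remaining entry and acts trivially on the other blocks.\<close>

lemma MOST_poly_nonzero:
  fixes p :: "complex poly"
  assumes "p \<noteq> 0"
  shows "\<forall>\<^sub>\<infinity>x. poly p x \<noteq> 0"
  using poly_roots_finite[OF assms] by (simp add: eventually_cofinite)

lemma MOST_False_complex: "\<not> (\<forall>\<^sub>\<infinity>x::complex. False)"
  using infinite_UNIV_char_0[where 'a = complex] by (simp add: eventually_cofinite)

section \<open>Values of rational functions at points\<close>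

lemma ratfun_cases:
  fixes F :: ratfun
  obtains p q where "q \<noteq> 0" "F = Fraction_Field.Fract p q"
  by (cases F) auto

text \<open>Any fraction whose denominator does not vanish at x is a witness, reduced or not, so
  sums and products need no cancellation.\<close>

definition regular_at :: "ratfun \<Rightarrow> complex \<Rightarrow> bool" where
  "regular_at F x \<longleftrightarrow> (\<exists>p q. F = Fraction_Field.Fract p q \<and> poly q x \<noteq> 0)"

abbreviation ev :: "ratfun \<Rightarrow> complex \<Rightarrow> complex" where
  "ev \<equiv> ratfun_value"

lemma regular_atE:
  assumes "regular_at F x"
  obtains p q where "F = Fraction_Field.Fract p q" "poly q x \<noteq> 0" "q \<noteq> 0"
  using assms unfolding regular_at_def by (metis poly_0)

lemma regular_at_Fract: "poly q x \<noteq> 0 \<Longrightarrow> regular_at (Fraction_Field.Fract p q) x"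
  by (auto simp: regular_at_def)

lemma ev_Fract:
  assumes "poly q x \<noteq> 0"
  shows "ev (Fraction_Field.Fract p q) x = poly p x / poly q x"
  unfolding ratfun_value_def
proof (rule the_equality)
  fix c assume "\<exists>p' q'. Fraction_Field.Fract p q = Fraction_Field.Fract p' q' \<and>
    poly q' x \<noteq> 0 \<and> c = poly p' x / poly q' x"
  then obtain p' q' where 1: "Fraction_Field.Fract p q = Fraction_Field.Fract p' q'"
    "poly q' x \<noteq> 0" "c = poly p' x / poly q' x" by blast
  with assms have "p * q' = p' * q"
    by (metis eq_fract(1) poly_0)
  from arg_cong[OF this, of "\<lambda>r. poly r x"] show "c = poly p x / poly q x"
    using assms 1(2,3) by (simp add: frac_eq_eq)
qed (use assms in blast)

lemma MOST_regular: "\<forall>\<^sub>\<infinity>x. regular_at F x"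
proof -
  obtain p q where F: "q \<noteq> 0" "F = Fraction_Field.Fract p q" by (rule ratfun_cases)
  from MOST_poly_nonzero[OF F(1)] show ?thesis
    by eventually_elim (simp add: F regular_at_Fract)
qed

lemma regular_at_to_fract [simp]: "regular_at (to_fract p) x"
  and ev_to_fract [simp]: "ev (to_fract p) x = poly p x"
  unfolding to_fract_def by (auto simp: regular_at_Fract ev_Fract)

lemma regular_at_const [simp]: "regular_at (ratfun_const c) x"
  and ev_const [simp]: "ev (ratfun_const c) x = c"
  unfolding ratfun_const_def by auto

lemma ratfun_const_simps [simp]:
  "ratfun_const 0 = 0" "ratfun_const 1 = 1"
  by (simp_all add: ratfun_const_def to_fract_def Zero_fract_def One_fract_def one_pCons)

lemma regular_at_0_1 [simp]: "regular_at 0 x" "regular_at 1 x"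
  and ev_0_1 [simp]: "ev 0 x = 0" "ev 1 x = 1"
  using regular_at_const[of 0 x] regular_at_const[of 1 x] ev_const[of 0 x] ev_const[of 1 x]
  by simp_all

context
  fixes F G :: ratfun and x :: complex
  assumes F: "regular_at F x" and G: "regular_at G x"
begin

lemma regular_at_add: "regular_at (F + G) x"
  and ev_add: "ev (F + G) x = ev F x + ev G x"
proof -
  from F obtain p q where F: "F = Fraction_Field.Fract p q" "poly q x \<noteq> 0" "q \<noteq> 0"
    by (rule regular_atE)
  from G obtain r s where G: "G = Fraction_Field.Fract r s" "poly s x \<noteq> 0" "s \<noteq> 0"
    by (rule regular_atE)
  show "regular_at (F + G) x" "ev (F + G) x = ev F x + ev G x"
    using F G by (auto simp: regular_at_Fract ev_Fract add_frac_eq)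
qed

lemma regular_at_mult: "regular_at (F * G) x"
  and ev_mult: "ev (F * G) x = ev F x * ev G x"
proof -
  from F obtain p q where F: "F = Fraction_Field.Fract p q" "poly q x \<noteq> 0" "q \<noteq> 0"
    by (rule regular_atE)
  from G obtain r s where G: "G = Fraction_Field.Fract r s" "poly s x \<noteq> 0" "s \<noteq> 0"
    by (rule regular_atE)
  show "regular_at (F * G) x" "ev (F * G) x = ev F x * ev G x"
    using F G by (auto simp: regular_at_Fract ev_Fract)
qed

end

context
  fixes F :: ratfun and x :: complex
  assumes F: "regular_at F x"
begin

lemma regular_at_uminus: "regular_at (- F) x"
  and ev_uminus: "ev (- F) x = - ev F x"
proof -
  from F obtain p q where F: "F = Fraction_Field.Fract p q" "poly q x \<noteq> 0" "q \<noteq> 0"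
    by (rule regular_atE)
  show "regular_at (- F) x" "ev (- F) x = - ev F x"
    using F by (auto simp: regular_at_Fract ev_Fract)
qed

lemma regular_at_inverse: "ev F x \<noteq> 0 \<Longrightarrow> regular_at (inverse F) x"
  and ev_inverse: "ev F x \<noteq> 0 \<Longrightarrow> ev (inverse F) x = inverse (ev F x)"
proof -
  from F obtain p q where F: "F = Fraction_Field.Fract p q" "poly q x \<noteq> 0" "q \<noteq> 0"
    by (rule regular_atE)
  show "regular_at (inverse F) x" "ev (inverse F) x = inverse (ev F x)" if "ev F x \<noteq> 0"
    using F that by (auto simp: regular_at_Fract ev_Fract)
qed

lemma regular_at_deriv: "regular_at (ratfun_deriv F) x"
  and ev_deriv: "(ev F has_field_derivative ev (ratfun_deriv F) x) (at x)"
proof -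
  from F obtain p q where F: "F = Fraction_Field.Fract p q" "poly q x \<noteq> 0" "q \<noteq> 0"
    by (rule regular_atE)
  show "regular_at (ratfun_deriv F) x"
    using F by (auto simp: regular_at_Fract ratfun_deriv_Fract)
  have "((\<lambda>x. poly p x / poly q x) has_field_derivative ev (ratfun_deriv F) x) (at x)"
    using F by (auto intro!: derivative_eq_intros simp: ratfun_deriv_Fract ev_Fract)
  moreover have "open {w. poly q w \<noteq> 0}"
    by (intro open_Collect_neq continuous_intros)
  then have "\<forall>\<^sub>F w in nhds x. poly q w \<noteq> 0"
    using F(2) by (auto simp: eventually_nhds)
  then have "\<forall>\<^sub>F w in nhds x. ev F w = poly p w / poly q w"
    by eventually_elim (simp add: F ev_Fract)
  ultimately show "(ev F has_field_derivative ev (ratfun_deriv F) x) (at x)"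
    using DERIV_cong_ev[OF refl _ refl, of "ev F"] by simp
qed

end

lemma regular_at_diff:
  assumes "regular_at F x" "regular_at G x"
  shows "regular_at (F - G) x" "ev (F - G) x = ev F x - ev G x"
  using regular_at_add[of F x "-G"] ev_add[of F x "-G"] regular_at_uminus[OF assms(2)]
    ev_uminus[OF assms(2)] assms by simp_all

lemma regular_at_power:
  assumes "regular_at F x"
  shows "regular_at (F ^ k) x" "ev (F ^ k) x = ev F x ^ k"
  using assms by (induction k) (auto simp: regular_at_mult ev_mult)

lemma regular_at_powi:
  assumes "regular_at F x" "ev F x \<noteq> 0"
  shows "regular_at (F powi k) x" "ev (F powi k) x = ev F x powi k"
  using assms by (auto simp: power_int_def regular_at_power regular_at_inverse ev_inverse)

lemma regular_at_sum:
  assumes "\<And>i. i \<in> A \<Longrightarrow> regular_at (F i) x"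
  shows "regular_at (\<Sum>i\<in>A. F i) x \<and> ev (\<Sum>i\<in>A. F i) x = (\<Sum>i\<in>A. ev (F i) x)"
  using assms by (induction A rule: infinite_finite_induct) (auto simp: regular_at_add ev_add)

lemma regular_at_prod:
  assumes "\<And>i. i \<in> A \<Longrightarrow> regular_at (F i) x"
  shows "regular_at (\<Prod>i\<in>A. F i) x \<and> ev (\<Prod>i\<in>A. F i) x = (\<Prod>i\<in>A. ev (F i) x)"
  using assms by (induction A rule: infinite_finite_induct) (auto simp: regular_at_mult ev_mult)

lemma ev_eq_0_imp:
  assumes "\<forall>\<^sub>\<infinity>x. ev F x = 0"
  shows "F = 0"
proof -
  obtain p q where F: "q \<noteq> 0" "F = Fraction_Field.Fract p q" by (rule ratfun_cases)
  have "p = 0"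
  proof (rule ccontr)
    assume "p \<noteq> 0"
    from assms MOST_poly_nonzero[OF F(1)] MOST_poly_nonzero[OF this]
    have "\<forall>\<^sub>\<infinity>x::complex. False" by eventually_elim (use F in \<open>simp add: ev_Fract\<close>)
    then show False using MOST_False_complex by blast
  qed
  then show ?thesis using F by (simp add: fract_collapse)
qed

lemma MOST_ev_add: "\<forall>\<^sub>\<infinity>x. ev (F + G) x = ev F x + ev G x"
  using MOST_regular[of F] MOST_regular[of G] by eventually_elim (rule ev_add)

lemma MOST_ev_mult: "\<forall>\<^sub>\<infinity>x. ev (F * G) x = ev F x * ev G x"
  using MOST_regular[of F] MOST_regular[of G] by eventually_elim (rule ev_mult)

lemma MOST_ev_diff: "\<forall>\<^sub>\<infinity>x. ev (F - G) x = ev F x - ev G x"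
  using MOST_regular[of F] MOST_regular[of G] by eventually_elim (rule regular_at_diff)

lemma MOST_ev_deriv: "\<forall>\<^sub>\<infinity>x. (ev F has_field_derivative ev (ratfun_deriv F) x) (at x)"
  using MOST_regular[of F] by eventually_elim (rule ev_deriv)

text \<open>Reduces identities of rational functions to identities of values. Each rule for values
  holds off a finite set, and the cofinite filter collects finitely many such exceptions, so the
  unspecified values at poles never matter.\<close>

lemma ratfun_eqI:
  assumes "\<forall>\<^sub>\<infinity>x. ev F x = ev G x"
  shows "F = G"
proof -
  have "\<forall>\<^sub>\<infinity>x. ev (F - G) x = 0"
    using assms MOST_ev_diff[of F G] by eventually_elim simp
  from ev_eq_0_imp[OF this] show ?thesis by simp
qed

lemma MOST_nonzero_ev: "F \<noteq> 0 \<Longrightarrow> \<forall>\<^sub>\<infinity>x. ev F x \<noteq> 0"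
  using MOST_ev_mult[of F "inverse F"] by (auto elim!: eventually_mono)

text \<open>Cofinite subsets of the plane are open. Hence a pointwise identity that holds at almost
  all points may be differentiated at almost all points.\<close>

lemma MOST_nhds:
  fixes P :: "complex \<Rightarrow> bool"
  assumes "\<forall>\<^sub>\<infinity>x. P x"
  shows "\<forall>\<^sub>\<infinity>x. \<forall>\<^sub>F w in nhds x. P w"
proof -
  have "open {x. P x}"
    using assms finite_imp_closed[of "{x. \<not> P x}"]
    by (simp add: eventually_cofinite closed_def Collect_neg_eq)
  with assms show ?thesis
    by (elim eventually_mono) (auto simp: eventually_nhds)
qed

lemma MOST_ev_deriv_eqI:
  assumes "\<forall>\<^sub>\<infinity>x. ev F x = f x" "\<forall>\<^sub>\<infinity>x. (f has_field_derivative f' x) (at x)"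
  shows "\<forall>\<^sub>\<infinity>x. ev (ratfun_deriv F) x = f' x"
  using MOST_nhds[OF assms(1)] assms(2) MOST_ev_deriv[of F]
proof eventually_elim
  case (elim x)
  have "(f has_field_derivative ev (ratfun_deriv F) x) (at x)"
    using elim(1,3) DERIV_cong_ev[OF refl _ refl, of "ev F" f x] by simp
  with elim show ?case by (blast intro: DERIV_unique)
qed

subsection \<open>Specialisation of matrices\<close>

lemma GL_carrier_iff:
  "g \<in> carrier (GL n) \<longleftrightarrow> g \<in> carrier_mat n n \<and> (\<exists>h\<in>carrier_mat n n. g * h = 1\<^sub>m n \<and> h * g = 1\<^sub>m n)"
  unfolding GL_def units_of_def Units_def ring_mat_def by auto

lemma GL_simps [simp]:
  "monoid.mult (GL n) = (\<lambda>A B. A * B)" "monoid.one (GL n) = 1\<^sub>m n"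
  unfolding GL_def units_of_def ring_mat_def by auto

lemma group_GL: "Group.group (GL n)"
  unfolding GL_def by (intro monoid.units_group ring.is_monoid ring_mat)

lemma GL_carrierD: "g \<in> carrier (GL n) \<Longrightarrow> g \<in> carrier_mat n n"
  by (simp add: GL_carrier_iff)

lemma GL_inv:
  assumes "g \<in> carrier (GL n)"
  shows "inv\<^bsub>GL n\<^esub> g \<in> carrier (GL n)" "inv\<^bsub>GL n\<^esub> g \<in> carrier_mat n n"
    "g * inv\<^bsub>GL n\<^esub> g = 1\<^sub>m n" "inv\<^bsub>GL n\<^esub> g * g = 1\<^sub>m n"
  using group.inv_closed[OF group_GL assms] group.r_inv[OF group_GL assms]
    group.l_inv[OF group_GL assms] GL_carrierD by auto

lemma GL_inv_unique:
  assumes "g \<in> carrier_mat n n" "h \<in> carrier_mat n n" "g * h = 1\<^sub>m n" "h * g = 1\<^sub>m n"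
  shows "inv\<^bsub>GL n\<^esub> g = h"
  using assms by (intro group.inv_equality[OF group_GL]) (auto simp: GL_carrier_iff)

lemma GL_det:
  fixes g :: "'a::field mat"
  assumes "g \<in> carrier (GL n)"
  shows "det g * det (inv\<^bsub>GL n\<^esub> g) = 1" "det g \<noteq> 0" "inverse (det g) = det (inv\<^bsub>GL n\<^esub> g)"
proof -
  show 1: "det g * det (inv\<^bsub>GL n\<^esub> g) = 1"
    using GL_inv[OF assms] GL_carrierD[OF assms] by (metis det_mult det_one)
  then show "det g \<noteq> 0" by auto
  show "inverse (det g) = det (inv\<^bsub>GL n\<^esub> g)" using inverse_unique[OF 1] by simp
qed

definition ev_mat :: "ratfun mat \<Rightarrow> complex \<Rightarrow> complex mat" where
  "ev_mat A x = map_mat (\<lambda>F. ev F x) A"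

definition regular_mat :: "ratfun mat \<Rightarrow> complex \<Rightarrow> bool" where
  "regular_mat A x \<longleftrightarrow> (\<forall>i<dim_row A. \<forall>j<dim_col A. regular_at (A $$ (i, j)) x)"

lemma ev_mat_carrier [simp, intro]: "A \<in> carrier_mat n m \<Longrightarrow> ev_mat A x \<in> carrier_mat n m"
  and ev_mat_dim [simp]: "dim_row (ev_mat A x) = dim_row A" "dim_col (ev_mat A x) = dim_col A"
  and ev_mat_index [simp]:
    "i < dim_row A \<Longrightarrow> j < dim_col A \<Longrightarrow> ev_mat A x $$ (i, j) = ev (A $$ (i, j)) x"
  by (auto simp: ev_mat_def)

lemma MOST_regular_mat: "\<forall>\<^sub>\<infinity>x. regular_mat A x"
proof -
  have "\<forall>\<^sub>\<infinity>x. \<forall>i\<in>{..<dim_row A}. \<forall>j\<in>{..<dim_col A}. regular_at (A $$ (i, j)) x"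
    by (intro eventually_ball_finite ballI MOST_regular) auto
  then show ?thesis by (auto simp: regular_mat_def elim: eventually_mono)
qed

lemma MOST_ev_mat_eqI:
  assumes "A \<in> carrier_mat n m" "\<And>x. M x \<in> carrier_mat n m"
    "\<And>i j. i < n \<Longrightarrow> j < m \<Longrightarrow> \<forall>\<^sub>\<infinity>x. ev (A $$ (i, j)) x = M x $$ (i, j)"
  shows "\<forall>\<^sub>\<infinity>x. ev_mat A x = M x"
proof -
  have "\<forall>\<^sub>\<infinity>x. \<forall>i\<in>{..<n}. \<forall>j\<in>{..<m}. ev (A $$ (i, j)) x = M x $$ (i, j)"
    by (intro eventually_ball_finite ballI assms(3)) auto
  then show ?thesis
  proof eventually_elim
    case (elim x)
    then show ?case using assms(1) assms(2)[of x] by (intro eq_matI) auto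
  qed
qed

lemma ev_mat_mult:
  assumes "A \<in> carrier_mat n k" "B \<in> carrier_mat k m" "regular_mat A x" "regular_mat B x"
  shows "ev_mat (A * B) x = ev_mat A x * ev_mat B x"
proof (rule eq_matI)
  fix i j assume "i < dim_row (ev_mat A x * ev_mat B x)" "j < dim_col (ev_mat A x * ev_mat B x)"
  then have ij: "i < n" "j < m" using assms by auto
  have "ev ((A * B) $$ (i, j)) x = ev (\<Sum>l\<in>{0..<k}. A $$ (i, l) * B $$ (l, j)) x"
    using ij assms by (simp add: scalar_prod_def)
  also have "\<dots> = (\<Sum>l\<in>{0..<k}. ev (A $$ (i, l) * B $$ (l, j)) x)"
    using ij assms by (intro regular_at_sum[THEN conjunct2] regular_at_mult)
      (auto simp: regular_mat_def)
  also have "\<dots> = (\<Sum>l\<in>{0..<k}. ev (A $$ (i, l)) x * ev (B $$ (l, j)) x)"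
    using ij assms by (intro sum.cong refl ev_mult) (auto simp: regular_mat_def)
  also have "\<dots> = (ev_mat A x * ev_mat B x) $$ (i, j)"
    using ij assms by (simp add: scalar_prod_def)
  finally show "ev_mat (A * B) x $$ (i, j) = (ev_mat A x * ev_mat B x) $$ (i, j)"
    using ij assms by simp
qed (use assms in auto)

lemma ev_mat_one: "ev_mat (1\<^sub>m n) x = 1\<^sub>m n"
  by (rule eq_matI) auto

lemma ev_det:
  assumes "A \<in> carrier_mat n n" "regular_mat A x"
  shows "regular_at (det A) x" "ev (det A) x = det (ev_mat A x)"
proof -
  have sg: "regular_at (signof p) x \<and> ev (signof p) x = signof p" for p :: "nat \<Rightarrow> nat"
    using regular_at_uminus[of 1 x] ev_uminus[of 1 x] by (auto simp: sign_def)
  have A: "regular_at (A $$ (i, p i)) x \<and> ev (A $$ (i, p i)) x = ev_mat A x $$ (i, p i)"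
    if "p permutes {0..<n}" "i < n" for p i
  proof -
    have "p i < n" using that permutes_in_image[OF that(1), of i] by auto
    then show ?thesis using that assms by (auto simp: regular_mat_def)
  qed
  have P: "regular_at (\<Prod>i = 0..<n. A $$ (i, p i)) x \<and>
      ev (\<Prod>i = 0..<n. A $$ (i, p i)) x = (\<Prod>i = 0..<n. ev_mat A x $$ (i, p i))"
    if "p permutes {0..<n}" for p
    using regular_at_prod[of "{0..<n}" "\<lambda>i. A $$ (i, p i)" x] A[OF that] by simp
  let ?t = "\<lambda>p. signof p * (\<Prod>i = 0..<n. A $$ (i, p i))"
  have T: "regular_at (?t p) x \<and> ev (?t p) x = signof p * (\<Prod>i = 0..<n. ev_mat A x $$ (i, p i))"
    if "p permutes {0..<n}" for p
    using P[OF that] sg[of p] by (auto simp: regular_at_mult ev_mult)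
  have "regular_at (\<Sum>p | p permutes {0..<n}. ?t p) x \<and>
     ev (\<Sum>p | p permutes {0..<n}. ?t p) x = (\<Sum>p | p permutes {0..<n}. ev (?t p) x)"
    using T by (intro regular_at_sum) auto
  also have "(\<Sum>p | p permutes {0..<n}. ev (?t p) x) = det (ev_mat A x)"
    using T assms(1) det_def'[OF ev_mat_carrier[OF assms(1), of x]] by (simp add: P)
  finally show "regular_at (det A) x" "ev (det A) x = det (ev_mat A x)"
    using assms(1) by (simp_all add: det_def')
qed

text \<open>The determinant must not vanish at the point because the variable \<open>None\<close>
  stands for its inverse.\<close>

lemma regular_gl_eval:
  assumes "A \<in> carrier_mat n n" "regular_mat A x" "det (ev_mat A x) \<noteq> 0"
  shows "regular_at (gl_eval ratfun_const p A) x \<and> ev (gl_eval ratfun_const p A) x = reg p (ev_mat A x)"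
proof -
  have c: "regular_at (gl_coord A v) x \<and> ev (gl_coord A v) x = gl_coord (ev_mat A x) v" for v
    using assms ev_det[OF assms(1,2)]
    by (auto simp: gl_coord_def regular_mat_def ev_inverse regular_at_inverse split: option.splits)
  have "regular_at (\<Prod>v\<in>Poly_Mapping.keys m. gl_coord A v ^ Poly_Mapping.lookup m v) x \<and>
      ev (\<Prod>v\<in>Poly_Mapping.keys m. gl_coord A v ^ Poly_Mapping.lookup m v) x =
      (\<Prod>v\<in>Poly_Mapping.keys m. gl_coord (ev_mat A x) v ^ Poly_Mapping.lookup m v)" for m
    using regular_at_prod[of "Poly_Mapping.keys m" "\<lambda>v. gl_coord A v ^ Poly_Mapping.lookup m v" x] c
    by (simp add: regular_at_power)
  then have t: "regular_at (ratfun_const (Poly_Mapping.lookup p m) *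
      (\<Prod>v\<in>Poly_Mapping.keys m. gl_coord A v ^ Poly_Mapping.lookup m v)) x \<and>
    ev (ratfun_const (Poly_Mapping.lookup p m) *
      (\<Prod>v\<in>Poly_Mapping.keys m. gl_coord A v ^ Poly_Mapping.lookup m v)) x =
    Poly_Mapping.lookup p m *
      (\<Prod>v\<in>Poly_Mapping.keys m. gl_coord (ev_mat A x) v ^ Poly_Mapping.lookup m v)" for m
    by (auto simp: regular_at_mult ev_mult)
  then show ?thesis
    using regular_at_sum[of "Poly_Mapping.keys p" "\<lambda>m. ratfun_const (Poly_Mapping.lookup p m) *
      (\<Prod>v \<in> Poly_Mapping.keys m. gl_coord A v ^ Poly_Mapping.lookup m v)" x]
    unfolding gl_eval_def by simp
qed

text \<open>The finitely many exceptional points must not depend on \<open>p\<close>, because infinitely many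
  \<open>p\<close> may be needed to cut out a group.\<close>

lemma MOST_gl_eval:
  assumes "A \<in> carrier (GL n)"
  shows "\<forall>\<^sub>\<infinity>x. \<forall>p. ev (gl_eval ratfun_const p A) x = reg p (ev_mat A x)"
proof -
  have A: "A \<in> carrier_mat n n" by (rule GL_carrierD[OF assms])
  from MOST_nonzero_ev[OF GL_det(2)[OF assms]] MOST_regular_mat[of A] show ?thesis
  proof eventually_elim
    case (elim x)
    then have "det (ev_mat A x) \<noteq> 0" using ev_det(2)[OF A] by simp
    from regular_gl_eval[OF A elim(2) this] show ?case by simp
  qed
qed

lemma MOST_ev_mat_GL:
  assumes "A \<in> carrier (GL n)"
  shows "\<forall>\<^sub>\<infinity>x. ev_mat A x \<in> carrier (GL n) \<and> inv\<^bsub>GL n\<^esub> (ev_mat A x) = ev_mat (inv\<^bsub>GL n\<^esub> A) x"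
  using MOST_regular_mat[of A] MOST_regular_mat[of "inv\<^bsub>GL n\<^esub> A"]
proof eventually_elim
  case (elim x)
  note A = GL_carrierD[OF assms] and B = GL_inv[OF assms]
  have "ev_mat A x * ev_mat (inv\<^bsub>GL n\<^esub> A) x = 1\<^sub>m n" "ev_mat (inv\<^bsub>GL n\<^esub> A) x * ev_mat A x = 1\<^sub>m n"
    using ev_mat_mult[OF A B(2) elim] ev_mat_mult[OF B(2) A elim(2,1)] B by (simp_all add: ev_mat_one)
  with A B show ?case by (auto simp: GL_carrier_iff intro!: GL_inv_unique)
qed

text \<open>\<open>zariski_closed\<close> provides some defining set S, while
  \<open>ratfun_points\<close> uses the whole ideal \<open>vanishing K\<close>. As S lies in that
  ideal, a point of K(z) has almost all of its values in K; conversely a function in the ideal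
  vanishes at almost all values and so vanishes as a rational function.\<close>

lemma ratfun_points_iff:
  assumes "zariski_closed n K" "A \<in> carrier_mat n n"
  shows "A \<in> ratfun_points n K \<longleftrightarrow> (\<forall>\<^sub>\<infinity>x. ev_mat A x \<in> K)"
proof
  from assms(1) obtain S where S: "K = {g \<in> carrier (GL n). \<forall>p\<in>S. reg p g = 0}"
    by (auto simp: zariski_closed_def)
  assume "A \<in> ratfun_points n K"
  then have A: "A \<in> carrier (GL n)" "\<And>p. p \<in> vanishing K \<Longrightarrow> gl_eval ratfun_const p A = 0"
    by (auto simp: ratfun_points_def)
  have "S \<subseteq> vanishing K" by (auto simp: S vanishing_def)
  with A(2) have 0: "\<And>p. p \<in> S \<Longrightarrow> gl_eval ratfun_const p A = 0" by auto
  from MOST_gl_eval[OF A(1)] MOST_ev_mat_GL[OF A(1)]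
  show "\<forall>\<^sub>\<infinity>x. ev_mat A x \<in> K"
  proof eventually_elim
    case (elim x)
    have "reg p (ev_mat A x) = 0" if "p \<in> S" for p
      using elim(1)[rule_format, of p] 0[OF that] by simp
    with elim(2) show ?case by (simp add: S)
  qed
next
  assume K: "\<forall>\<^sub>\<infinity>x. ev_mat A x \<in> K"
  have KG: "K \<subseteq> carrier (GL n)" using assms(1) by (auto simp: zariski_closed_def)
  \<comment> \<open>Here A is only known to be a square matrix. Invertibility comes from its values:
    they lie in K, hence have nonzero determinant.\<close>
  have "det A \<noteq> 0"
  proof
    assume 0: "det A = 0"
    from K MOST_regular_mat[of A] have "\<forall>\<^sub>\<infinity>x::complex. False"
    proof eventually_elim
      case (elim x)
      then show ?case
        using 0 ev_det(2)[OF assms(2), of x] GL_det(2)[of "ev_mat A x" n] KG by auto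
    qed
    then show False using MOST_False_complex by blast
  qed
  then have A: "A \<in> carrier (GL n)"
    using det_non_zero_imp_unit[OF assms(2), of "()"] unfolding GL_def units_of_def by simp
  moreover have "gl_eval ratfun_const p A = 0" if "p \<in> vanishing K" for p
  proof (rule ev_eq_0_imp)
    show "\<forall>\<^sub>\<infinity>x. ev (gl_eval ratfun_const p A) x = 0"
      using K MOST_gl_eval[OF A] by eventually_elim (use that in \<open>auto simp: vanishing_def\<close>)
  qed
  ultimately show "A \<in> ratfun_points n K" by (simp add: ratfun_points_def)
qed

subsection \<open>Algebras of functions on matrices\<close>

text \<open>Polynomial, Laurent and regular functions, and functions with a chain rule at the
  identity, are closed under the same operations. A class of this kind that contains the entries and
  the inverse determinant of a family of matrices contains every regular function of the family.
  Values off D are ignored.\<close>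

locale function_algebra =
  fixes D :: "'b set" and C :: "('b \<Rightarrow> complex) \<Rightarrow> bool"
  assumes cong: "C f \<Longrightarrow> (\<And>t. t \<in> D \<Longrightarrow> f t = g t) \<Longrightarrow> C g"
    and const: "C (\<lambda>_. c)"
    and add: "C f \<Longrightarrow> C g \<Longrightarrow> C (\<lambda>t. f t + g t)"
    and mult: "C f \<Longrightarrow> C g \<Longrightarrow> C (\<lambda>t. f t * g t)"
begin

lemma sum: "(\<And>i. i \<in> A \<Longrightarrow> C (f i)) \<Longrightarrow> C (\<lambda>t. \<Sum>i\<in>A. f i t)"
  by (induction A rule: infinite_finite_induct) (auto intro: const add)

lemma prod: "(\<And>i. i \<in> A \<Longrightarrow> C (f i)) \<Longrightarrow> C (\<lambda>t. \<Prod>i\<in>A. f i t)"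
  by (induction A rule: infinite_finite_induct) (auto intro: const mult)

lemma power: "C f \<Longrightarrow> C (\<lambda>t. f t ^ k)"
  by (induction k) (auto intro: const mult)

lemma det:
  assumes "\<And>t. t \<in> D \<Longrightarrow> X t \<in> carrier_mat n n"
    and "\<And>a b. a < n \<Longrightarrow> b < n \<Longrightarrow> C (\<lambda>t. X t $$ (a, b))"
  shows "C (\<lambda>t. det (X t))"
proof (rule cong)
  show "C (\<lambda>t. \<Sum>p | p permutes {0..<n}. signof p * (\<Prod>i = 0..<n. X t $$ (i, p i)))"
  proof (intro sum mult const prod assms(2))
    fix p i assume "p \<in> {p. p permutes {0..<n}}" "i \<in> {0..<n}"
    then show "i < n" "p i < n" using permutes_in_image[of p "{0..<n}" i] by auto
  qed
  show "(\<Sum>p | p permutes {0..<n}. signof p * (\<Prod>i = 0..<n. X t $$ (i, p i))) = det (X t)"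
    if "t \<in> D" for t
    using det_def'[OF assms(1)[OF that]] by simp
qed

lemma reg:
  assumes X: "\<And>t. t \<in> D \<Longrightarrow> X t \<in> carrier_mat n n"
    and e: "\<And>a b. a < n \<Longrightarrow> b < n \<Longrightarrow> C (\<lambda>t. X t $$ (a, b))"
    and d: "C (\<lambda>t. inverse (det (X t)))"
  shows "C (\<lambda>t. reg p (X t))"
proof -
  have "C (\<lambda>t. gl_coord (X t) v)" for v
  proof (cases v)
    case None then show ?thesis using d by (simp add: gl_coord_def)
  next
    case (Some ab)
    obtain a b where ab: "ab = (a, b)" by fastforce
    show ?thesis
    proof (cases "a < n \<and> b < n")
      case True
      then have "C (\<lambda>t. X t $$ (a, b))" using e by blast
      then show ?thesis
        by (rule cong) (use X True in \<open>auto simp: gl_coord_def Some ab\<close>)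
    next
      case False
      show ?thesis by (rule cong[OF const[of 0]]) (use X False in \<open>auto simp: gl_coord_def Some ab\<close>)
    qed
  qed
  then show ?thesis
    unfolding gl_eval_def by (intro sum mult const prod power)
qed

lemma mult_mat:
  assumes "\<And>t. t \<in> D \<Longrightarrow> X t \<in> carrier_mat n k" "\<And>t. t \<in> D \<Longrightarrow> Y t \<in> carrier_mat k m"
    and "\<And>a b. a < n \<Longrightarrow> b < k \<Longrightarrow> C (\<lambda>t. X t $$ (a, b))"
    and "\<And>a b. a < k \<Longrightarrow> b < m \<Longrightarrow> C (\<lambda>t. Y t $$ (a, b))"
    and "a < n" "b < m"
  shows "C (\<lambda>t. (X t * Y t) $$ (a, b))"
proof (rule cong)
  show "C (\<lambda>t. \<Sum>l\<in>{0..<k}. X t $$ (a, l) * Y t $$ (l, b))"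
    by (intro sum mult assms) (use assms(5,6) in auto)
  show "(\<Sum>l\<in>{0..<k}. X t $$ (a, l) * Y t $$ (l, b)) = (X t * Y t) $$ (a, b)" if "t \<in> D" for t
    using assms(1,2)[OF that] assms(5,6) by (simp add: scalar_prod_def)
qed

end

definition poly_fun :: "(complex \<Rightarrow> complex) \<Rightarrow> bool" where
  "poly_fun f \<longleftrightarrow> (\<exists>p. \<forall>s. f s = poly p s)"

text \<open>The power \<open>t ^ N\<close> clears the pole at 0. The value at 0 itself stays free,
  since \<open>inverse 0 = 0\<close> makes it meaningless.\<close>

definition laurent_fun :: "(complex \<Rightarrow> complex) \<Rightarrow> bool" where
  "laurent_fun f \<longleftrightarrow> (\<exists>p N. \<forall>t. t \<noteq> 0 \<longrightarrow> f t * t ^ N = poly p t)"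

definition regular_fun :: "nat \<Rightarrow> (complex mat \<Rightarrow> complex) \<Rightarrow> bool" where
  "regular_fun n f \<longleftrightarrow> (\<exists>p. \<forall>g\<in>carrier (GL n). f g = reg p g)"

interpretation poly_fun: function_algebra UNIV poly_fun
proof
  fix f g :: "complex \<Rightarrow> complex" and c
  show "poly_fun f \<Longrightarrow> (\<And>t. t \<in> UNIV \<Longrightarrow> f t = g t) \<Longrightarrow> poly_fun g"
    by (auto simp: poly_fun_def)
  show "poly_fun (\<lambda>_. c)" unfolding poly_fun_def by (rule exI[of _ "[:c:]"]) simp
  assume "poly_fun f" "poly_fun g"
  then obtain p q where pq: "\<And>s. f s = poly p s" "\<And>s. g s = poly q s" by (auto simp: poly_fun_def)
  show "poly_fun (\<lambda>t. f t + g t)" unfolding poly_fun_def by (rule exI[of _ "p + q"]) (simp add: pq)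
  show "poly_fun (\<lambda>t. f t * g t)" unfolding poly_fun_def by (rule exI[of _ "p * q"]) (simp add: pq)
qed

lemma poly_fun_ident: "poly_fun (\<lambda>s. s)"
  unfolding poly_fun_def by (rule exI[of _ "[:0, 1:]"]) simp

interpretation laurent_fun: function_algebra "- {0}" laurent_fun
proof
  fix f g :: "complex \<Rightarrow> complex" and c
  show "laurent_fun f \<Longrightarrow> (\<And>t. t \<in> - {0} \<Longrightarrow> f t = g t) \<Longrightarrow> laurent_fun g"
    unfolding laurent_fun_def by simp
  show "laurent_fun (\<lambda>_. c)"
    unfolding laurent_fun_def by (rule exI[of _ "[:c:]"], rule exI[of _ 0]) simp
  assume "laurent_fun f" "laurent_fun g"
  then obtain p q N M where pq: "\<And>t. t \<noteq> 0 \<Longrightarrow> f t * t ^ N = poly p t"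
      "\<And>t. t \<noteq> 0 \<Longrightarrow> g t * t ^ M = poly q t"
    by (auto simp: laurent_fun_def)
  show "laurent_fun (\<lambda>t. f t + g t)" unfolding laurent_fun_def
    by (rule exI[of _ "p * monom 1 M + q * monom 1 N"], rule exI[of _ "N + M"])
      (auto simp: poly_monom power_add algebra_simps simp flip: pq)
  show "laurent_fun (\<lambda>t. f t * g t)" unfolding laurent_fun_def
    by (rule exI[of _ "p * q"], rule exI[of _ "N + M"])
      (auto simp: power_add algebra_simps simp flip: pq)
qed

lemma laurent_fun_ident: "laurent_fun (\<lambda>t. t)"
  unfolding laurent_fun_def by (rule exI[of _ "[:0, 1:]"], rule exI[of _ 0]) simp

lemma laurent_fun_inverse: "laurent_fun (\<lambda>t. inverse t)"
  unfolding laurent_fun_def by (rule exI[of _ 1], rule exI[of _ 1]) simp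

definition monomial_value :: "complex mat \<Rightarrow> ((nat \<times> nat) option \<Rightarrow>\<^sub>0 nat) \<Rightarrow> complex" where
  "monomial_value g m = (\<Prod>v \<in> Poly_Mapping.keys m. gl_coord g v ^ Poly_Mapping.lookup m v)"

lemma reg_superset:
  assumes "finite A" "Poly_Mapping.keys p \<subseteq> A"
  shows "reg p g = (\<Sum>m\<in>A. Poly_Mapping.lookup p m * monomial_value g m)"
  unfolding gl_eval_def monomial_value_def[symmetric]
  by (rule sum.mono_neutral_left) (use assms in \<open>auto simp: in_keys_iff\<close>)

lemma monomial_value_superset:
  assumes "finite A" "Poly_Mapping.keys m \<subseteq> A"
  shows "monomial_value g m = (\<Prod>v\<in>A. gl_coord g v ^ Poly_Mapping.lookup m v)"
  unfolding monomial_value_def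
  by (rule prod.mono_neutral_left) (use assms in \<open>auto simp: in_keys_iff\<close>)

lemma monomial_value_add: "monomial_value g (m + m') = monomial_value g m * monomial_value g m'"
proof -
  let ?A = "Poly_Mapping.keys m \<union> Poly_Mapping.keys m'"
  have "Poly_Mapping.keys (m + m') \<subseteq> ?A" by (rule keys_add)
  then show ?thesis
    using monomial_value_superset[of ?A m g] monomial_value_superset[of ?A m' g]
      monomial_value_superset[of ?A "m + m'" g]
    by (simp add: lookup_add power_add prod.distrib)
qed

lemma reg_add: "reg (p + q) g = reg p g + reg q g"
proof -
  let ?A = "Poly_Mapping.keys p \<union> Poly_Mapping.keys q"
  have "Poly_Mapping.keys (p + q) \<subseteq> ?A" by (rule keys_add)
  then show ?thesis
    using reg_superset[of ?A p g] reg_superset[of ?A q g] reg_superset[of ?A "p + q" g]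
    by (simp add: lookup_add algebra_simps sum.distrib)
qed

lemma reg_single: "reg (Poly_Mapping.single m c) g = c * monomial_value g m"
  using reg_superset[of "{m}" "Poly_Mapping.single m c" g] by simp

lemma reg_zero: "reg 0 g = 0"
  by (simp add: gl_eval_def)

lemma reg_sum: "reg (\<Sum>i\<in>A. p i) g = (\<Sum>i\<in>A. reg (p i) g)"
  by (induction A rule: infinite_finite_induct) (auto simp: reg_zero reg_add)

lemma gl_fun_as_sum:
  fixes p :: gl_fun
  shows "p = (\<Sum>m\<in>Poly_Mapping.keys p. Poly_Mapping.single m (Poly_Mapping.lookup p m))"
  by (rule poly_mapping_eqI)
    (auto simp: lookup_sum lookup_single when_def in_keys_iff)

lemma reg_mult: "reg (p * q) g = reg p g * reg q g"
proof -
  let ?s = "\<lambda>r m. Poly_Mapping.single m (Poly_Mapping.lookup r m)"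
  have "p * q = (\<Sum>m\<in>Poly_Mapping.keys p. \<Sum>m'\<in>Poly_Mapping.keys q. ?s p m * ?s q m')"
    by (subst gl_fun_as_sum[of p], subst gl_fun_as_sum[of q]) (rule sum_product)
  then have "reg (p * q) g = (\<Sum>m\<in>Poly_Mapping.keys p. \<Sum>m'\<in>Poly_Mapping.keys q.
      reg (?s p m) g * reg (?s q m') g)"
    by (simp add: reg_sum mult_single reg_single monomial_value_add algebra_simps)
  also have "\<dots> = reg p g * reg q g"
    by (simp add: sum_product[symmetric] reg_single) (simp add: gl_eval_def monomial_value_def)
  finally show ?thesis .
qed

interpretation regular_fun: function_algebra "carrier (GL n)" "regular_fun n"
proof
  fix f g :: "complex mat \<Rightarrow> complex" and c
  show "regular_fun n f \<Longrightarrow> (\<And>t. t \<in> carrier (GL n) \<Longrightarrow> f t = g t) \<Longrightarrow> regular_fun n g"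
    by (auto simp: regular_fun_def)
  show "regular_fun n (\<lambda>_. c)" unfolding regular_fun_def
    by (rule exI[of _ "Poly_Mapping.single 0 c"]) (simp add: reg_single monomial_value_def)
  assume "regular_fun n f" "regular_fun n g"
  then obtain p q where pq: "\<And>s. s \<in> carrier (GL n) \<Longrightarrow> f s = reg p s"
      "\<And>s. s \<in> carrier (GL n) \<Longrightarrow> g s = reg q s" by (auto simp: regular_fun_def)
  show "regular_fun n (\<lambda>t. f t + g t)" unfolding regular_fun_def
    by (rule exI[of _ "p + q"]) (simp add: pq reg_add)
  show "regular_fun n (\<lambda>t. f t * g t)" unfolding regular_fun_def
    by (rule exI[of _ "p * q"]) (simp add: pq reg_mult)
qed

lemma regular_fun_reg: "regular_fun n (reg p)"
  by (auto simp: regular_fun_def)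

lemma regular_fun_coord: "regular_fun n (\<lambda>g. gl_coord g v)"
  unfolding regular_fun_def
  by (rule exI[of _ "Poly_Mapping.single (Poly_Mapping.single v 1) 1"])
    (simp add: reg_single monomial_value_def)

lemma regular_fun_entry: "a < n \<Longrightarrow> b < n \<Longrightarrow> regular_fun n (\<lambda>g. g $$ (a, b))"
  by (rule regular_fun.cong[OF regular_fun_coord[of n "Some (a, b)"]])
    (auto simp: gl_coord_def dest: GL_carrierD)

lemma regular_fun_inverse_det: "regular_fun n (\<lambda>g. inverse (det g))"
  by (rule regular_fun.cong[OF regular_fun_coord[of n None]]) (auto simp: gl_coord_def)

lemma GL_inv_adj:
  fixes g :: "complex mat"
  assumes "g \<in> carrier (GL n)"
  shows "inv\<^bsub>GL n\<^esub> g = inverse (det g) \<cdot>\<^sub>m adj_mat g"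
proof (rule GL_inv_unique)
  have g: "g \<in> carrier_mat n n" and d: "det g \<noteq> 0" using assms by (auto simp: GL_carrierD GL_det)
  note a = adj_mat[OF g]
  have 1: "inverse (det g) \<cdot>\<^sub>m (det g \<cdot>\<^sub>m 1\<^sub>m n) = 1\<^sub>m n"
    by (rule eq_matI) (use d in auto)
  show "g \<in> carrier_mat n n" "inverse (det g) \<cdot>\<^sub>m adj_mat g \<in> carrier_mat n n" using g a by auto
  show "g * (inverse (det g) \<cdot>\<^sub>m adj_mat g) = 1\<^sub>m n"
    using mult_smult_distrib[OF g a(1), of "inverse (det g)"] a(2) 1 by simp
  show "inverse (det g) \<cdot>\<^sub>m adj_mat g * g = 1\<^sub>m n"
    using mult_smult_assoc_mat[OF a(1) g, of "inverse (det g)"] a(3) 1 by simp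
qed

text \<open>Inversion is regular by the adjugate formula. This supplies a \<open>gl_fun\<close> for
  weights with negative exponents, because \<open>is_root\<close> speaks of regular functions and
  not of abstract characters.\<close>

lemma regular_fun_inv: "regular_fun n (\<lambda>g. reg p (inv\<^bsub>GL n\<^esub> g))"
proof (rule regular_fun.reg)
  show "inv\<^bsub>GL n\<^esub> g \<in> carrier_mat n n" if "g \<in> carrier (GL n)" for g :: "complex mat"
    using GL_inv[OF that] by simp
  have "regular_fun n det"
    by (rule regular_fun.det[of n "\<lambda>g. g"]) (auto intro: GL_carrierD regular_fun_entry)
  then show "regular_fun n (\<lambda>g. inverse (det (inv\<^bsub>GL n\<^esub> g)))"
    by (rule regular_fun.cong) (use GL_det(3) in \<open>metis inverse_inverse_eq\<close>)
  fix a b assume ab: "a < n" "b < n"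
  have "regular_fun n (\<lambda>g. det (mat_delete g b a))"
  proof (rule regular_fun.det)
    show "mat_delete g b a \<in> carrier_mat (n - 1) (n - 1)" if "g \<in> carrier (GL n)" for g :: "complex mat"
      using mat_delete_carrier[OF GL_carrierD[OF that]] .
    fix i j assume ij: "i < n - 1" "j < n - 1"
    show "regular_fun n (\<lambda>g. mat_delete g b a $$ (i, j))"
      by (rule regular_fun.cong[OF regular_fun_entry[of "if i < b then i else Suc i" n
            "if j < a then j else Suc j"]])
        (use ij in \<open>auto simp: mat_delete_def dest!: GL_carrierD\<close>)
  qed
  then have "regular_fun n (\<lambda>g. inverse (det g) * ((-1) ^ (b + a) * det (mat_delete g b a)))"
    by (intro regular_fun.mult regular_fun_inverse_det regular_fun.const)
  then show "regular_fun n (\<lambda>g. (inv\<^bsub>GL n\<^esub> g) $$ (a, b))"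
    by (rule regular_fun.cong)
      (use ab in \<open>auto simp: GL_inv_adj adj_mat_def cofactor_def dest: GL_carrierD\<close>)
qed

subsection \<open>Differentials along curves\<close>

definition mat_deriv ::
  "nat \<Rightarrow> nat \<Rightarrow> (complex \<Rightarrow> complex mat) \<Rightarrow> complex mat \<Rightarrow> complex \<Rightarrow> bool" where
  "mat_deriv n m X Y t \<longleftrightarrow> (\<forall>s. X s \<in> carrier_mat n m) \<and> Y \<in> carrier_mat n m \<and>
    (\<forall>a<n. \<forall>b<m. ((\<lambda>s. X s $$ (a, b)) has_field_derivative Y $$ (a, b)) (at t))"

lemma mat_derivI:
  assumes "\<And>s. X s \<in> carrier_mat n m" "Y \<in> carrier_mat n m"
    "\<And>a b. a < n \<Longrightarrow> b < m \<Longrightarrow> ((\<lambda>s. X s $$ (a, b)) has_field_derivative Y $$ (a, b)) (at t)"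
  shows "mat_deriv n m X Y t"
  using assms by (auto simp: mat_deriv_def)

lemma mat_derivD:
  assumes "mat_deriv n m X Y t"
  shows "X s \<in> carrier_mat n m" "Y \<in> carrier_mat n m"
    "a < n \<Longrightarrow> b < m \<Longrightarrow> ((\<lambda>s. X s $$ (a, b)) has_field_derivative Y $$ (a, b)) (at t)"
  using assms by (auto simp: mat_deriv_def)

lemma mat_deriv_unique:
  assumes "mat_deriv n m X Y t" "mat_deriv n m X' Y' t" "\<forall>\<^sub>F s in nhds t. X s = X' s"
  shows "Y = Y'"
proof (rule eq_matI)
  fix a b assume "a < dim_row Y'" "b < dim_col Y'"
  then have ab: "a < n" "b < m" using mat_derivD(2)[OF assms(2)] by auto
  have "\<forall>\<^sub>F s in nhds t. X s $$ (a, b) = X' s $$ (a, b)"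
    using assms(3) by eventually_elim simp
  then have "((\<lambda>s. X s $$ (a, b)) has_field_derivative Y' $$ (a, b)) (at t)"
    using DERIV_cong_ev[OF refl _ refl, of "\<lambda>s. X s $$ (a, b)" "\<lambda>s. X' s $$ (a, b)"]
      mat_derivD(3)[OF assms(2) ab] by simp
  with mat_derivD(3)[OF assms(1) ab] show "Y $$ (a, b) = Y' $$ (a, b)" by (rule DERIV_unique)
qed (use mat_derivD(2)[OF assms(1)] mat_derivD(2)[OF assms(2)] in auto)

lemma mat_deriv_const: "A \<in> carrier_mat n m \<Longrightarrow> mat_deriv n m (\<lambda>_. A) (0\<^sub>m n m) t"
  by (rule mat_derivI) auto

lemma mat_deriv_mult:
  assumes "mat_deriv n k X X' t" "mat_deriv k m Z Z' t"
  shows "mat_deriv n m (\<lambda>s. X s * Z s) (X' * Z t + X t * Z') t"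
proof (rule mat_derivI)
  note X = mat_derivD[OF assms(1)] and Z = mat_derivD[OF assms(2)]
  show "X s * Z s \<in> carrier_mat n m" for s using X(1) Z(1) by (rule mult_carrier_mat)
  show "X' * Z t + X t * Z' \<in> carrier_mat n m"
    using mult_carrier_mat[OF X(2) Z(1)] mult_carrier_mat[OF X(1) Z(2)] by auto
  fix a b assume ab: "a < n" "b < m"
  have 1: "(X s * Z s) $$ (a, b) = (\<Sum>l\<in>{0..<k}. X s $$ (a, l) * Z s $$ (l, b))" for s
    using ab X(1)[of s] Z(1)[of s] by (simp add: scalar_prod_def)
  have 2: "(X' * Z t + X t * Z') $$ (a, b) =
      (\<Sum>l\<in>{0..<k}. X' $$ (a, l) * Z t $$ (l, b) + Z' $$ (l, b) * X t $$ (a, l))"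
    using ab X(1)[of t] X(2) Z(1)[of t] Z(2)
    by (simp add: scalar_prod_def sum.distrib mult.commute)
  show "((\<lambda>s. (X s * Z s) $$ (a, b)) has_field_derivative (X' * Z t + X t * Z') $$ (a, b)) (at t)"
    unfolding 1 2 using ab X(3) Z(3) by (intro DERIV_sum DERIV_mult) auto
qed

lemma mat_deriv_mult_left:
  assumes "A \<in> carrier_mat n k" "mat_deriv k m Z Z' t"
  shows "mat_deriv n m (\<lambda>s. A * Z s) (A * Z') t"
  using mat_deriv_mult[OF mat_deriv_const[OF assms(1)] assms(2)] assms
    mat_derivD(1)[OF assms(2), of t] mult_carrier_mat[OF assms(1) mat_derivD(2)[OF assms(2)]]
  by simp

lemma mat_deriv_mult_right:
  assumes "mat_deriv n k Z Z' t" "A \<in> carrier_mat k m"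
  shows "mat_deriv n m (\<lambda>s. Z s * A) (Z' * A) t"
  using mat_deriv_mult[OF assms(1) mat_deriv_const[OF assms(2)]] assms
    mat_derivD(1)[OF assms(1), of t] mult_carrier_mat[OF mat_derivD(2)[OF assms(1)] assms(2)]
  by simp

text \<open>A chain rule at the identity, tested on curves through it; L is the differential. The
  mere existence of L is stable under sums and products, which is enough to reach every regular
  function.\<close>

definition diff_at_one :: "nat \<Rightarrow> (complex mat \<Rightarrow> complex) \<Rightarrow> (nat \<Rightarrow> nat \<Rightarrow> complex) \<Rightarrow> bool" where
  "diff_at_one n f L \<longleftrightarrow> (\<forall>X Y t. mat_deriv n n X Y t \<and> X t = 1\<^sub>m n \<longrightarrow>
     ((\<lambda>s. f (X s)) has_field_derivative (\<Sum>a<n. \<Sum>b<n. L a b * Y $$ (a, b))) (at t))"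

interpretation diff_at_one: function_algebra "carrier_mat n n" "\<lambda>f. \<exists>L. diff_at_one n f L"
proof
  fix f g :: "complex mat \<Rightarrow> complex" and c
  show "\<exists>L. diff_at_one n f L \<Longrightarrow> (\<And>t. t \<in> carrier_mat n n \<Longrightarrow> f t = g t) \<Longrightarrow> \<exists>L. diff_at_one n g L"
    unfolding diff_at_one_def mat_deriv_def by simp
  have "diff_at_one n (\<lambda>_. c) (\<lambda>_ _. 0)" by (simp add: diff_at_one_def)
  then show "\<exists>L. diff_at_one n (\<lambda>_. c) L" by blast
  assume "\<exists>L. diff_at_one n f L" "\<exists>L. diff_at_one n g L"
  then obtain L M where LM: "diff_at_one n f L" "diff_at_one n g M" by blast
  have "diff_at_one n (\<lambda>t. f t + g t) (\<lambda>a b. L a b + M a b)"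
    using LM unfolding diff_at_one_def
    by (auto simp: algebra_simps sum.distrib intro!: DERIV_add)
  then show "\<exists>L. diff_at_one n (\<lambda>t. f t + g t) L" by blast
  have "diff_at_one n (\<lambda>t. f t * g t) (\<lambda>a b. L a b * g (1\<^sub>m n) + M a b * f (1\<^sub>m n))"
    unfolding diff_at_one_def
  proof (intro allI impI, elim conjE)
    fix X Y t assume X: "mat_deriv n n X Y t" "X t = 1\<^sub>m n"
    have "((\<lambda>s. f (X s) * g (X s)) has_field_derivative
        (\<Sum>a<n. \<Sum>b<n. L a b * Y $$ (a, b)) * g (X t) + (\<Sum>a<n. \<Sum>b<n. M a b * Y $$ (a, b)) * f (X t)) (at t)"
      using LM X unfolding diff_at_one_def by (intro DERIV_mult) blast+
    then show "((\<lambda>s. f (X s) * g (X s)) has_field_derivative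
        (\<Sum>a<n. \<Sum>b<n. (L a b * g (1\<^sub>m n) + M a b * f (1\<^sub>m n)) * Y $$ (a, b))) (at t)"
      by (simp add: X sum_distrib_left sum_distrib_right sum.distrib algebra_simps)
  qed
  then show "\<exists>L. diff_at_one n (\<lambda>t. f t * g t) L" by blast
qed

lemma diff_at_one_entry: "a < n \<Longrightarrow> b < n \<Longrightarrow> \<exists>L. diff_at_one n (\<lambda>g. g $$ (a, b)) L"
proof (rule exI[of _ "\<lambda>a' b'. if a' = a then if b' = b then 1 else 0 else 0"])
  assume ab: "a < n" "b < n"
  have "(\<Sum>a'<n. \<Sum>b'<n. (if a' = a then if b' = b then 1 else 0 else 0) * Y $$ (a', b')) = Y $$ (a, b)"
    for Y :: "complex mat"
  proof -
    have "(\<Sum>b'<n. (if a' = a then if b' = b then 1 else 0 else 0) * Y $$ (a', b')) =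
      (if a' = a then Y $$ (a, b) else 0)" for a'
    proof (cases "a' = a")
      case True
      have "(\<Sum>b'<n. (if b' = b then 1 else 0) * Y $$ (a, b')) = (\<Sum>b'<n. if b' = b then Y $$ (a, b') else 0)"
        by (intro sum.cong) auto
      then show ?thesis using True ab by simp
    qed simp
    then show ?thesis using ab by simp
  qed
  then show "diff_at_one n (\<lambda>g. g $$ (a, b)) (\<lambda>a' b'. if a' = a then if b' = b then 1 else 0 else 0)"
    using ab by (auto simp: diff_at_one_def mat_deriv_def)
qed

lemma diff_at_one_inverse:
  assumes "\<exists>L. diff_at_one n f L" "f (1\<^sub>m n) \<noteq> 0"
  shows "\<exists>L. diff_at_one n (\<lambda>g. inverse (f g)) L"
proof -
  obtain L where L: "diff_at_one n f L" using assms by blast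
  have "diff_at_one n (\<lambda>g. inverse (f g)) (\<lambda>a b. - inverse (f (1\<^sub>m n) ^ 2) * L a b)"
    unfolding diff_at_one_def
  proof (intro allI impI, elim conjE)
    fix X Y t assume X: "mat_deriv n n X Y t" "X t = 1\<^sub>m n"
    have "((\<lambda>s. f (X s)) has_field_derivative (\<Sum>a<n. \<Sum>b<n. L a b * Y $$ (a, b))) (at t)"
      using L X unfolding diff_at_one_def by blast
    from DERIV_inverse_fun[OF this] show "((\<lambda>s. inverse (f (X s))) has_field_derivative
        (\<Sum>a<n. \<Sum>b<n. (- inverse (f (1\<^sub>m n) ^ 2) * L a b) * Y $$ (a, b))) (at t)"
      using assms(2)
      by (simp add: X sum_distrib_left sum_negf power2_eq_square mult_ac)
  qed
  then show ?thesis by blast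
qed

lemma reg_has_derivative:
  assumes X: "mat_deriv n n X Y t" "X t = 1\<^sub>m n"
  shows "((\<lambda>s. reg p (X s)) has_field_derivative gl_diff (\<lambda>c. c) p Y) (at t)"
proof -
  have "\<exists>L. diff_at_one n (\<lambda>g. inverse (det g)) L"
    by (intro diff_at_one_inverse diff_at_one.det[of n "\<lambda>g. g"] diff_at_one_entry) auto
  then have "\<exists>L. diff_at_one n (reg p) L"
    by (intro diff_at_one.reg[of n "\<lambda>g. g"] diff_at_one_entry) auto
  then obtain L where L: "diff_at_one n (reg p) L" by blast
  \<comment> \<open>Testing on the lines through the identity in coordinate directions identifies L
    with the partial derivatives in \<open>gl_diff\<close>.\<close>
  have "deriv (\<lambda>t. reg p (1\<^sub>m n + t \<cdot>\<^sub>m unit_mat n a b)) 0 = L a b" if ab: "a < n" "b < n" for a b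
  proof (rule DERIV_imp_deriv)
    have "mat_deriv n n (\<lambda>t. 1\<^sub>m n + t \<cdot>\<^sub>m unit_mat n a b) (unit_mat n a b) 0"
    proof (rule mat_derivI)
      fix i j assume ij: "i < n" "j < n"
      have "((\<lambda>s. (if i = j then 1 else 0) + s * unit_mat n a b $$ (i, j)) has_field_derivative
        unit_mat n a b $$ (i, j)) (at 0)"
        by (auto intro!: derivative_eq_intros)
      then show "((\<lambda>s. (1\<^sub>m n + s \<cdot>\<^sub>m unit_mat n a b) $$ (i, j)) has_field_derivative
        unit_mat n a b $$ (i, j)) (at 0)" using ij by (simp add: unit_mat_def)
    qed (auto simp: unit_mat_def)
    moreover have "1\<^sub>m n + 0 \<cdot>\<^sub>m unit_mat n a b = 1\<^sub>m n"
      by (rule eq_matI) (auto simp: unit_mat_def)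
    moreover have "(\<Sum>a'<n. \<Sum>b'<n. L a' b' * unit_mat n a b $$ (a', b')) = L a b"
    proof -
      have "(\<Sum>b'<n. L a' b' * unit_mat n a b $$ (a', b')) = (if a' = a then L a b else 0)"
        if "a' < n" for a'
      proof -
        have "(\<Sum>b'<n. L a' b' * unit_mat n a b $$ (a', b')) =
          (\<Sum>b'<n. if b' = b then if a' = a then L a b else 0 else 0)"
          using that ab by (intro sum.cong) (auto simp: unit_mat_def)
        then show ?thesis using ab by simp
      qed
      then have "(\<Sum>a'<n. \<Sum>b'<n. L a' b' * unit_mat n a b $$ (a', b')) =
          (\<Sum>a'<n. if a' = a then L a b else 0)"
        by (intro sum.cong) auto
      then show ?thesis using ab by simp
    qed
    ultimately show "((\<lambda>t. reg p (1\<^sub>m n + t \<cdot>\<^sub>m unit_mat n a b)) has_field_derivative L a b) (at 0)"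
      using L unfolding diff_at_one_def by fastforce
  qed
  then have "gl_diff (\<lambda>c. c) p Y = (\<Sum>a<n. \<Sum>b<n. L a b * Y $$ (a, b))"
    using mat_derivD(2)[OF X(1)] by (simp add: gl_diff_def)
  with L X show ?thesis unfolding diff_at_one_def by simp
qed

lemma mor_map_carrier [simp]: "mor_map m P g \<in> carrier_mat m m"
  by (simp add: mor_map_def)

lemma mor_diff_carrier [simp]: "mor_diff \<iota> m P X \<in> carrier_mat m m"
  by (simp add: mor_diff_def)

lemma mor_map_deriv:
  assumes "mat_deriv n n X Y t" "X t = 1\<^sub>m n"
  shows "mat_deriv m m (\<lambda>s. mor_map m P (X s)) (mor_diff (\<lambda>c. c) m P Y) t"
proof (rule mat_derivI)
  fix a b assume "a < m" "b < m"
  then show "((\<lambda>s. mor_map m P (X s) $$ (a, b)) has_field_derivative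
      mor_diff (\<lambda>c. c) m P Y $$ (a, b)) (at t)"
    using reg_has_derivative[OF assms, of "P a b"] by (simp add: mor_map_def mor_diff_def)
qed auto

lemma gl_diff_carrier:
  "X \<in> carrier_mat n k \<Longrightarrow> gl_diff \<iota> p X =
    (\<Sum>a<n. \<Sum>b<n. \<iota> (deriv (\<lambda>t. reg p (1\<^sub>m n + t \<cdot>\<^sub>m unit_mat n a b)) 0) * X $$ (a, b))"
  by (simp add: gl_diff_def)

lemma gl_diff_sum:
  "gl_diff \<iota> p (mat n n (\<lambda>ab. \<Sum>i\<in>S. c i * M i $$ ab)) = (\<Sum>i\<in>S. c i * gl_diff \<iota> p (mat n n (\<lambda>ab. M i $$ ab)))"
proof -
  have "gl_diff \<iota> p (mat n n (\<lambda>ab. \<Sum>i\<in>S. c i * M i $$ ab)) =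
    (\<Sum>a<n. \<Sum>b<n. \<Sum>i\<in>S. c i * (\<iota> (deriv (\<lambda>t. reg p (1\<^sub>m n + t \<cdot>\<^sub>m unit_mat n a b)) 0) * M i $$ (a, b)))"
    by (simp add: gl_diff_def sum_distrib_left sum_distrib_right mult_ac)
  also have "\<dots> = (\<Sum>a<n. \<Sum>i\<in>S. \<Sum>b<n. c i * (\<iota> (deriv (\<lambda>t. reg p (1\<^sub>m n + t \<cdot>\<^sub>m unit_mat n a b)) 0) * M i $$ (a, b)))"
    by (intro sum.cong refl sum.swap)
  also have "\<dots> = (\<Sum>i\<in>S. \<Sum>a<n. \<Sum>b<n. c i * (\<iota> (deriv (\<lambda>t. reg p (1\<^sub>m n + t \<cdot>\<^sub>m unit_mat n a b)) 0) * M i $$ (a, b)))"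
    by (rule sum.swap)
  finally show ?thesis by (simp add: gl_diff_def sum_distrib_left)
qed

lemma gl_diff_add:
  assumes "X \<in> carrier_mat n n" "Y \<in> carrier_mat n n"
  shows "gl_diff \<iota> p (X + Y) = gl_diff \<iota> p X + gl_diff \<iota> p Y"
  using assms gl_diff_carrier[OF add_carrier_mat[OF assms(2), of X]]
  by (simp add: gl_diff_carrier[OF assms(1)] gl_diff_carrier[OF assms(2)] sum.distrib algebra_simps)

lemma gl_diff_smult:
  assumes "X \<in> carrier_mat n n"
  shows "gl_diff \<iota> p (c \<cdot>\<^sub>m X) = c * gl_diff \<iota> p X"
  using assms by (simp add: gl_diff_def sum_distrib_left algebra_simps)

lemma mor_diff_add:
  assumes "X \<in> carrier_mat n n" "Y \<in> carrier_mat n n"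
  shows "mor_diff \<iota> m P (X + Y) = mor_diff \<iota> m P X + mor_diff \<iota> m P Y"
  by (rule eq_matI) (auto simp: mor_diff_def gl_diff_add[OF assms])

lemma mor_diff_smult:
  assumes "X \<in> carrier_mat n n"
  shows "mor_diff \<iota> m P (c \<cdot>\<^sub>m X) = c \<cdot>\<^sub>m mor_diff \<iota> m P X"
  by (rule eq_matI) (auto simp: mor_diff_def gl_diff_smult[OF assms])

lemma MOST_gl_diff:
  assumes "X \<in> carrier_mat n n"
  shows "\<forall>\<^sub>\<infinity>x. ev (gl_diff ratfun_const p X) x = gl_diff (\<lambda>c. c) p (ev_mat X x)"
  using MOST_regular_mat[of X]
proof eventually_elim
  case (elim x)
  let ?d = "\<lambda>a b. deriv (\<lambda>t. reg p (1\<^sub>m n + t \<cdot>\<^sub>m unit_mat n a b)) 0"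
  have t: "regular_at (ratfun_const (?d a b) * X $$ (a, b)) x \<and>
    ev (ratfun_const (?d a b) * X $$ (a, b)) x = ?d a b * ev_mat X x $$ (a, b)"
    if "a < n" "b < n" for a b
    using elim that assms by (auto simp: regular_at_mult ev_mult regular_mat_def)
  then have "regular_at (\<Sum>b<n. ratfun_const (?d a b) * X $$ (a, b)) x \<and>
    ev (\<Sum>b<n. ratfun_const (?d a b) * X $$ (a, b)) x = (\<Sum>b<n. ?d a b * ev_mat X x $$ (a, b))"
    if "a < n" for a
    using regular_at_sum[of "{..<n}" "\<lambda>b. ratfun_const (?d a b) * X $$ (a, b)" x] that by simp
  then have "ev (\<Sum>a<n. \<Sum>b<n. ratfun_const (?d a b) * X $$ (a, b)) x =
      (\<Sum>a<n. \<Sum>b<n. ?d a b * ev_mat X x $$ (a, b))"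
    using regular_at_sum[of "{..<n}" "\<lambda>a. \<Sum>b<n. ratfun_const (?d a b) * X $$ (a, b)" x] by simp
  then show ?case using assms by (simp add: gl_diff_carrier[of _ n n])
qed

lemma MOST_mor_diff:
  assumes "X \<in> carrier_mat n n"
  shows "\<forall>\<^sub>\<infinity>x. ev_mat (mor_diff ratfun_const m P X) x = mor_diff (\<lambda>c. c) m P (ev_mat X x)"
  by (rule MOST_ev_mat_eqI[of _ m m])
    (use MOST_gl_diff[OF assms] in \<open>auto simp: mor_diff_def\<close>)

unbundle no vec_syntax
no_notation fps_nth (infixl "$" 75)

subsection \<open>Representations and their differentials\<close>

lemma poly_eq_off_0:
  fixes p q :: "complex poly"
  assumes "\<And>s. s \<noteq> 0 \<Longrightarrow> poly p s = poly q s"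
  shows "p = q"
proof (rule ccontr)
  assume "p \<noteq> q"
  then have "\<forall>\<^sub>\<infinity>s. poly (p - q) s \<noteq> 0" by (intro MOST_poly_nonzero) simp
  moreover have "\<forall>\<^sub>\<infinity>s::complex. s \<noteq> 0" using MOST_poly_nonzero[of "[:0, 1:]"] by simp
  ultimately have "\<forall>\<^sub>\<infinity>s::complex. False" by eventually_elim (use assms in simp)
  then show False using MOST_False_complex by blast
qed

lemma mat_deriv_vec:
  assumes "mat_deriv n m X Y t" "u \<in> carrier_vec m" "a < n"
  shows "((\<lambda>s. (X s *\<^sub>v u) $ a) has_field_derivative (Y *\<^sub>v u) $ a) (at t)"
proof -
  note X = mat_derivD[OF assms(1)]
  have 1: "(X s *\<^sub>v u) $ a = (\<Sum>b\<in>{0..<m}. X s $$ (a, b) * u $ b)" for s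
    using X(1)[of s] assms by (simp add: scalar_prod_def)
  have 2: "(Y *\<^sub>v u) $ a = (\<Sum>b\<in>{0..<m}. Y $$ (a, b) * u $ b)"
    using X(2) assms by (simp add: scalar_prod_def)
  show ?thesis unfolding 1 2 using X(3) assms(3)
    by (intro DERIV_sum DERIV_cmult_right) auto
qed

lemma mat_deriv_vec_eqI:
  fixes f :: "complex \<Rightarrow> complex vec" and w :: "complex vec"
  assumes X: "mat_deriv m m X Y t" and u: "u \<in> carrier_vec m" "w \<in> carrier_vec m"
    and f: "\<forall>\<^sub>F s in nhds t. X s *\<^sub>v u = f s"
    and w: "\<And>a. a < m \<Longrightarrow> ((\<lambda>s. f s $ a) has_field_derivative w $ a) (at t)"
  shows "Y *\<^sub>v u = w"
proof (rule eq_vecI)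
  fix a assume "a < dim_vec w"
  then have a: "a < m" using u by simp
  have "\<forall>\<^sub>F s in nhds t. (X s *\<^sub>v u) $ a = f s $ a" using f by eventually_elim simp
  then have "((\<lambda>s. (X s *\<^sub>v u) $ a) has_field_derivative w $ a) (at t)"
    using w[OF a] DERIV_cong_ev[OF refl _ refl, of "\<lambda>s. (X s *\<^sub>v u) $ a" "\<lambda>s. f s $ a" t] by simp
  with mat_deriv_vec[OF X u(1) a] show "(Y *\<^sub>v u) $ a = w $ a" by (rule DERIV_unique)
qed (use u mat_derivD(2)[OF X] in simp)

lemma mat_deriv_scale:
  assumes "mat_deriv n m X Y 0"
  shows "mat_deriv n m (\<lambda>s. X (c * s)) (c \<cdot>\<^sub>m Y) 0"
proof (rule mat_derivI)
  fix a b assume ab: "a < n" "b < m"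
  have "((\<lambda>s. X s $$ (a, b)) has_field_derivative Y $$ (a, b)) (at (c * 0))"
    using mat_derivD(3)[OF assms ab] by simp
  from DERIV_chain2[OF this DERIV_cmult_Id]
  show "((\<lambda>s. X (c * s) $$ (a, b)) has_field_derivative (c \<cdot>\<^sub>m Y) $$ (a, b)) (at 0)"
    using ab mat_derivD(2)[OF assms] by (simp add: mult.commute)
qed (use mat_derivD[OF assms] in auto)

text \<open>Elements of the Lie algebra that come with a curve in K, because identities between
  differentials are obtained by differentiating identities of the group along such a curve.\<close>

definition tangent :: "nat \<Rightarrow> complex mat set \<Rightarrow> complex mat \<Rightarrow> bool" where
  "tangent n K Y \<longleftrightarrow> (\<exists>X. mat_deriv n n X Y 0 \<and> X 0 = 1\<^sub>m n \<and> (\<forall>\<^sub>F t in nhds 0. X t \<in> K))"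

lemma tangent_carrier: "tangent n K Y \<Longrightarrow> Y \<in> carrier_mat n n"
  by (auto simp: tangent_def dest: mat_derivD)

lemma tangent_imp_lie_algebra:
  assumes "tangent n K Y"
  shows "Y \<in> lie_algebra n K"
proof -
  from assms obtain X where X: "mat_deriv n n X Y 0" "X 0 = 1\<^sub>m n" "\<forall>\<^sub>F t in nhds 0. X t \<in> K"
    by (auto simp: tangent_def)
  have "gl_diff (\<lambda>c. c) p Y = 0" if "p \<in> vanishing K" for p
  proof -
    have "\<forall>\<^sub>F t in nhds 0. reg p (X t) = 0"
      using X(3) by eventually_elim (use that in \<open>auto simp: vanishing_def\<close>)
    then have "((\<lambda>t. reg p (X t)) has_field_derivative 0) (at 0)"
      using DERIV_cong_ev[OF refl _ refl, of "\<lambda>t. reg p (X t)" "\<lambda>_. 0" 0 0] by simp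
    with reg_has_derivative[OF X(1,2)] show ?thesis by (rule DERIV_unique)
  qed
  then show ?thesis using mat_derivD(2)[OF X(1)] by (simp add: lie_algebra_def)
qed

locale matrix_group =
  fixes n :: nat and K :: "complex mat set"
  assumes subgroup: "subgroup K (GL n)"
begin

lemma in_GL: "g \<in> K \<Longrightarrow> g \<in> carrier (GL n)"
  using subgroup.mem_carrier[OF subgroup] .

lemma in_carrier [simp, intro]: "g \<in> K \<Longrightarrow> g \<in> carrier_mat n n"
  using in_GL GL_carrierD by blast

lemma one_in: "1\<^sub>m n \<in> K"
  using subgroup.one_closed[OF subgroup] by simp

lemma mult_in: "g \<in> K \<Longrightarrow> h \<in> K \<Longrightarrow> g * h \<in> K"
  using subgroup.m_closed[OF subgroup] by simp

lemma inv_in: "g \<in> K \<Longrightarrow> inv\<^bsub>GL n\<^esub> g \<in> K"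
  using subgroup.m_inv_closed[OF subgroup] by simp

lemma tangent_conj:
  assumes g: "g \<in> K" "h \<in> K" "g * h = 1\<^sub>m n" and Y: "tangent n K Y"
  shows "tangent n K (g * Y * h)"
proof -
  from Y obtain X where X: "mat_deriv n n X Y 0" "X 0 = 1\<^sub>m n" "\<forall>\<^sub>F t in nhds 0. X t \<in> K"
    by (auto simp: tangent_def)
  have "mat_deriv n n (\<lambda>t. g * X t * h) (g * Y * h) 0"
    using g X by (intro mat_deriv_mult_right mat_deriv_mult_left) auto
  moreover have "g * X 0 * h = 1\<^sub>m n"
    using g X right_mult_one_mat[OF in_carrier[OF g(1)]] by simp
  moreover have "\<forall>\<^sub>F t in nhds 0. g * X t * h \<in> K"
    using X(3) by eventually_elim (use g mult_in in auto)
  ultimately show ?thesis unfolding tangent_def by (intro exI[of _ "\<lambda>t. g * X t * h"]) auto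
qed

end

locale rep = matrix_group n K for n K +
  fixes m :: nat and P :: gl_mor
  assumes rho_GL: "g \<in> K \<Longrightarrow> mor_map m P g \<in> carrier (GL m)"
    and rho_mult: "g \<in> K \<Longrightarrow> h \<in> K \<Longrightarrow> mor_map m P (g * h) = mor_map m P g * mor_map m P h"
begin

abbreviation "\<rho> \<equiv> mor_map m P"
abbreviation "d\<rho> \<equiv> mor_diff (\<lambda>c. c) m P"

lemma rho_one: "\<rho> (1\<^sub>m n) = 1\<^sub>m m"
proof -
  have "\<rho> (1\<^sub>m n) * \<rho> (1\<^sub>m n) = \<rho> (1\<^sub>m n)" using rho_mult[OF one_in one_in] by simp
  then show ?thesis
    using group.l_cancel_one[OF group_GL rho_GL[OF one_in] rho_GL[OF one_in]] by simp
qed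

lemma rho_inverse: "g \<in> K \<Longrightarrow> h \<in> K \<Longrightarrow> g * h = 1\<^sub>m n \<Longrightarrow> \<rho> g * \<rho> h = 1\<^sub>m m"
  using rho_mult rho_one by metis

lemma rho_deriv:
  "mat_deriv n n X Y t \<Longrightarrow> X t = 1\<^sub>m n \<Longrightarrow> mat_deriv m m (\<lambda>s. \<rho> (X s)) (d\<rho> Y) t"
  by (rule mor_map_deriv)

text \<open>Translates a velocity at a point other than the identity back to the identity. With g
  the value of v and X the curve of its inverse this is the inhomogeneous term of the gauge
  action.\<close>

lemma drho_left:
  assumes g: "g \<in> K" and X: "mat_deriv n n X Y t" "g * X t = 1\<^sub>m n" "\<forall>\<^sub>F s in nhds t. X s \<in> K"
    and R: "mat_deriv m m (\<lambda>s. \<rho> (X s)) R t"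
  shows "d\<rho> (g * Y) = \<rho> g * R"
proof (rule mat_deriv_unique)
  show "mat_deriv m m (\<lambda>s. \<rho> (g * X s)) (d\<rho> (g * Y)) t"
    using g X by (intro rho_deriv mat_deriv_mult_left) auto
  show "mat_deriv m m (\<lambda>s. \<rho> g * \<rho> (X s)) (\<rho> g * R) t"
    by (rule mat_deriv_mult_left[OF _ R]) auto
  show "\<forall>\<^sub>F s in nhds t. \<rho> (g * X s) = \<rho> g * \<rho> (X s)"
    using X(3) by eventually_elim (use g rho_mult in auto)
qed

lemma drho_conj:
  assumes g: "g \<in> K" "h \<in> K" "g * h = 1\<^sub>m n" and Y: "tangent n K Y"
  shows "d\<rho> (g * Y * h) = \<rho> g * d\<rho> Y * \<rho> h"
proof -
  from Y obtain X where X: "mat_deriv n n X Y 0" "X 0 = 1\<^sub>m n" "\<forall>\<^sub>F t in nhds 0. X t \<in> K"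
    by (auto simp: tangent_def)
  show ?thesis
  proof (rule mat_deriv_unique)
    show "mat_deriv m m (\<lambda>s. \<rho> (g * X s * h)) (d\<rho> (g * Y * h)) 0"
      using g X right_mult_one_mat[OF in_carrier[OF g(1)]]
      by (intro rho_deriv mat_deriv_mult_right mat_deriv_mult_left) auto
    show "mat_deriv m m (\<lambda>s. \<rho> g * \<rho> (X s) * \<rho> h) (\<rho> g * d\<rho> Y * \<rho> h) 0"
      by (rule mat_deriv_mult_right[OF mat_deriv_mult_left[OF _ rho_deriv[OF X(1,2)]]]) auto
    show "\<forall>\<^sub>F s in nhds 0. \<rho> (g * X s * h) = \<rho> g * \<rho> (X s) * \<rho> h"
      using X(3) by eventually_elim (use g rho_mult mult_in in auto)
  qed
qed

lemma drho_intertwine: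
  assumes g: "g \<in> K" "h \<in> K" "g * h = 1\<^sub>m n" "h * g = 1\<^sub>m n" and Y: "tangent n K Y"
    and u: "u \<in> carrier_vec m"
  shows "\<rho> g *\<^sub>v (d\<rho> Y *\<^sub>v u) = d\<rho> (g * Y * h) *\<^sub>v (\<rho> g *\<^sub>v u)"
proof -
  have "d\<rho> (g * Y * h) *\<^sub>v (\<rho> g *\<^sub>v u) = (\<rho> g * d\<rho> Y) *\<^sub>v (\<rho> h *\<^sub>v (\<rho> g *\<^sub>v u))"
    unfolding drho_conj[OF g(1-3) Y] using u by (subst assoc_mult_mat_vec[of _ m m _ m])
      (auto intro!: mult_carrier_mat[of _ m m] mult_mat_vec_carrier[of _ m m])
  also have "\<rho> h *\<^sub>v (\<rho> g *\<^sub>v u) = u"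
    using u rho_inverse[OF g(2,1,4)] by (subst assoc_mult_mat_vec[of _ m m _ m, symmetric]) auto
  also have "(\<rho> g * d\<rho> Y) *\<^sub>v u = \<rho> g *\<^sub>v (d\<rho> Y *\<^sub>v u)"
    using u by (subst assoc_mult_mat_vec[of _ m m _ m]) auto
  finally show ?thesis ..
qed

text \<open>Differentiates the action on a single vector, so that the effect of e_j and of the
  coroots on \<nu> and f_i \<nu> can be read off from group elements.\<close>

lemma drho_vec_eqI:
  fixes f :: "complex \<Rightarrow> complex vec" and w :: "complex vec"
  assumes X: "mat_deriv n n X Y t" "X t = 1\<^sub>m n"
    and u: "u \<in> carrier_vec m" "w \<in> carrier_vec m"
    and f: "\<forall>\<^sub>F s in nhds t. \<rho> (X s) *\<^sub>v u = f s"
    and w: "\<And>a. a < m \<Longrightarrow> ((\<lambda>s. f s $ a) has_field_derivative w $ a) (at t)"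
  shows "d\<rho> Y *\<^sub>v u = w"
  by (rule mat_deriv_vec_eqI[OF rho_deriv[OF X] u f w])

end

subsection \<open>The group \<open>SL\<^sub>2\<close>\<close>

lemma mat2_carrier [simp]: "mat2 a b c d \<in> carrier_mat 2 2"
  by (simp add: mat2_def mat_of_rows_list_def numeral_2_eq_2)

lemma mat2_index [simp]:
  "mat2 a b c d $$ (0, 0) = a" "mat2 a b c d $$ (0, Suc 0) = b"
  "mat2 a b c d $$ (Suc 0, 0) = c" "mat2 a b c d $$ (Suc 0, Suc 0) = d"
  by (simp_all add: mat2_def mat_of_rows_list_def)

lemma mat2_dim [simp]: "dim_row (mat2 a b c d) = 2" "dim_col (mat2 a b c d) = 2"
  by (simp_all add: mat2_def mat_of_rows_list_def)

lemma less_2_split: "i < (2::nat) \<longleftrightarrow> i = 0 \<or> i = Suc 0"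
  by auto

lemma eq_mat2I:
  assumes "A \<in> carrier_mat 2 2" "B \<in> carrier_mat 2 2"
    "A $$ (0, 0) = B $$ (0, 0)" "A $$ (0, Suc 0) = B $$ (0, Suc 0)"
    "A $$ (Suc 0, 0) = B $$ (Suc 0, 0)" "A $$ (Suc 0, Suc 0) = B $$ (Suc 0, Suc 0)"
  shows "A = B"
  by (rule eq_matI) (use assms in \<open>auto simp: less_2_split\<close>)

lemma mat2_mult:
  "mat2 a b c d * mat2 a' b' c' d' = mat2 (a * a' + b * c') (a * b' + b * d') (c * a' + d * c') (c * b' + d * d')"
  by (rule eq_mat2I) (auto simp: scalar_prod_def numeral_2_eq_2)

lemma mat2_one: "mat2 1 0 0 1 = 1\<^sub>m 2"
  by (rule eq_mat2I) auto

lemma det_mat2: "det (mat2 a b c d) = a * d - b * c"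
  by (subst laplace_expansion_row[of _ 2 0]) (auto simp: cofactor_def mat_delete_def det_single numeral_2_eq_2)

lemma SL2_mat2: "a * d - b * c = 1 \<Longrightarrow> mat2 a b c d \<in> SL2"
  by (simp add: SL2_def det_mat2)

lemma SL2_unip [simp]: "mat2 1 s 0 1 \<in> SL2" "mat2 1 0 s 1 \<in> SL2"
  by (simp_all add: SL2_mat2)

lemma SL2_diag: "t \<noteq> 0 \<Longrightarrow> mat2 t 0 0 (inverse t) \<in> SL2"
  by (simp add: SL2_mat2)

lemma subgroup_SL2: "subgroup SL2 (GL 2)"
proof
  show sub: "SL2 \<subseteq> carrier (GL 2)"
    using det_non_zero_imp_unit[where 'a = complex and n = 2 and b = "()"]
    unfolding GL_def units_of_def SL2_def by auto
  show "x \<otimes>\<^bsub>GL 2\<^esub> y \<in> SL2" if "x \<in> SL2" "y \<in> SL2" for x y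
    using that by (auto simp: SL2_def det_mult)
  show "\<one>\<^bsub>GL 2\<^esub> \<in> SL2" by (simp add: SL2_def)
  show "inv\<^bsub>GL 2\<^esub> x \<in> SL2" if "x \<in> SL2" for x
    using that sub GL_det(1)[of x 2] GL_inv(2)[of x 2] by (auto simp: SL2_def)
qed

text \<open>The diagonal curve uses the parameter 1 + s instead of an exponential, so that coroots
  are differentiated in their algebraic parameter. It leaves SL2 only at s = -1, hence stays inside
  near 0.\<close>

lemma tangent_SL2:
  "mat_deriv 2 2 (\<lambda>s. mat2 1 s 0 1) (mat2 0 1 0 0) 0"
  "mat_deriv 2 2 (\<lambda>s. mat2 1 0 s 1) (mat2 0 0 1 0) 0"
  "mat_deriv 2 2 (\<lambda>s. mat2 (1 + s) 0 0 (inverse (1 + s))) (mat2 1 0 0 (-1)) 0"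
  by (rule mat_derivI; auto simp: less_2_split intro!: derivative_eq_intros)+

lemma eventually_one_plus_nonzero: "\<forall>\<^sub>F s in nhds (0::complex). 1 + s \<noteq> 0"
  by (rule eventually_nhds[THEN iffD2], rule exI[of _ "- {-1}"])
    (auto simp: add_eq_0_iff)

lemma tangent_SL2_E: "tangent 2 SL2 (mat2 0 1 0 0)"
  and tangent_SL2_F: "tangent 2 SL2 (mat2 0 0 1 0)"
proof -
  show "tangent 2 SL2 (mat2 0 1 0 0)" unfolding tangent_def
    using tangent_SL2(1) by (intro exI[of _ "\<lambda>s. mat2 1 s 0 1"]) (auto simp: mat2_one)
  show "tangent 2 SL2 (mat2 0 0 1 0)" unfolding tangent_def
    using tangent_SL2(2) by (intro exI[of _ "\<lambda>s. mat2 1 0 s 1"]) (auto simp: mat2_one)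
qed

lemma alg_hom_rep:
  assumes "subgroup K (GL n)" "alg_hom n K m L P" "L \<subseteq> carrier (GL m)"
  shows "rep n K m P"
proof (intro rep.intro matrix_group.intro rep_axioms.intro)
  show "subgroup K (GL n)" by fact
  fix g h assume g: "g \<in> K"
  have hom: "mor_map m P \<in> hom (GL n\<lparr>carrier := K\<rparr>) (GL m\<lparr>carrier := L\<rparr>)"
    using assms(2) by (simp add: alg_hom_def)
  show "mor_map m P g \<in> carrier (GL m)"
    using hom_carrier[OF hom] g assms(3) by auto
  show "mor_map m P (g * h) = mor_map m P g * mor_map m P h" if "h \<in> K"
    using hom_mult[OF hom, of g h] g that by simp
qed

text \<open>The polynomial is a unit, hence constant. This makes a simple root subgroup act
  trivially on a line that it preserves.\<close>

lemma poly_mult_reflected_eq_1: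
  fixes p :: "complex poly"
  assumes "\<And>s. poly p s * poly p (- s) = 1"
  shows "poly p s = poly p 0"
proof -
  have "p * pcompose p [:0, -1:] = 1"
    by (rule poly_eq_off_0) (simp add: poly_pcompose assms)
  then have "p dvd 1" by (metis dvd_triv_left)
  then obtain c where "p = [:c:]" by (auto simp: is_unit_poly_iff)
  then show ?thesis by simp
qed

text \<open>For p(t) = f(t) t^N multiplicativity reads p(s t) = p(s) p(t). Comparing coefficients of
  s^k, for a k at which p has a nonzero coefficient, gives p(t) = t^k.\<close>

lemma laurent_character:
  assumes "laurent_fun f" "\<And>s t. s \<noteq> 0 \<Longrightarrow> t \<noteq> 0 \<Longrightarrow> f (s * t) = f s * f t"
    "\<And>t. t \<noteq> 0 \<Longrightarrow> f t \<noteq> 0"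
  shows "\<exists>k. \<forall>t. t \<noteq> 0 \<longrightarrow> f t = t powi k"
proof -
  from assms(1) obtain p N where p: "\<And>t. t \<noteq> 0 \<Longrightarrow> f t * t ^ N = poly p t"
    by (auto simp: laurent_fun_def)
  have "p \<noteq> 0" using p[of 1] assms(3)[of 1] by auto
  then obtain k where k: "coeff p k \<noteq> 0" using leading_coeff_neq_0 by blast
  have "f t = t powi (int k - int N)" if t: "t \<noteq> 0" for t
  proof -
    have "pcompose p [:0, t:] = Polynomial.smult (poly p t) p"
    proof (rule poly_eq_off_0)
      fix s :: complex assume "s \<noteq> 0"
      then have "poly p (s * t) = (f s * s ^ N) * (f t * t ^ N)"
        using p[of "s * t"] t assms(2)[of s t] by (simp add: power_mult_distrib mult_ac)
      then show "poly (pcompose p [:0, t:]) s = poly (Polynomial.smult (poly p t) p) s"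
        using p[OF \<open>s \<noteq> 0\<close>] p[OF t] by (simp add: poly_pcompose)
    qed
    then have "coeff p k * t ^ k = poly p t * coeff p k"
      by (metis coeff_pcompose_linear coeff_smult mult.commute)
    then have "f t * t ^ N = t ^ k" using k p[OF t] by (simp add: mult.commute)
    then show ?thesis using t by (simp add: power_int_diff field_simps)
  qed
  then show ?thesis by blast
qed

text \<open>A polynomial tending to 0 at infinity vanishes, and for m > 0 the right-hand side tends
  to 0, which would force q = 0. Algebraically, with u = 1/a the reflected polynomial of p gets a
  zero at u = 0, where its value is the leading coefficient of p.\<close>

lemma pole_order_nonpos:
  fixes p q :: "complex poly"
  assumes "\<And>a. a \<noteq> 0 \<Longrightarrow> poly p a = inverse a ^ m * poly q (inverse a)" "poly q 0 \<noteq> 0"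
  shows "m = 0"
proof (rule ccontr)
  assume m: "m \<noteq> 0"
  have "reflect_poly p = monom 1 (degree p + m) * q"
  proof (rule poly_eq_off_0)
    fix u :: complex assume u: "u \<noteq> 0"
    then show "poly (reflect_poly p) u = poly (monom 1 (degree p + m) * q) u"
      using assms(1)[of "inverse u"] by (simp add: poly_reflect_poly_nz poly_monom power_add)
  qed
  from arg_cong[OF this, of "\<lambda>r. poly r 0"] have "lead_coeff p = 0"
    using m by (simp add: poly_monom)
  then have "p = 0" by simp
  then have "poly q a = 0" if "a \<noteq> 0" for a
    using assms(1)[of "inverse a"] that by simp
  then have "q = 0" by (intro poly_eq_off_0) simp
  with assms(2) show False by simp
qed

lemma conj_mult:
  fixes h :: "complex mat"
  assumes "h \<in> carrier_mat n n" "h' \<in> carrier_mat n n" "h' * h = 1\<^sub>m n"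
    "A \<in> carrier_mat n n" "B \<in> carrier_mat n n"
  shows "(h * A * h') * (h * B * h') = h * (A * B) * h'"
proof -
  have "h' * (h * C) = C" if "C \<in> carrier_mat n n" for C
    using assoc_mult_mat[OF assms(2,1) that] assms(3) that by simp
  then show ?thesis
    using assms by (simp add: assoc_mult_mat[of _ n n _ n _ n] mult_carrier_mat[of _ n n])
qed

lemma powi_2_inject: "(2::complex) powi k = 2 powi l \<longleftrightarrow> k = l"
proof
  assume "(2::complex) powi k = 2 powi l"
  from arg_cong[OF this, of norm] have "(2::real) powi k = 2 powi l"
    by (simp add: norm_power_int)
  then show "k = l"
    using power_int_strict_increasing[of k l "2::real"] power_int_strict_increasing[of l k "2::real"]
    by (cases k l rule: linorder_cases) auto
qed simp

section \<open>One-parameter subgroups and root data of a pinned group\<close>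

locale pinned =
  fixes G :: "('i::finite) pinned_group"
  assumes pinned: "pinned_simple_group G"
begin

abbreviation "n \<equiv> gsize G"
abbreviation "\<alpha> i h \<equiv> reg (sroot G i) h"

definition up :: "'i \<Rightarrow> complex \<Rightarrow> complex mat" where
  "up j s = mor_map n (sl2_map G j) (mat2 1 s 0 1)"

definition lo :: "'i \<Rightarrow> complex \<Rightarrow> complex mat" where
  "lo j s = mor_map n (sl2_map G j) (mat2 1 0 s 1)"

lemma alg_groups: "alg_group n (grp G)" "alg_group n (borel_plus G)" "alg_group n (torus G)"
  and torus_eq: "torus G = borel_plus G \<inter> borel_minus G"
  and borel_sub: "borel_plus G \<subseteq> grp G" "borel_minus G \<subseteq> grp G"
  and torus: "alg_torus n (torus G)"
  and roots: "simple_roots n (grp G) (borel_plus G) (torus G) (sroot G)"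
  and root_sl2: "\<And>i. root_sl2 n (grp G) (borel_plus G) (borel_minus G) (torus G) (sroot G i) (sl2_map G i)"
  using pinned unfolding pinned_simple_group_def simple_alg_group_def borel_subgroup_def
    connected_solvable_def maximal_torus_def alg_torus_def by blast+

lemma torus_sub: "torus G \<subseteq> borel_plus G" "torus G \<subseteq> grp G"
  using torus_eq borel_sub by auto

sublocale grp: matrix_group n "grp G"
  by (rule matrix_group.intro) (use alg_groups in \<open>simp add: alg_group_def\<close>)
sublocale borel: matrix_group n "borel_plus G"
  by (rule matrix_group.intro) (use alg_groups in \<open>simp add: alg_group_def\<close>)
sublocale torus: matrix_group n "torus G"
  by (rule matrix_group.intro) (use alg_groups in \<open>simp add: alg_group_def\<close>)

sublocale sl2: rep 2 SL2 n "sl2_map G j" for j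
proof (rule alg_hom_rep[OF subgroup_SL2])
  show "alg_hom 2 SL2 n (grp G) (sl2_map G j)" using root_sl2[of j] by (simp add: root_sl2_def)
  show "grp G \<subseteq> carrier (GL n)" using grp.in_GL by blast
qed

lemma up_in: "up j s \<in> borel_plus G" "up j s \<in> grp G"
  and lo_in: "lo j s \<in> grp G"
  and coroot_in: "t \<noteq> 0 \<Longrightarrow> coroot G j t \<in> torus G"
  using root_sl2[of j] borel_sub by (auto simp: root_sl2_def up_def lo_def coroot_def)

lemma coroot_in_grp: "t \<noteq> 0 \<Longrightarrow> coroot G j t \<in> grp G" "t \<noteq> 0 \<Longrightarrow> coroot G j t \<in> borel_plus G"
  using coroot_in torus_sub by auto

lemma up_carrier [simp]: "up j s \<in> carrier_mat n n"
  and lo_carrier [simp]: "lo j s \<in> carrier_mat n n"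
  and coroot_carrier [simp]: "coroot G j t \<in> carrier_mat n n"
  by (simp_all add: up_def lo_def coroot_def)

lemma up_0: "up j 0 = 1\<^sub>m n" and lo_0: "lo j 0 = 1\<^sub>m n" and coroot_1: "coroot G j 1 = 1\<^sub>m n"
  using sl2.rho_one[of j] by (simp_all add: up_def lo_def coroot_def mat2_one)

lemma up_inverse: "up j s * up j (- s) = 1\<^sub>m n" "up j (- s) * up j s = 1\<^sub>m n"
  unfolding up_def by (rule sl2.rho_inverse; simp add: mat2_mult mat2_one)+

lemma coroot_mult: "s \<noteq> 0 \<Longrightarrow> t \<noteq> 0 \<Longrightarrow> coroot G j (s * t) = coroot G j s * coroot G j t"
  unfolding coroot_def
  by (subst sl2.rho_mult[symmetric]) (auto simp: SL2_diag mat2_mult mult.commute)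

lemma coroot_inverse:
  "t \<noteq> 0 \<Longrightarrow> coroot G j t * coroot G j (inverse t) = 1\<^sub>m n"
  "t \<noteq> 0 \<Longrightarrow> coroot G j (inverse t) * coroot G j t = 1\<^sub>m n"
  using coroot_mult[of t "inverse t" j] coroot_mult[of "inverse t" t j] by (simp_all add: coroot_1)

lemma chev_carrier [simp]: "chev_e G j \<in> carrier_mat n n" "chev_f G j \<in> carrier_mat n n"
  "chev_h G j \<in> carrier_mat n n"
  by (simp_all add: chev_e_def chev_f_def chev_h_def)

lemma chev_dim [simp]:
  "dim_row (chev_e G j) = n" "dim_col (chev_e G j) = n"
  "dim_row (chev_f G j) = n" "dim_col (chev_f G j) = n"
  "dim_row (chev_h G j) = n" "dim_col (chev_h G j) = n"
  by (simp_all only: carrier_matD[OF chev_carrier(1)] carrier_matD[OF chev_carrier(2)]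
      carrier_matD[OF chev_carrier(3)])

lemma up_deriv: "mat_deriv n n (up j) (chev_e G j) 0"
  and lo_deriv: "mat_deriv n n (lo j) (chev_f G j) 0"
  and coroot_deriv: "mat_deriv n n (\<lambda>s. coroot G j (1 + s)) (chev_h G j) 0"
  unfolding up_def[abs_def] lo_def[abs_def] coroot_def[abs_def] chev_e_def chev_f_def chev_h_def
  by (intro sl2.rho_deriv tangent_SL2; simp add: mat2_one)+

lemma tangent_f: "tangent n (grp G) (chev_f G j)"
  and tangent_h: "tangent n (grp G) (chev_h G j)"
proof -
  show "tangent n (grp G) (chev_f G j)" unfolding tangent_def
    using lo_deriv lo_in lo_0 by (intro exI[of _ "lo j"]) auto
  show "tangent n (grp G) (chev_h G j)" unfolding tangent_def
    using coroot_deriv coroot_in_grp(1) coroot_1 eventually_one_plus_nonzero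
    by (intro exI[of _ "\<lambda>s. coroot G j (1 + s)"]) (auto elim: eventually_mono)
qed

lemma e_nonzero: "chev_e G j \<noteq> 0\<^sub>m n n"
  using root_sl2[of j] by (simp add: root_sl2_def chev_e_def)

lemma torus_inv:
  assumes "h \<in> torus G"
  shows "inv\<^bsub>GL n\<^esub> h \<in> torus G" "h * inv\<^bsub>GL n\<^esub> h = 1\<^sub>m n" "inv\<^bsub>GL n\<^esub> h * h = 1\<^sub>m n"
    "inv\<^bsub>GL n\<^esub> h \<in> carrier_mat n n" "h \<in> carrier_mat n n"
  using assms torus.inv_in GL_inv[OF torus.in_GL[OF assms]] by auto

lemma torus_up:
  assumes "h \<in> torus G"
  shows "h * up j s * inv\<^bsub>GL n\<^esub> h = up j (\<alpha> j h * s)"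
    and "h * lo j s * inv\<^bsub>GL n\<^esub> h = lo j (inverse (\<alpha> j h) * s)"
  using root_sl2[of j] assms by (simp_all add: root_sl2_def up_def lo_def)

lemma torus_e:
  assumes "h \<in> torus G"
  shows "h * chev_e G j * inv\<^bsub>GL n\<^esub> h = \<alpha> j h \<cdot>\<^sub>m chev_e G j"
proof (rule mat_deriv_unique)
  show "mat_deriv n n (\<lambda>s. h * up j s * inv\<^bsub>GL n\<^esub> h) (h * chev_e G j * inv\<^bsub>GL n\<^esub> h) 0"
    using torus_inv[OF assms] by (intro mat_deriv_mult_right[of n n] mat_deriv_mult_left[of _ n n] up_deriv) auto
  show "mat_deriv n n (\<lambda>s. up j (\<alpha> j h * s)) (\<alpha> j h \<cdot>\<^sub>m chev_e G j) 0"
    by (rule mat_deriv_scale[OF up_deriv])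
qed (simp add: torus_up[OF assms])

lemma torus_f:
  assumes "h \<in> torus G"
  shows "h * chev_f G j * inv\<^bsub>GL n\<^esub> h = inverse (\<alpha> j h) \<cdot>\<^sub>m chev_f G j"
proof (rule mat_deriv_unique)
  show "mat_deriv n n (\<lambda>s. h * lo j s * inv\<^bsub>GL n\<^esub> h) (h * chev_f G j * inv\<^bsub>GL n\<^esub> h) 0"
    using torus_inv[OF assms] by (intro mat_deriv_mult_right[of n n] mat_deriv_mult_left[of _ n n] lo_deriv) auto
  show "mat_deriv n n (\<lambda>s. lo j (inverse (\<alpha> j h) * s)) (inverse (\<alpha> j h) \<cdot>\<^sub>m chev_f G j) 0"
    by (rule mat_deriv_scale[OF lo_deriv])
qed (simp add: torus_up[OF assms])

lemma coroot_inv: "t \<noteq> 0 \<Longrightarrow> inv\<^bsub>GL n\<^esub> (coroot G j t) = coroot G j (inverse t)"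
  by (rule GL_inv_unique) (auto simp: coroot_inverse)

lemma up_f: "up i s * chev_f G i * up i (- s)
    = chev_f G i + s \<cdot>\<^sub>m chev_h G i + (- s\<^sup>2) \<cdot>\<^sub>m chev_e G i"
proof -
  have "up i s * chev_f G i * up i (- s) =
      mor_diff (\<lambda>c. c) n (sl2_map G i) (mat2 1 s 0 1 * mat2 0 0 1 0 * mat2 1 (- s) 0 1)"
    unfolding up_def chev_f_def
    by (rule sl2.drho_conj[symmetric]) (auto simp: mat2_mult mat2_one tangent_SL2_F)
  also have "mat2 1 s 0 1 * mat2 0 0 1 0 * mat2 1 (- s) 0 1 =
      mat2 0 0 1 0 + s \<cdot>\<^sub>m mat2 1 0 0 (-1) + (- s\<^sup>2) \<cdot>\<^sub>m mat2 0 1 0 0"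
    by (rule eq_mat2I) (auto simp: mat2_mult power2_eq_square)
  finally show ?thesis
    by (simp add: mor_diff_add[of _ 2] mor_diff_smult[of _ 2] chev_e_def chev_f_def chev_h_def)
qed

lemma coroot_e: "t \<noteq> 0 \<Longrightarrow> coroot G i t * chev_e G i * coroot G i (inverse t) = t\<^sup>2 \<cdot>\<^sub>m chev_e G i"
proof -
  assume t: "t \<noteq> 0"
  have "coroot G i t * chev_e G i * coroot G i (inverse t) =
      mor_diff (\<lambda>c. c) n (sl2_map G i) (mat2 t 0 0 (inverse t) * mat2 0 1 0 0 * mat2 (inverse t) 0 0 t)"
    using t SL2_diag[of t] SL2_diag[of "inverse t"] unfolding coroot_def chev_e_def inverse_inverse_eq
    by (intro sl2.drho_conj[symmetric]) (auto simp: mat2_mult mat2_one tangent_SL2_E)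
  also have "mat2 t 0 0 (inverse t) * mat2 0 1 0 0 * mat2 (inverse t) 0 0 t = t\<^sup>2 \<cdot>\<^sub>m mat2 0 1 0 0"
    by (rule eq_mat2I) (auto simp: mat2_mult power2_eq_square)
  finally show ?thesis
    by (simp add: mor_diff_smult[of _ 2] chev_e_def)
qed

text \<open>\<open>root_sl2\<close> only guarantees that e is nonzero. If f vanished,
  \<open>up_f\<close> would give s h = s^2 e for every s, and s = 1 together with s = -1 would make
  e equal to its negative.\<close>

lemma f_nonzero: "chev_f G i \<noteq> 0\<^sub>m n n"
proof
  assume f: "chev_f G i = 0\<^sub>m n n"
  have 0: "s * chev_h G i $$ (a, b) = s\<^sup>2 * chev_e G i $$ (a, b)" if "a < n" "b < n" for a b s
  proof -
    have "up i s * chev_f G i * up i (- s) = 0\<^sub>m n n"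
      using left_mult_zero_mat[OF up_carrier[of i "-s"]] right_mult_zero_mat[OF up_carrier[of i s]]
      unfolding f by simp
    then have "(chev_f G i + s \<cdot>\<^sub>m chev_h G i + (- s\<^sup>2) \<cdot>\<^sub>m chev_e G i) $$ (a, b) = 0"
      using that by (simp add: up_f)
    moreover have "chev_f G i $$ (a, b) = 0" using that f by simp
    ultimately show ?thesis using that by simp
  qed
  have "chev_e G i = 0\<^sub>m n n"
  proof (rule eq_matI)
    fix a b assume "a < dim_row (0\<^sub>m n n)" "b < dim_col (0\<^sub>m n n)"
    then have ab: "a < n" "b < n" by auto
    from 0[OF ab, of 1] 0[OF ab, of "-1"] show "chev_e G i $$ (a, b) = 0\<^sub>m n n $$ (a, b)"
      using ab by (simp add: eq_neg_iff_add_eq_0)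
  qed (use chev_carrier[of i] in auto)
  then show False using e_nonzero by blast
qed

subsubsection \<open>Roots\<close>

lemma is_root: "is_root n (torus G) (borel_plus G) (sroot G i)"
  using roots by (simp add: simple_roots_def)

lemma root_nonzero: "h \<in> torus G \<Longrightarrow> \<alpha> i h \<noteq> 0"
  and root_mult: "h \<in> torus G \<Longrightarrow> h' \<in> torus G \<Longrightarrow> \<alpha> i (h * h') = \<alpha> i h * \<alpha> i h'"
  using is_root[of i] by (auto simp: is_root_def alg_character_def)

lemma root_one: "\<alpha> i (1\<^sub>m n) = 1"
  using root_mult[OF torus.one_in torus.one_in, of i] root_nonzero[OF torus.one_in, of i]
  by simp

lemma root_inv: "h \<in> torus G \<Longrightarrow> \<alpha> i (inv\<^bsub>GL n\<^esub> h) = inverse (\<alpha> i h)"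
  using root_mult[of h "inv\<^bsub>GL n\<^esub> h" i] torus_inv[of h] root_one[of i]
    inverse_unique[of "\<alpha> i h"] by simp

lemma coroot_laurent_entries:
  assumes "a < n" "b < n"
  shows "laurent_fun (\<lambda>t. coroot G j t $$ (a, b))" "laurent_fun (\<lambda>t. coroot G j (inverse t) $$ (a, b))"
proof -
  have 1: "laurent_fun (\<lambda>t. reg p (mat2 t 0 0 (inverse t)))" for p
  proof (rule laurent_fun.reg[of _ 2])
    show "laurent_fun (\<lambda>t. inverse (det (mat2 t 0 0 (inverse t))))"
      by (rule laurent_fun.cong[OF laurent_fun.const[of 1]]) (auto simp: det_mat2)
  qed (auto simp: less_2_split intro!: laurent_fun_ident laurent_fun_inverse laurent_fun.const)
  have 2: "laurent_fun (\<lambda>t. reg p (mat2 (inverse t) 0 0 t))" for p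
  proof (rule laurent_fun.reg[of _ 2])
    show "laurent_fun (\<lambda>t. inverse (det (mat2 (inverse t) 0 0 t)))"
      by (rule laurent_fun.cong[OF laurent_fun.const[of 1]]) (auto simp: det_mat2)
  qed (auto simp: less_2_split intro!: laurent_fun_ident laurent_fun_inverse laurent_fun.const)
  show "laurent_fun (\<lambda>t. coroot G j t $$ (a, b))" "laurent_fun (\<lambda>t. coroot G j (inverse t) $$ (a, b))"
    using 1 2 assms by (simp_all add: coroot_def mor_map_def)
qed

lemma coroot_laurent: "laurent_fun (\<lambda>t. reg p (coroot G j t))"
proof (rule laurent_fun.reg[of _ n])
  \<comment> \<open>The inverse of a coroot at t is its value at 1/t, so the inverse determinant is
    again a Laurent function.\<close>
  have "laurent_fun (\<lambda>t. det (coroot G j (inverse t)))"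
    by (rule laurent_fun.det[of _ n]) (auto intro: coroot_laurent_entries)
  then show "laurent_fun (\<lambda>t. inverse (det (coroot G j t)))"
  proof (rule laurent_fun.cong)
    fix t :: complex assume "t \<in> - {0}"
    then have "det (coroot G j t) * det (coroot G j (inverse t)) = 1"
      using det_mult[OF coroot_carrier[of j t] coroot_carrier[of j "inverse t"]] coroot_inverse(1)[of t j]
      by simp
    then show "det (coroot G j (inverse t)) = inverse (det (coroot G j t))"
      by (metis inverse_unique)
  qed
qed (auto intro: coroot_laurent_entries)

text \<open>The polynomial inverse Y is what controls the inverse determinant of the image of X: it
  equals the determinant of the image of Y.\<close>

lemma poly_fun_sl2:
  assumes "\<And>s. X s \<in> SL2" "\<And>s. Y s \<in> SL2" "\<And>s. X s * Y s = 1\<^sub>m 2"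
    and "\<And>a b. a < 2 \<Longrightarrow> b < 2 \<Longrightarrow> poly_fun (\<lambda>s. X s $$ (a, b))"
    and "\<And>a b. a < 2 \<Longrightarrow> b < 2 \<Longrightarrow> poly_fun (\<lambda>s. Y s $$ (a, b))"
  shows "a < n \<Longrightarrow> b < n \<Longrightarrow> poly_fun (\<lambda>s. mor_map n (sl2_map G j) (X s) $$ (a, b))"
    and "poly_fun (\<lambda>s. reg p (mor_map n (sl2_map G j) (X s)))"
proof -
  have r: "poly_fun (\<lambda>s. reg p (Z s))"
    if "\<And>s. Z s \<in> SL2" "\<And>a b. a < 2 \<Longrightarrow> b < 2 \<Longrightarrow> poly_fun (\<lambda>s. Z s $$ (a, b))" for Z p
  proof (rule poly_fun.reg[of _ 2])
    have Z: "Z s \<in> carrier_mat 2 2" "det (Z s) = 1" for s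
      using that(1)[of s] unfolding SL2_def by simp_all
    show "poly_fun (\<lambda>t. inverse (det (Z t)))"
      unfolding Z(2) by (rule poly_fun.const)
    show "Z s \<in> carrier_mat 2 2" for s by (rule Z(1))
    show "poly_fun (\<lambda>s. Z s $$ (a, b))" if "a < 2" "b < 2" for a b
      by (rule \<open>\<And>a b. a < 2 \<Longrightarrow> b < 2 \<Longrightarrow> poly_fun (\<lambda>s. Z s $$ (a, b))\<close>[OF that])
  qed
  have e: "poly_fun (\<lambda>s. mor_map n (sl2_map G j) (X s) $$ (a, b))"
    "poly_fun (\<lambda>s. mor_map n (sl2_map G j) (Y s) $$ (a, b))" if "a < n" "b < n" for a b
    using r[OF assms(1,4)] r[OF assms(2,5)] that by (simp_all add: mor_map_def)
  then show "a < n \<Longrightarrow> b < n \<Longrightarrow> poly_fun (\<lambda>s. mor_map n (sl2_map G j) (X s) $$ (a, b))" by blast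
  show "poly_fun (\<lambda>s. reg p (mor_map n (sl2_map G j) (X s)))"
  proof (rule poly_fun.reg[of _ n])
    have "poly_fun (\<lambda>s. det (mor_map n (sl2_map G j) (Y s)))"
      using e(2) by (rule poly_fun.det[of _ n, OF mor_map_carrier])
    then show "poly_fun (\<lambda>s. inverse (det (mor_map n (sl2_map G j) (X s))))"
    proof (rule poly_fun.cong)
      fix s
      have "mor_map n (sl2_map G j) (X s) * mor_map n (sl2_map G j) (Y s) = 1\<^sub>m n"
        by (rule sl2.rho_inverse[OF assms(1-3)])
      then have "det (mor_map n (sl2_map G j) (X s)) * det (mor_map n (sl2_map G j) (Y s)) = 1"
        using det_mult[OF mor_map_carrier mor_map_carrier] by (metis det_one)
      then show "det (mor_map n (sl2_map G j) (Y s)) = inverse (det (mor_map n (sl2_map G j) (X s)))"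
        by (metis inverse_unique)
    qed
  qed (rule mor_map_carrier, rule e(1))
qed

lemma up_poly: "a < n \<Longrightarrow> b < n \<Longrightarrow> poly_fun (\<lambda>s. up j (c * s) $$ (a, b))"
  and up_poly_reg: "poly_fun (\<lambda>s. reg p (up j s))"
  and lo_poly: "a < n \<Longrightarrow> b < n \<Longrightarrow> poly_fun (\<lambda>s. lo j (c * s) $$ (a, b))"
proof -
  have 1: "poly_fun (\<lambda>s. c * s)" for c by (intro poly_fun.mult poly_fun.const poly_fun_ident)
  have 2: "poly_fun (\<lambda>s. - (c * s))" for c using 1[of "-c"] by simp
  show "a < n \<Longrightarrow> b < n \<Longrightarrow> poly_fun (\<lambda>s. up j (c * s) $$ (a, b))"
    unfolding up_def
    by (rule poly_fun_sl2(1)[of _ "\<lambda>s. mat2 1 (- (c * s)) 0 1"])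
      (auto simp: mat2_mult mat2_one less_2_split 1 2 intro: poly_fun.const)
  show "a < n \<Longrightarrow> b < n \<Longrightarrow> poly_fun (\<lambda>s. lo j (c * s) $$ (a, b))"
    unfolding lo_def
    by (rule poly_fun_sl2(1)[of _ "\<lambda>s. mat2 1 0 (- (c * s)) 1"])
      (auto simp: mat2_mult mat2_one less_2_split 1 2 intro: poly_fun.const)
  show "poly_fun (\<lambda>s. reg p (up j s))"
    unfolding up_def using 1[of 1] 2[of 1]
    by (intro poly_fun_sl2(2)[of _ "\<lambda>s. mat2 1 (- s) 0 1"])
      (auto simp: mat2_mult mat2_one less_2_split intro: poly_fun.const)
qed

text \<open>Justifies the definite description in \<open>cartan\<close>: an exponent exists because
  a multiplicative Laurent function is a power, and the value at t = 2 determines it.\<close>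

lemma cartan_powi: "t \<noteq> 0 \<Longrightarrow> \<alpha> j (coroot G i t) = t powi cartan G i j"
proof -
  have "\<exists>k. \<forall>t. t \<noteq> 0 \<longrightarrow> \<alpha> j (coroot G i t) = t powi k"
    by (intro laurent_character coroot_laurent)
      (auto simp: coroot_mult root_mult coroot_in root_nonzero)
  then obtain k where k: "\<forall>t. t \<noteq> 0 \<longrightarrow> \<alpha> j (coroot G i t) = t powi k" by blast
  have "\<forall>t. t \<noteq> 0 \<longrightarrow> \<alpha> j (coroot G i t) = t powi cartan G i j"
    unfolding cartan_def
  proof (rule theI[where P = "\<lambda>k. \<forall>t. t \<noteq> 0 \<longrightarrow> \<alpha> j (coroot G i t) = t powi k", OF k])
    fix k' assume "\<forall>t. t \<noteq> 0 \<longrightarrow> \<alpha> j (coroot G i t) = t powi k'"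
    with k have "(2::complex) powi k = 2 powi k'" by (metis zero_neq_numeral)
    then show "k' = k" by (simp add: powi_2_inject)
  qed
  then show "t \<noteq> 0 \<Longrightarrow> \<alpha> j (coroot G i t) = t powi cartan G i j" by blast
qed

text \<open>Conjugation of e_i by its own coroot at t is computed twice: as scaling by the root
  \<alpha>_i and, inside SL2, as scaling by t^2. Since e_i is nonzero, the two factors
  agree.\<close>

lemma cartan_diag: "cartan G i i = 2"
proof -
  have "\<alpha> i (coroot G i t) = t powi 2" if t: "t \<noteq> 0" for t
  proof -
    have eq: "\<alpha> i (coroot G i t) \<cdot>\<^sub>m chev_e G i = t\<^sup>2 \<cdot>\<^sub>m chev_e G i"
      using torus_e[OF coroot_in[OF t], of i] coroot_e[OF t, of i] coroot_inv[OF t, of i] by simp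
    obtain a b where ab: "a < n" "b < n" "chev_e G i $$ (a, b) \<noteq> 0"
      using e_nonzero[of i] eq_matI[of "0\<^sub>m n n" "chev_e G i"] by auto
    from arg_cong[OF eq, of "\<lambda>M. M $$ (a, b)"]
    have "\<alpha> i (coroot G i t) * chev_e G i $$ (a, b) = t\<^sup>2 * chev_e G i $$ (a, b)"
      unfolding index_smult_mat(1)[of a "chev_e G i" b, unfolded chev_dim, OF ab(1,2)] .
    then show ?thesis using ab by simp
  qed
  from this[of 2] cartan_powi[of 2 i i] have "(2::complex) powi cartan G i i = 2 powi 2" by simp
  then show ?thesis unfolding powi_2_inject .
qed

text \<open>Differentiating \<open>t powi cartan G j i\<close> at t = 1 gives the pairing of each
  coroot with the root; the sum follows by linearity.\<close>

lemma root_pairing_coroot_sum: "root_pairing G i (coroot_sum G \<zeta>) = (\<Sum>j\<in>UNIV. \<zeta> j * of_int (cartan G j i))"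
proof -
  have "gl_diff (\<lambda>c. c) (sroot G i) (chev_h G j) = of_int (cartan G j i)" for j
  proof -
    have 1: "((\<lambda>s. \<alpha> i (coroot G j (1 + s))) has_field_derivative
        gl_diff (\<lambda>c. c) (sroot G i) (chev_h G j)) (at 0)"
      by (rule reg_has_derivative[OF coroot_deriv]) (simp add: coroot_1)
    have "((\<lambda>s. (1 + s) powi cartan G j i) has_field_derivative of_int (cartan G j i)) (at (0::complex))"
      by (auto intro!: derivative_eq_intros)
    moreover have "\<forall>\<^sub>F s in nhds 0. \<alpha> i (coroot G j (1 + s)) = (1 + s) powi cartan G j i"
      using eventually_one_plus_nonzero by eventually_elim (simp add: cartan_powi)
    ultimately have "((\<lambda>s. \<alpha> i (coroot G j (1 + s))) has_field_derivative of_int (cartan G j i)) (at 0)"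
      using DERIV_cong_ev[OF refl _ refl, of "\<lambda>s. \<alpha> i (coroot G j (1 + s))"
        "\<lambda>s. (1 + s) powi cartan G j i" 0] by simp
    with 1 show ?thesis by (rule DERIV_unique)
  qed
  moreover have "mat n n (\<lambda>ab. chev_h G j $$ ab) = chev_h G j" for j
    by (intro eq_matI) auto
  ultimately show ?thesis
    unfolding root_pairing_def coroot_sum_def gl_diff_sum by simp
qed

end

lemma (in matrix_group) tangent_add:
  assumes "tangent n K Y" "tangent n K Z"
  shows "tangent n K (Y + Z)"
proof -
  from assms obtain X W where X: "mat_deriv n n X Y 0" "X 0 = 1\<^sub>m n" "\<forall>\<^sub>F t in nhds 0. X t \<in> K"
    and W: "mat_deriv n n W Z 0" "W 0 = 1\<^sub>m n" "\<forall>\<^sub>F t in nhds 0. W t \<in> K"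
    by (auto simp: tangent_def)
  have "mat_deriv n n (\<lambda>t. X t * W t) (Y + Z) 0"
    using mat_deriv_mult[OF X(1) W(1)] X(2) W(2) mat_derivD(2)[OF X(1)] mat_derivD(2)[OF W(1)] by simp
  moreover have "\<forall>\<^sub>F t in nhds 0. X t * W t \<in> K"
    using X(3) W(3) by eventually_elim (rule mult_in)
  ultimately show ?thesis unfolding tangent_def
    using X(2) W(2) by (intro exI[of _ "\<lambda>t. X t * W t"]) auto
qed

lemma tangent_smult:
  assumes "tangent n K Y"
  shows "tangent n K (c \<cdot>\<^sub>m Y)"
proof -
  from assms obtain X where X: "mat_deriv n n X Y 0" "X 0 = 1\<^sub>m n" "\<forall>\<^sub>F t in nhds 0. X t \<in> K"
    by (auto simp: tangent_def)
  have "((\<lambda>t. c * t) \<longlongrightarrow> c * 0) (nhds 0)" by (intro tendsto_intros filterlim_ident)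
  then have "\<forall>\<^sub>F t in nhds 0. X (c * t) \<in> K"
    using X(3) eventually_compose_filterlim[of "\<lambda>t. X t \<in> K" "nhds 0" "\<lambda>t. c * t"] by simp
  then show ?thesis unfolding tangent_def
    using mat_deriv_scale[OF X(1), of c] X(2) by (intro exI[of _ "\<lambda>t. X (c * t)"]) auto
qed

lemma (in matrix_group) tangent_zero: "tangent n K (mat n n (\<lambda>ab. 0))"
proof -
  have "mat n n (\<lambda>ab. 0) = (0\<^sub>m n n :: complex mat)" by (intro eq_matI) auto
  then show ?thesis unfolding tangent_def
    by (intro exI[of _ "\<lambda>_. 1\<^sub>m n"]) (auto simp: one_in intro!: mat_deriv_const)
qed

lemma mor_map_dim [simp]: "dim_row (mor_map m P g) = m" "dim_col (mor_map m P g) = m"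
  by (simp_all add: mor_map_def)

lemma (in matrix_group) tangent_sum:
  assumes "\<And>j. j \<in> S \<Longrightarrow> tangent n K (M j)"
  shows "tangent n K (mat n n (\<lambda>ab. \<Sum>j\<in>S. c j * M j $$ ab))"
  using assms
proof (induction S rule: infinite_finite_induct)
  case (insert j S)
  have "mat n n (\<lambda>ab. \<Sum>j\<in>insert j S. c j * M j $$ ab) =
      c j \<cdot>\<^sub>m M j + mat n n (\<lambda>ab. \<Sum>j\<in>S. c j * M j $$ ab)"
    using insert tangent_carrier[OF insert.prems, of j] by (intro eq_matI) auto
  then show ?case using insert by (auto intro!: tangent_add tangent_smult)
qed (simp_all add: tangent_zero)

lemma mult3_entry:
  fixes A B C :: "complex mat"
  assumes "A \<in> carrier_mat n n" "B \<in> carrier_mat n n" "C \<in> carrier_mat n n" "a < n" "b < n"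
  shows "(A * B * C) $$ (a, b) = (\<Sum>d<n. \<Sum>c<n. A $$ (a, c) * C $$ (d, b) * B $$ (c, d))"
proof -
  have "(A * B * C) $$ (a, b) = (\<Sum>c<n. A $$ (a, c) * (\<Sum>d<n. B $$ (c, d) * C $$ (d, b)))"
    using assms by (simp add: scalar_prod_def atLeast0LessThan)
  also have "\<dots> = (\<Sum>c<n. \<Sum>d<n. A $$ (a, c) * C $$ (d, b) * B $$ (c, d))"
    by (simp add: sum_distrib_left mult_ac)
  also have "\<dots> = (\<Sum>d<n. \<Sum>c<n. A $$ (a, c) * C $$ (d, b) * B $$ (c, d))"
    by (rule sum.swap)
  finally show ?thesis .
qed

section \<open>Simple root subgroups acting on the f_i, and signs of the Cartan integers\<close>

context pinned
begin

lemma prod_powi_two_roots: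
  assumes "h \<in> torus G"
  shows "(\<Prod>l\<in>UNIV. \<alpha> l h powi ((if l = j then int k else 0) - (if l = i then 1 else 0)))
    = \<alpha> j h ^ k * inverse (\<alpha> i h)"
proof -
  have "(\<Prod>l\<in>UNIV. \<alpha> l h powi ((if l = j then int k else 0) - (if l = i then 1 else 0)))
    = (\<Prod>l\<in>UNIV. (if l = j then \<alpha> l h ^ k else 1) * (if l = i then inverse (\<alpha> l h) else 1))"
    using root_nonzero[OF assms]
    by (intro prod.cong refl) (auto simp: power_int_diff divide_inverse power_int_minus)
  then show ?thesis by (simp add: prod.distrib)
qed

lemmas roots_independent = roots[unfolded simple_roots_def, THEN conjunct2, THEN conjunct1]
lemmas roots_positive = roots[unfolded simple_roots_def, THEN conjunct2, THEN conjunct2, THEN conjunct1]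
lemmas roots_negative = roots[unfolded simple_roots_def, THEN conjunct2, THEN conjunct2, THEN conjunct2]

text \<open>Every root is a nonnegative or a nonpositive combination of simple roots, and
  independence makes the coefficients unique. Here the coefficient at i is -1 and the one at j is k
  > 0, so both signs occur.\<close>

lemma weight_not_root:
  assumes ij: "i \<noteq> j" and k: "k \<ge> 1"
    and \<psi>: "\<And>h. h \<in> torus G \<Longrightarrow> reg \<psi> h = \<alpha> j h ^ k * inverse (\<alpha> i h)"
  shows "\<not> is_root n (torus G) (grp G) \<psi>"
proof
  assume root: "is_root n (torus G) (grp G) \<psi>"
  let ?c = "\<lambda>l. (if l = j then int k else 0) - (if l = i then 1 else 0)"
  have \<psi>': "reg \<psi> h = (\<Prod>l\<in>UNIV. \<alpha> l h powi ?c l)" if "h \<in> torus G" for h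
    unfolding \<psi>[OF that] prod_powi_two_roots[OF that] ..
  have ind: "c l = 0" if "\<forall>h\<in>torus G. (\<Prod>l\<in>UNIV. \<alpha> l h powi c l) = 1" for c :: "'i \<Rightarrow> int" and l
    by (rule roots_independent[THEN spec[of _ c], THEN mp, OF that, THEN spec])
  show False
  proof (cases "is_root n (torus G) (borel_plus G) \<psi>")
    case True
    from roots_positive[THEN spec[of _ \<psi>], THEN mp, OF True]
    obtain m :: "'i \<Rightarrow> nat" where m: "\<forall>h\<in>torus G. reg \<psi> h = (\<Prod>l\<in>UNIV. \<alpha> l h ^ m l)" ..
    have "(\<Prod>l\<in>UNIV. \<alpha> l h powi (?c l - int (m l))) = 1" if h: "h \<in> torus G" for h
    proof -
      have "(\<Prod>l\<in>UNIV. \<alpha> l h powi (?c l - int (m l))) =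
        (\<Prod>l\<in>UNIV. \<alpha> l h powi ?c l) / (\<Prod>l\<in>UNIV. \<alpha> l h ^ m l)"
        unfolding prod_dividef[symmetric]
        by (intro prod.cong refl)
          (simp only: power_int_diff[OF disjI1[OF root_nonzero[OF h]]] power_int_of_nat)
      also have "\<dots> = reg \<psi> h / reg \<psi> h"
        by (rule arg_cong2[where f = "(/)", OF \<psi>'[OF h, symmetric] m[rule_format, OF h, symmetric]])
      also have "\<dots> = 1" using \<psi>[OF h] root_nonzero[OF h] by simp
      finally show ?thesis .
    qed
    then have "?c i - int (m i) = 0" by (intro ind[of "\<lambda>l. ?c l - int (m l)"] ballI)
    with ij show False by simp
  next
    case False
    from roots_negative[THEN spec[of _ \<psi>], THEN mp, OF conjI[OF root False]]
    obtain m :: "'i \<Rightarrow> nat" where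
      m: "\<forall>h\<in>torus G. reg \<psi> h = inverse (\<Prod>l\<in>UNIV. \<alpha> l h ^ m l)" ..
    have "(\<Prod>l\<in>UNIV. \<alpha> l h powi (?c l + int (m l))) = 1" if h: "h \<in> torus G" for h
    proof -
      have "(\<Prod>l\<in>UNIV. \<alpha> l h powi (?c l + int (m l))) =
        (\<Prod>l\<in>UNIV. \<alpha> l h powi ?c l) * (\<Prod>l\<in>UNIV. \<alpha> l h ^ m l)"
        using root_nonzero[OF h] unfolding prod.distrib[symmetric]
        by (intro prod.cong) (simp_all only: power_int_add power_int_of_nat simp_thms)
      also have "\<dots> = reg \<psi> h * inverse (reg \<psi> h)"
        unfolding m[rule_format, OF h] inverse_inverse_eq
        by (simp only: \<psi>'[OF h, symmetric] m[rule_format, OF h])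
      also have "\<dots> = 1"
      proof (rule right_inverse)
        show "reg \<psi> h \<noteq> 0" unfolding \<psi>[OF h] using root_nonzero[OF h] by simp
      qed
      finally show ?thesis .
    qed
    then have "?c j + int (m j) = 0" by (intro ind[of "\<lambda>l. ?c l + int (m l)"] ballI)
    with ij k show False by simp
  qed
qed

text \<open>The conjugate is a polynomial in \<open>s\<close> whose coefficient of \<open>s\<^sup>k\<close> has weight
  \<open>k\<alpha>\<^sub>j - \<alpha>\<^sub>i\<close>, which is not a root for \<open>k \<ge> 1\<close>.\<close>

lemma up_f_other:
  assumes ij: "i \<noteq> j"
  shows "up j s * chev_f G i * up j (- s) = chev_f G i"
proof -
  let ?Q = "\<lambda>s. up j s * chev_f G i * up j (- s)"
  have Qc [simp]: "?Q s \<in> carrier_mat n n" for s by (intro mult_carrier_mat[of _ n n]) auto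
  have "\<exists>p. \<forall>s. ?Q s $$ (a, b) = poly p s" if "a < n" "b < n" for a b
  proof -
    have u: "poly_fun (\<lambda>s. up j s $$ (a, b))" "poly_fun (\<lambda>s. up j (- s) $$ (a, b))"
      if "a < n" "b < n" for a b
      using up_poly[OF that, of j 1] up_poly[OF that, of j "-1"] by simp_all
    have v: "poly_fun (\<lambda>s. (up j s * chev_f G i) $$ (a, b))" if "a < n" "b < n" for a b
      by (rule poly_fun.mult_mat[of _ n n _ n, OF _ _ u(1) poly_fun.const that]) auto
    have "poly_fun (\<lambda>s. ?Q s $$ (a, b))"
      by (rule poly_fun.mult_mat[of _ n n _ n, OF _ _ v u(2) that])
        (auto intro: mult_carrier_mat[of _ n n])
    then show ?thesis by (simp add: poly_fun_def)
  qed
  then obtain p where p: "\<And>a b s. a < n \<Longrightarrow> b < n \<Longrightarrow> ?Q s $$ (a, b) = poly (p a b) s" by metis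
  define C where "C k = mat n n (\<lambda>(a, b). coeff (p a b) k)" for k
  have C [simp]: "C k \<in> carrier_mat n n" for k by (simp add: C_def)
  \<comment> \<open>Membership in the Lie algebra is a set of linear conditions on the entries. They
    hold for all conjugates, hence for each coefficient of the polynomial in s.\<close>
  have lie: "C k \<in> lie_algebra n (grp G)" for k
  proof -
    have "gl_diff (\<lambda>c. c) q (C k) = 0" if q: "q \<in> vanishing (grp G)" for q
    proof -
      let ?d = "\<lambda>a b. deriv (\<lambda>t. reg q (1\<^sub>m n + t \<cdot>\<^sub>m unit_mat n a b)) 0"
      have "(\<Sum>a<n. \<Sum>b<n. Polynomial.smult (?d a b) (p a b)) = 0"
      proof (rule poly_eq_off_0)
        fix s
        have "?Q s \<in> lie_algebra n (grp G)"
          by (intro tangent_imp_lie_algebra grp.tangent_conj up_in up_inverse tangent_f)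
        then have "gl_diff (\<lambda>c. c) q (?Q s) = 0" using q by (simp add: lie_algebra_def)
        then show "poly (\<Sum>a<n. \<Sum>b<n. Polynomial.smult (?d a b) (p a b)) s = poly 0 s"
          by (simp add: gl_diff_carrier[OF Qc] poly_sum p)
      qed
      from arg_cong[OF this, of "\<lambda>r. coeff r k"] show ?thesis
        by (simp add: gl_diff_carrier[OF C] coeff_sum) (simp add: C_def)
    qed
    then show ?thesis by (simp add: lie_algebra_def)
  qed
  have weight: "h * C k * inv\<^bsub>GL n\<^esub> h = (\<alpha> j h ^ k * inverse (\<alpha> i h)) \<cdot>\<^sub>m C k" if h: "h \<in> torus G" for h k
  proof (rule eq_matI)
    let ?h' = "inv\<^bsub>GL n\<^esub> h"
    note hh = torus_inv[OF h]
    fix a b assume "a < dim_row ((\<alpha> j h ^ k * inverse (\<alpha> i h)) \<cdot>\<^sub>m C k)"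
      "b < dim_col ((\<alpha> j h ^ k * inverse (\<alpha> i h)) \<cdot>\<^sub>m C k)"
    then have ab: "a < n" "b < n" by (simp_all add: C_def)
    have conj: "h * ?Q s * ?h' = inverse (\<alpha> i h) \<cdot>\<^sub>m ?Q (\<alpha> j h * s)" for s
    proof -
      have "h * ?Q s * ?h' = (h * (up j s * chev_f G i) * ?h') * (h * up j (- s) * ?h')"
        using hh by (intro conj_mult[symmetric]) (auto intro: mult_carrier_mat[of _ n n])
      also have "h * (up j s * chev_f G i) * ?h' = (h * up j s * ?h') * (h * chev_f G i * ?h')"
        using hh by (intro conj_mult[symmetric]) auto
      also have "(h * up j s * ?h') * (h * chev_f G i * ?h') * (h * up j (- s) * ?h') =
          up j (\<alpha> j h * s) * (inverse (\<alpha> i h) \<cdot>\<^sub>m chev_f G i) * up j (- (\<alpha> j h * s))"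
        by (simp add: torus_up[OF h] torus_f[OF h])
      also have "\<dots> = inverse (\<alpha> i h) \<cdot>\<^sub>m ?Q (\<alpha> j h * s)"
        by (subst mult_smult_distrib[of _ n n _ n], simp, simp,
            subst mult_smult_assoc_mat[of _ n n _ n]) (auto intro: mult_carrier_mat[of _ n n])
      finally show ?thesis .
    qed
    \<comment> \<open>Conjugation by h multiplies by the inverse of \<alpha>_i(h) and replaces s by
      \<alpha>_j(h) s; written as an identity of polynomials in s, this can be compared coefficient
      by coefficient.\<close>
    have "(\<Sum>d<n. \<Sum>c<n. Polynomial.smult (h $$ (a, c) * ?h' $$ (d, b)) (p c d)) =
        Polynomial.smult (inverse (\<alpha> i h)) (pcompose (p a b) [:0, \<alpha> j h:])"
    proof (rule poly_eq_off_0)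
      fix s
      have "(h * ?Q s * ?h') $$ (a, b) = inverse (\<alpha> i h) * ?Q (\<alpha> j h * s) $$ (a, b)"
        unfolding conj using ab carrier_matD[OF Qc] by (subst index_smult_mat(1)) auto
      moreover have "(h * ?Q s * ?h') $$ (a, b) =
          (\<Sum>d<n. \<Sum>c<n. h $$ (a, c) * ?h' $$ (d, b) * poly (p c d) s)"
        unfolding mult3_entry[OF hh(5) Qc hh(4) ab]
        by (intro sum.cong refl) (simp only: p lessThan_iff)
      ultimately have "(\<Sum>d<n. \<Sum>c<n. h $$ (a, c) * ?h' $$ (d, b) * poly (p c d) s) =
          inverse (\<alpha> i h) * poly (p a b) (\<alpha> j h * s)"
        using p[OF ab, of "\<alpha> j h * s"] by (simp only:)
      then show "poly (\<Sum>d<n. \<Sum>c<n. Polynomial.smult (h $$ (a, c) * ?h' $$ (d, b)) (p c d)) s =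
          poly (Polynomial.smult (inverse (\<alpha> i h)) (pcompose (p a b) [:0, \<alpha> j h:])) s"
        by (simp add: poly_sum poly_pcompose mult.commute[of s])
    qed
    from arg_cong[OF this, of "\<lambda>r. coeff r k"]
    show "(h * C k * ?h') $$ (a, b) = ((\<alpha> j h ^ k * inverse (\<alpha> i h)) \<cdot>\<^sub>m C k) $$ (a, b)"
      using ab hh by (simp add: mult3_entry[of _ n] coeff_sum coeff_pcompose_linear) (simp add: C_def)
  qed (use carrier_matD[OF torus_inv(4)[OF h]] carrier_matD[OF torus_inv(5)[OF h]] in \<open>auto simp: C_def\<close>)
  have C0: "C k = 0\<^sub>m n n" if k: "k \<ge> 1" for k
  proof (rule ccontr)
    assume nz: "C k \<noteq> 0\<^sub>m n n"
    \<comment> \<open>The weight needs a representative that is regular on all of GL_n; the negative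
      exponent is realised by evaluating \<alpha>_i at the inverse matrix.\<close>
    have "regular_fun n (\<lambda>g. \<alpha> j g ^ k * \<alpha> i (inv\<^bsub>GL n\<^esub> g))"
      by (intro regular_fun.mult regular_fun.power regular_fun_reg regular_fun_inv)
    then obtain \<psi> where "\<And>g. g \<in> carrier (GL n) \<Longrightarrow> reg \<psi> g = \<alpha> j g ^ k * \<alpha> i (inv\<^bsub>GL n\<^esub> g)"
      by (auto simp: regular_fun_def)
    then have \<psi>: "reg \<psi> h = \<alpha> j h ^ k * inverse (\<alpha> i h)" if "h \<in> torus G" for h
      using that root_inv torus.in_GL by simp
    \<comment> \<open>\<open>is_root\<close> demands a nontrivial weight. A trivial one would
      contradict independence, because the exponent at i is -1.\<close>
    have "\<exists>h\<in>torus G. reg \<psi> h \<noteq> 1"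
    proof (rule ccontr)
      assume "\<not> (\<exists>h\<in>torus G. reg \<psi> h \<noteq> 1)"
      then have "\<forall>h\<in>torus G. (\<Prod>l\<in>UNIV. \<alpha> l h powi ((if l = j then int k else 0) - (if l = i then 1 else 0))) = 1"
        using \<psi> prod_powi_two_roots by simp
      then have "(if i = j then int k else 0) - (if i = i then 1 else 0) = 0"
        by (rule roots_independent[THEN spec, THEN mp, THEN spec])
      with ij show False by simp
    qed
    moreover have "alg_character (torus G) \<psi>"
      unfolding alg_character_def using \<psi> root_nonzero root_mult torus.mult_in
      by (simp add: power_mult_distrib)
    ultimately have "is_root n (torus G) (grp G) \<psi>"
      unfolding is_root_def using lie[of k] nz weight[of _ k] \<psi> by auto
    with weight_not_root[OF ij k \<psi>] show False by blast
  qed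
  show ?thesis
  proof (rule eq_matI)
    fix a b assume "a < dim_row (chev_f G i)" "b < dim_col (chev_f G i)"
    then have ab: "a < n" "b < n" by auto
    have "coeff (p a b) k = 0" if "k \<ge> 1" for k
      using arg_cong[OF C0[OF that], of "\<lambda>M. M $$ (a, b)"] ab by (simp add: C_def)
    then have "degree (p a b) = 0"
      by (metis One_nat_def Suc_leI leading_coeff_0_iff degree_0 neq0_conv)
    then have "poly (p a b) s = poly (p a b) 0" by (auto elim: degree_eq_zeroE)
    then show "?Q s $$ (a, b) = chev_f G i $$ (a, b)"
      using p[OF ab, of s] p[OF ab, of 0]
      by (simp add: up_0 left_mult_one_mat[OF chev_carrier(2)] right_mult_one_mat[OF chev_carrier(2)])
  qed (use carrier_matD[OF Qc[of s]] in auto)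
qed

text \<open>Conjugating \<open>f\<^sub>i\<close> by the image of \<open>(a, -1; 1, 0)\<close> under \<open>SL\<^sub>2\<close> for \<open>\<alpha>\<^sub>j\<close> gives a polynomial
  in \<open>a\<close>. For \<open>a \<noteq> 0\<close> the matrix is lower unipotent times diagonal times upper unipotent, so the
  result is also \<open>a\<close> to the power \<open>-a\<^sub>j\<^sub>i\<close> times a polynomial in \<open>1/a\<close> with nonzero constant term.\<close>

lemma cartan_nonpos:
  assumes ij: "i \<noteq> j"
  shows "cartan G j i \<le> 0"
proof (rule ccontr)
  assume "\<not> cartan G j i \<le> 0"
  then obtain m where m: "cartan G j i = int m" "m \<noteq> 0" by (cases "cartan G j i") auto
  define W where "W a = mor_map n (sl2_map G j) (mat2 a (-1) 1 0)" for a
  define W' where "W' a = mor_map n (sl2_map G j) (mat2 0 1 (-1) a)" for a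
  have W_c [simp]: "W a \<in> carrier_mat n n" "W' a \<in> carrier_mat n n" for a by (simp_all add: W_def W'_def)
  \<comment> \<open>The chosen entry of f_i becomes the constant term of q below and must therefore
    be nonzero.\<close>
  obtain r c where rc: "r < n" "c < n" "chev_f G i $$ (r, c) \<noteq> 0"
    using f_nonzero[of i] eq_matI[of "0\<^sub>m n n" "chev_f G i"] by auto
  have "poly_fun (\<lambda>a. W a $$ (b, d))" "poly_fun (\<lambda>a. W' a $$ (b, d))" if "b < n" "d < n" for b d
  proof -
    show "poly_fun (\<lambda>a. W a $$ (b, d))" unfolding W_def
      by (rule poly_fun_sl2(1)[of _ "\<lambda>a. mat2 0 1 (-1) a"])
        (use that in \<open>auto simp: SL2_mat2 mat2_mult mat2_one less_2_split intro: poly_fun.const poly_fun_ident\<close>)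
    show "poly_fun (\<lambda>a. W' a $$ (b, d))" unfolding W'_def
      by (rule poly_fun_sl2(1)[of _ "\<lambda>a. mat2 a (-1) 1 0"])
        (use that in \<open>auto simp: SL2_mat2 mat2_mult mat2_one less_2_split intro: poly_fun.const poly_fun_ident\<close>)
  qed
  then have Wp: "poly_fun (\<lambda>a. W a $$ (b, d))" "poly_fun (\<lambda>a. W' a $$ (b, d))" if "b < n" "d < n" for b d
    using that by blast+
  have v: "poly_fun (\<lambda>a. (W a * chev_f G i) $$ (b, d))" if "b < n" "d < n" for b d
    by (rule poly_fun.mult_mat[of _ n n _ n, OF _ _ Wp(1) poly_fun.const that]) auto
  have "poly_fun (\<lambda>a. (W a * chev_f G i * W' a) $$ (r, c))"
    by (rule poly_fun.mult_mat[of _ n n _ n, OF _ _ v Wp(2) rc(1,2)])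
      (auto intro: mult_carrier_mat[of _ n n])
  then obtain p where p: "\<And>a. (W a * chev_f G i * W' a) $$ (r, c) = poly p a"
    by (auto simp: poly_fun_def)
  have lp: "poly_fun (\<lambda>s. lo j s $$ (a, b))" "poly_fun (\<lambda>s. lo j (- s) $$ (a, b))"
    if "a < n" "b < n" for a b
    using lo_poly[OF that, of j 1] lo_poly[OF that, of j "-1"] by simp_all
  have v: "poly_fun (\<lambda>s. (lo j s * chev_f G i) $$ (b, d))" if "b < n" "d < n" for b d
    by (rule poly_fun.mult_mat[of _ n n _ n, OF _ _ lp(1) poly_fun.const that]) auto
  have "poly_fun (\<lambda>s. (lo j s * chev_f G i * lo j (- s)) $$ (r, c))"
    by (rule poly_fun.mult_mat[of _ n n _ n, OF _ _ v lp(2) rc(1,2)])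
      (auto intro: mult_carrier_mat[of _ n n])
  then obtain q where q: "\<And>s. (lo j s * chev_f G i * lo j (- s)) $$ (r, c) = poly q s"
    by (auto simp: poly_fun_def)
  have "poly p a = inverse a ^ m * poly q (inverse a)" if a: "a \<noteq> 0" for a
  proof -
    have W: "W a = lo j (inverse a) * (coroot G j a * up j (- inverse a))"
    proof -
      have "mat2 a (-1) 1 0 = mat2 1 0 (inverse a) 1 * (mat2 a 0 0 (inverse a) * mat2 1 (- inverse a) 0 1)"
        using a by (simp add: mat2_mult)
      then show ?thesis unfolding W_def lo_def coroot_def up_def
        using sl2.rho_mult SL2_diag[OF a] sl2.mult_in SL2_unip by simp
    qed
    have W': "W' a = up j (inverse a) * coroot G j (inverse a) * lo j (- inverse a)"
    proof -
      have "mat2 0 1 (-1) a = mat2 1 (inverse a) 0 1 * mat2 (inverse a) 0 0 a * mat2 1 0 (- inverse a) 1"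
        using a by (simp add: mat2_mult)
      moreover have "mat2 (inverse a) 0 0 a \<in> SL2" using SL2_diag[of "inverse a"] a by simp
      ultimately show ?thesis unfolding W'_def lo_def coroot_def up_def
        using sl2.rho_mult sl2.mult_in SL2_unip by simp
    qed
    have "W a * chev_f G i * W' a = lo j (inverse a) *
        (coroot G j a * (up j (- inverse a) * chev_f G i * up j (- (- inverse a))) * coroot G j (inverse a)) *
        lo j (- inverse a)"
      unfolding W W' by (simp add: assoc_mult_mat[of _ n n _ n _ n] mult_carrier_mat[of _ n n])
    \<comment> \<open>The innermost conjugation by the upper unipotent factor fixes f_i since i
      \<noteq> j; the diagonal factor then scales f_i by a^(-m).\<close>
    also have "\<dots> = lo j (inverse a) * (inverse (a ^ m) \<cdot>\<^sub>m chev_f G i) * lo j (- inverse a)"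
      using torus_f[OF coroot_in[OF a], of j i] coroot_inv[OF a, of j] cartan_powi[OF a, of i j] m
      unfolding up_f_other[OF ij] by simp
    also have "\<dots> = inverse (a ^ m) \<cdot>\<^sub>m (lo j (inverse a) * chev_f G i * lo j (- inverse a))"
      by (subst mult_smult_distrib[of _ n n _ n], simp, simp,
          subst mult_smult_assoc_mat[of _ n n _ n]) (auto intro: mult_carrier_mat[of _ n n])
    finally show ?thesis
      using rc p[of a] q[of "inverse a"] carrier_matD[OF lo_carrier]
      by (simp add: power_inverse)
  qed
  moreover have "poly q 0 \<noteq> 0"
    using q[of 0] rc by (simp add: lo_0 left_mult_one_mat[OF chev_carrier(2)] right_mult_one_mat[OF chev_carrier(2)])
  ultimately have "m = 0" by (rule pole_order_nonpos)
  with m show False by simp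
qed

text \<open>Transported to diagonal matrices through the isomorphism in \<open>alg_torus\<close>. It
  allows the weight projections for different coroots to be taken one after the other.\<close>

lemma torus_commute:
  assumes "g \<in> torus G" "h \<in> torus G"
  shows "g * h = h * g"
proof -
  obtain k P Q where PQ: "alg_hom n (torus G) k (diag_group k) P" "alg_hom k (diag_group k) n (torus G) Q"
    "\<forall>g\<in>torus G. mor_map n Q (mor_map k P g) = g"
    using torus unfolding alg_torus_def by blast
  have hom: "mor_map k P \<in> hom (GL n\<lparr>carrier := torus G\<rparr>) (GL k\<lparr>carrier := diag_group k\<rparr>)"
    using PQ(1) by (simp add: alg_hom_def)
  have P: "mor_map k P x \<in> diag_group k" if "x \<in> torus G" for x
    using hom_carrier[OF hom] that by auto
  have "mor_map k P (g * h) = mor_map k P (h * g)"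
  proof -
    have "mor_map k P g * mor_map k P h = mor_map k P h * mor_map k P g"
    proof (rule eq_matI)
      fix a b assume "a < dim_row (mor_map k P h * mor_map k P g)" "b < dim_col (mor_map k P h * mor_map k P g)"
      then have ab: "a < k" "b < k" by (auto simp: mor_map_def)
      have d: "mor_map k P x $$ (a, b) = 0" if "x \<in> torus G" "a < k" "b < k" "a \<noteq> b" for x a b
        using P[OF that(1)] that by (auto simp: diag_group_def diagonal_mat_def GL_carrier_iff)
      have "(mor_map k P x * mor_map k P y) $$ (a, b) =
          (if a = b then mor_map k P x $$ (a, a) * mor_map k P y $$ (a, a) else 0)"
        if "x \<in> torus G" "y \<in> torus G" for x y
      proof -
        have "(mor_map k P x * mor_map k P y) $$ (a, b) =
            (\<Sum>c\<in>{0..<k}. mor_map k P x $$ (a, c) * mor_map k P y $$ (c, b))"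
          using ab carrier_matD[OF mor_map_carrier] by (simp add: scalar_prod_def)
        also have "\<dots> = (\<Sum>c\<in>{0..<k}. if c = a then
            (if a = b then mor_map k P x $$ (a, a) * mor_map k P y $$ (a, a) else 0) else 0)"
          using d[OF that(1) ab(1)] d[OF that(2) _ ab(2)] ab by (intro sum.cong) auto
        finally show ?thesis using ab by simp
      qed
      from this[OF assms] this[OF assms(2,1)]
      show "(mor_map k P g * mor_map k P h) $$ (a, b) = (mor_map k P h * mor_map k P g) $$ (a, b)"
        by (simp add: mult.commute)
    qed (auto simp: mor_map_def)
    then show ?thesis
      using hom_mult[OF hom, of g h] hom_mult[OF hom, of h g] assms by simp
  qed
  then show ?thesis using PQ(3) torus.mult_in assms by metis
qed

end

subsection \<open>Fundamental representations\<close>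

lemma mor_diff_dim [simp]: "dim_row (mor_diff \<iota> m P X) = m" "dim_col (mor_diff \<iota> m P X) = m"
  by (simp_all add: mor_diff_def)

lemma smult_mat_vec:
  fixes A :: "'a::comm_ring_1 mat"
  assumes "dim_vec u = dim_col A"
  shows "(c \<cdot>\<^sub>m A) *\<^sub>v u = c \<cdot>\<^sub>v (A *\<^sub>v u)"
  by (rule eq_vecI) (use assms in \<open>auto simp: scalar_prod_def sum_distrib_left mult.assoc\<close>)

lemma mor_diff_sum_vec:
  assumes "u \<in> carrier_vec m" "a < m" "\<And>i. i \<in> S \<Longrightarrow> M i \<in> carrier_mat n n"
  shows "(mor_diff \<iota> m P (mat n n (\<lambda>ab. \<Sum>i\<in>S. c i * M i $$ ab)) *\<^sub>v u) $ a
    = (\<Sum>i\<in>S. c i * (mor_diff \<iota> m P (M i) *\<^sub>v u) $ a)"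
proof -
  have M: "mat n n (\<lambda>ab. M i $$ ab) = M i" if "i \<in> S" for i
    using assms(3)[OF that] by (intro eq_matI) auto
  have "(mor_diff \<iota> m P (mat n n (\<lambda>ab. \<Sum>i\<in>S. c i * M i $$ ab)) *\<^sub>v u) $ a =
      (\<Sum>b\<in>{0..<m}. (\<Sum>i\<in>S. c i * gl_diff \<iota> (P a b) (M i)) * u $ b)"
    using assms(1,2) by (simp add: mor_diff_def scalar_prod_def gl_diff_sum M)
  also have "\<dots> = (\<Sum>b\<in>{0..<m}. \<Sum>i\<in>S. c i * (gl_diff \<iota> (P a b) (M i) * u $ b))"
    by (simp add: sum_distrib_left sum_distrib_right mult_ac)
  also have "\<dots> = (\<Sum>i\<in>S. \<Sum>b\<in>{0..<m}. c i * (gl_diff \<iota> (P a b) (M i) * u $ b))"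
    by (rule sum.swap)
  also have "\<dots> = (\<Sum>i\<in>S. c i * (mor_diff \<iota> m P (M i) *\<^sub>v u) $ a)"
    using assms(1,2) by (simp add: mor_diff_def scalar_prod_def sum_distrib_left)
  finally show ?thesis .
qed

definition lin_form :: "nat \<Rightarrow> (nat \<Rightarrow> complex) \<Rightarrow> complex vec \<Rightarrow> complex" where
  "lin_form m l u = (\<Sum>a<m. l a * u $ a)"

lemma lin_form_add: "u \<in> carrier_vec m \<Longrightarrow> w \<in> carrier_vec m \<Longrightarrow>
    lin_form m l (u + w) = lin_form m l u + lin_form m l w"
  by (simp add: lin_form_def algebra_simps sum.distrib)

lemma lin_form_smult: "u \<in> carrier_vec m \<Longrightarrow> lin_form m l (c \<cdot>\<^sub>v u) = c * lin_form m l u"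
  by (simp add: lin_form_def sum_distrib_left mult_ac)

lemma lin_form_mat:
  assumes "A \<in> carrier_mat m m" "u \<in> carrier_vec m"
  shows "lin_form m l (A *\<^sub>v u) = (\<Sum>b<m. u $ b * (\<Sum>a<m. l a * A $$ (a, b)))"
proof -
  have "lin_form m l (A *\<^sub>v u) = (\<Sum>a<m. \<Sum>b<m. u $ b * (l a * A $$ (a, b)))"
    using assms by (simp add: lin_form_def scalar_prod_def atLeast0LessThan sum_distrib_left mult_ac)
  also have "\<dots> = (\<Sum>b<m. \<Sum>a<m. u $ b * (l a * A $$ (a, b)))"
    by (rule sum.swap)
  finally show ?thesis by (simp add: sum_distrib_left)
qed

lemma laurent_common_denominator:
  assumes "\<And>b. b < m \<Longrightarrow> laurent_fun (f b)"
  shows "\<exists>N p. \<forall>b<(m::nat). \<forall>t. t \<noteq> 0 \<longrightarrow> f b t * t ^ N = poly (p b) t"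
proof -
  have "\<forall>b. \<exists>q M. b < m \<longrightarrow> (\<forall>t. t \<noteq> 0 \<longrightarrow> f b t * t ^ M = poly q t)"
    using assms by (fastforce simp: laurent_fun_def)
  then obtain q M where q: "\<And>b t. b < m \<Longrightarrow> t \<noteq> 0 \<Longrightarrow> f b t * t ^ M b = poly (q b) t" by metis
  define N where "N = (\<Sum>b<m. M b)"
  have "f b t * t ^ N = poly (q b * monom 1 (N - M b)) t" if "b < m" "t \<noteq> 0" for b t
  proof -
    have "M b \<le> N" unfolding N_def using that by (intro member_le_sum) auto
    then have "t ^ N = t ^ M b * t ^ (N - M b)" by (simp flip: power_add)
    then show ?thesis using q[OF that] by (simp add: poly_monom mult.assoc[symmetric])
  qed
  then show ?thesis by (intro exI[of _ N] exI[of _ "\<lambda>b. q b * monom 1 (N - M b)"]) blast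
qed

context pinned
begin

text \<open>The value of \<open>miura_oper\<close> at a point, with the values of the \<Lambda>_j
  and g_j as parameters; \<kappa> = 0 and constant \<gamma> give Z.\<close>

definition oper_at :: "('i \<Rightarrow> complex) \<Rightarrow> ('i \<Rightarrow> complex) \<Rightarrow> complex mat" where
  "oper_at \<kappa> \<gamma> = mat n n (\<lambda>ab. (\<Sum>j\<in>UNIV. \<kappa> j * chev_e G j $$ ab) + (\<Sum>j\<in>UNIV. \<gamma> j * chev_h G j $$ ab))"

end

locale fundamental = pinned G for G :: "('i::finite) pinned_group" +
  fixes i :: 'i and V :: hw_rep
  assumes fundamental: "fundamental_rep G i V"
begin

abbreviation "m \<equiv> rdim V"
abbreviation "\<nu> \<equiv> hwvec V"
abbreviation "R \<equiv> mor_map m (rmap V)"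
abbreviation "dR \<equiv> mor_diff (\<lambda>c. c) m (rmap V)"
abbreviation "\<nu>f \<equiv> dR (chev_f G i) *\<^sub>v \<nu>"
abbreviation "\<delta> j \<equiv> (if j = i then 1 else 0)"

sublocale act: rep n "grp G" m "rmap V"
  by (rule alg_hom_rep[OF grp.subgroup]) (use fundamental in \<open>auto simp: fundamental_rep_def\<close>)

lemma hw_carrier [simp]: "\<nu> \<in> carrier_vec m" and hw_nonzero: "\<nu> \<noteq> 0\<^sub>v m"
  and hw_borel: "b \<in> borel_plus G \<Longrightarrow> \<exists>c. R b *\<^sub>v \<nu> = c \<cdot>\<^sub>v \<nu>"
  using fundamental by (auto simp: fundamental_rep_def)

lemma hw_dim [simp]: "dim_vec \<nu> = m"
  using hw_carrier by (rule carrier_vecD)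

lemma zero_smult_hw [simp]: "0 \<cdot>\<^sub>v \<nu> = 0\<^sub>v m"
  by (rule eq_vecI) auto

lemma R_vec_carrier [simp]: "u \<in> carrier_vec m \<Longrightarrow> R g *\<^sub>v u \<in> carrier_vec m"
  and dR_vec_carrier [simp]: "u \<in> carrier_vec m \<Longrightarrow> dR Y *\<^sub>v u \<in> carrier_vec m"
  by (auto intro: mult_mat_vec_carrier[of _ m m])

lemma R_mult_vec:
  "g \<in> grp G \<Longrightarrow> h \<in> grp G \<Longrightarrow> u \<in> carrier_vec m \<Longrightarrow> R (g * h) *\<^sub>v u = R g *\<^sub>v (R h *\<^sub>v u)"
  by (simp add: act.rho_mult assoc_mult_mat_vec[of _ m m _ m])

lemma R_inverse_vec:
  "g \<in> grp G \<Longrightarrow> h \<in> grp G \<Longrightarrow> g * h = 1\<^sub>m n \<Longrightarrow> u \<in> carrier_vec m \<Longrightarrow> R g *\<^sub>v (R h *\<^sub>v u) = u"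
  using R_mult_vec[of g h u] act.rho_one by simp

lemma coroot_hw:
  assumes "t \<noteq> 0"
  shows "R (coroot G j t) *\<^sub>v \<nu> = (if j = i then t else 1) \<cdot>\<^sub>v \<nu>"
proof -
  obtain \<omega> where "fundamental_weight G i \<omega>" "\<forall>h\<in>torus G. R h *\<^sub>v \<nu> = reg \<omega> h \<cdot>\<^sub>v \<nu>"
    using fundamental by (auto simp: fundamental_rep_def)
  then show ?thesis using coroot_in[OF assms, of j] assms by (simp add: fundamental_weight_def)
qed

lemma hw_entry: obtains a where "a < m" "\<nu> $ a \<noteq> 0"
  using hw_nonzero eq_vecI[of "0\<^sub>v m" \<nu>] carrier_vecD[OF hw_carrier] by auto

text \<open>The line of \<nu> is stable under B_+, so the subgroup acts by a scalar c(s). This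
  scalar is polynomial in s and satisfies c(s) c(-s) = 1, hence is constant with value c(0) =
  1.\<close>

lemma up_hw: "R (up j s) *\<^sub>v \<nu> = \<nu>"
proof -
  obtain c where c: "\<And>s. R (up j s) *\<^sub>v \<nu> = c s \<cdot>\<^sub>v \<nu>" using hw_borel[OF up_in(1)] by metis
  obtain a where a: "a < m" "\<nu> $ a \<noteq> 0" by (rule hw_entry)
  have e: "c s * \<nu> $ a = (\<Sum>b\<in>{0..<m}. reg (rmap V a b) (up j s) * \<nu> $ b)" for s
    using arg_cong[OF c[of s], of "\<lambda>v. v $ a"] a carrier_vecD[OF hw_carrier]
    by (simp add: mor_map_def scalar_prod_def)
  have "poly_fun (\<lambda>s. (\<Sum>b\<in>{0..<m}. reg (rmap V a b) (up j s) * \<nu> $ b) * inverse (\<nu> $ a))"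
    by (intro poly_fun.mult poly_fun.sum poly_fun.const up_poly_reg)
  then have "poly_fun c"
    by (rule poly_fun.cong) (use a in \<open>simp flip: e\<close>)
  then obtain p where p: "\<And>s. c s = poly p s" by (auto simp: poly_fun_def)
  have "c s * c (- s) = 1" for s
  proof -
    have "\<nu> = R (up j s) *\<^sub>v (R (up j (- s)) *\<^sub>v \<nu>)"
      by (rule R_inverse_vec[symmetric]) (auto intro: up_in up_inverse)
    also have "\<dots> = c (- s) \<cdot>\<^sub>v (c s \<cdot>\<^sub>v \<nu>)"
      unfolding c by (subst mult_mat_vec[of _ m m]) (auto simp: c)
    finally have "\<nu> $ a = c (- s) * (c s * \<nu> $ a)"
      using a carrier_vecD[OF hw_carrier] by (metis index_smult_vec(1) index_smult_vec(2))
    then show ?thesis using a by (simp add: field_simps)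
  qed
  then have "c s = c 0" using poly_mult_reflected_eq_1[of p s] p by simp
  moreover have "c 0 = 1"
    using arg_cong[OF c[of 0], of "\<lambda>v. v $ a"] a carrier_vecD[OF hw_carrier]
    by (simp add: up_0 act.rho_one)
  ultimately show ?thesis using c[of s] by simp
qed

lemma e_hw: "dR (chev_e G j) *\<^sub>v \<nu> = 0\<^sub>v m"
  by (rule act.drho_vec_eqI[OF up_deriv up_0, where f = "\<lambda>_. \<nu>"]) (auto simp: up_hw)

lemma h_hw: "dR (chev_h G j) *\<^sub>v \<nu> = \<delta> j \<cdot>\<^sub>v \<nu>"
proof (rule act.drho_vec_eqI[OF coroot_deriv, where f = "\<lambda>s. (if j = i then 1 + s else 1) \<cdot>\<^sub>v \<nu>"])
  show "\<forall>\<^sub>F s in nhds 0. R (coroot G j (1 + s)) *\<^sub>v \<nu> = (if j = i then 1 + s else 1) \<cdot>\<^sub>v \<nu>"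
    using eventually_one_plus_nonzero by eventually_elim (rule coroot_hw)
  show "((\<lambda>s. ((if j = i then 1 + s else 1) \<cdot>\<^sub>v \<nu>) $ a) has_field_derivative (\<delta> j \<cdot>\<^sub>v \<nu>) $ a) (at 0)"
    if "a < m" for a
    using that carrier_vecD[OF hw_carrier] by (auto intro!: derivative_eq_intros)
qed (auto simp: coroot_1)

text \<open>As the subgroup fixes \<nu>, only the conjugate of f_i matters. For j \<noteq> i it is
  f_i itself; for j = i it is f_i + s h_i - s^2 e_i, where h_i fixes \<nu> and e_i kills it.\<close>

lemma up_\<nu>f: "R (up j s) *\<^sub>v \<nu>f = \<nu>f + (if j = i then s else 0) \<cdot>\<^sub>v \<nu>"
proof -
  have 1: "R (up j s) *\<^sub>v \<nu>f = dR (up j s * chev_f G i * up j (- s)) *\<^sub>v \<nu>"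
    using act.drho_intertwine[OF up_in(2) up_in(2) up_inverse tangent_f hw_carrier, of j s i]
    by (simp add: up_hw)
  show ?thesis
  proof (cases "j = i")
    case False
    then have "R (up j s) *\<^sub>v \<nu>f = \<nu>f" using 1 up_f_other[of i j s] by simp
    then show ?thesis using False right_zero_vec[OF dR_vec_carrier[OF hw_carrier]] by simp
  next
    case True
    have "dR (chev_f G i + s \<cdot>\<^sub>m chev_h G i + (- s\<^sup>2) \<cdot>\<^sub>m chev_e G i) =
        dR (chev_f G i) + s \<cdot>\<^sub>m dR (chev_h G i) + (- s\<^sup>2) \<cdot>\<^sub>m dR (chev_e G i)"
      by (simp add: mor_diff_add[of _ n] mor_diff_smult[of _ n])
    then have "R (up j s) *\<^sub>v \<nu>f = \<nu>f + s \<cdot>\<^sub>v (dR (chev_h G i) *\<^sub>v \<nu>) + (- s\<^sup>2) \<cdot>\<^sub>v (dR (chev_e G i) *\<^sub>v \<nu>)"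
      using 1 True up_f[of i s]
      by (simp add: add_mult_distrib_mat_vec[of _ m m] smult_mat_vec)
    moreover have "(- s\<^sup>2) \<cdot>\<^sub>v 0\<^sub>v m = 0\<^sub>v m" by (rule eq_vecI) auto
    moreover have "\<nu>f + s \<cdot>\<^sub>v \<nu> \<in> carrier_vec m" by simp
    ultimately show ?thesis using True right_zero_vec[of "\<nu>f + s \<cdot>\<^sub>v \<nu>" m]
      by (simp add: h_hw e_hw)
  qed
qed

text \<open>The vector f_i \<nu> has weight \<omega>_i - \<alpha>_i, whose pairing with the coroot
  of index j is the exponent.\<close>

lemma coroot_\<nu>f:
  assumes t: "t \<noteq> 0"
  shows "R (coroot G j t) *\<^sub>v \<nu>f = (t powi (\<delta> j - cartan G j i)) \<cdot>\<^sub>v \<nu>f"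
proof -
  note [simp] = mult_mat_vec[of _ m m]
  have "R (coroot G j t) *\<^sub>v \<nu>f = dR (coroot G j t * chev_f G i * coroot G j (inverse t)) *\<^sub>v
      (R (coroot G j t) *\<^sub>v \<nu>)"
    using t by (intro act.drho_intertwine coroot_in_grp coroot_inverse tangent_f) auto
  also have "coroot G j t * chev_f G i * coroot G j (inverse t) = inverse (t powi cartan G j i) \<cdot>\<^sub>m chev_f G i"
    using torus_f[OF coroot_in[OF t], of j i] by (simp add: coroot_inv[OF t] cartan_powi[OF t])
  also have "dR \<dots> = inverse (t powi cartan G j i) \<cdot>\<^sub>m dR (chev_f G i)"
    by (simp add: mor_diff_smult[of _ n])
  also have "\<dots> *\<^sub>v (R (coroot G j t) *\<^sub>v \<nu>) =
      (inverse (t powi cartan G j i) * (if j = i then t else 1)) \<cdot>\<^sub>v \<nu>f"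
    by (simp add: coroot_hw[OF t] smult_mat_vec smult_smult_assoc mult.commute)
  also have "inverse (t powi cartan G j i) * (if j = i then t else 1) = t powi (\<delta> j - cartan G j i)"
    using t by (auto simp: power_int_diff power_int_minus divide_inverse)
  finally show ?thesis .
qed

lemma e_\<nu>f: "dR (chev_e G j) *\<^sub>v \<nu>f = \<delta> j \<cdot>\<^sub>v \<nu>"
proof (rule act.drho_vec_eqI[OF up_deriv up_0, where f = "\<lambda>s. \<nu>f + (if j = i then s else 0) \<cdot>\<^sub>v \<nu>"])
  show "((\<lambda>s. (\<nu>f + (if j = i then s else 0) \<cdot>\<^sub>v \<nu>) $ a) has_field_derivative (\<delta> j \<cdot>\<^sub>v \<nu>) $ a) (at 0)"
    if "a < m" for a
  proof -
    have "((\<lambda>s. \<nu>f $ a + (if j = i then s else 0) * \<nu> $ a) has_field_derivative \<delta> j * \<nu> $ a) (at 0)"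
      by (auto intro!: derivative_eq_intros)
    then show ?thesis using that
      by (cases "j = i") (simp_all del: index_mult_mat_vec)
  qed
qed (auto simp: up_\<nu>f)

lemma h_\<nu>f: "dR (chev_h G j) *\<^sub>v \<nu>f = of_int (\<delta> j - cartan G j i) \<cdot>\<^sub>v \<nu>f"
proof (rule act.drho_vec_eqI[OF coroot_deriv, where f = "\<lambda>s. ((1 + s) powi (\<delta> j - cartan G j i)) \<cdot>\<^sub>v \<nu>f"])
  show "\<forall>\<^sub>F s in nhds 0. R (coroot G j (1 + s)) *\<^sub>v \<nu>f = ((1 + s) powi (\<delta> j - cartan G j i)) \<cdot>\<^sub>v \<nu>f"
    using eventually_one_plus_nonzero by eventually_elim (rule coroot_\<nu>f)
  show "((\<lambda>s. (((1 + s) powi (\<delta> j - cartan G j i)) \<cdot>\<^sub>v \<nu>f) $ a) has_field_derivative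
      (of_int (\<delta> j - cartan G j i) \<cdot>\<^sub>v \<nu>f) $ a) (at 0)" if "a < m" for a
  proof -
    have "((\<lambda>s. (1 + s) powi k * \<nu>f $ a) has_field_derivative of_int k * \<nu>f $ a) (at 0)" for k
      by (auto intro!: derivative_eq_intros)
    from this[of "\<delta> j - cartan G j i"] show ?thesis using that
      by (simp only: index_smult_vec dim_mult_mat_vec mor_diff_dim)
  qed
qed (auto simp: coroot_1)

text \<open>The projection onto the highest weight line along the other weight spaces, extracted one
  coroot at a time as a coefficient of the Laurent polynomial \<open>t \<mapsto> l(t\<^sup>\<alpha> u)\<close>.\<close>

lemma ex_weight_form:
  "\<exists>l. lin_form m l \<nu> = 1 \<and> (\<forall>j\<in>S. \<forall>t u. t \<noteq> 0 \<longrightarrow> u \<in> carrier_vec m \<longrightarrow>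
    lin_form m l (R (coroot G j t) *\<^sub>v u) = (if j = i then t else 1) * lin_form m l u)"
proof (induction S rule: infinite_finite_induct)
  case (infinite S)
  then show ?case by simp
next
  case empty
  obtain a where a: "a < m" "\<nu> $ a \<noteq> 0" by (rule hw_entry)
  have "lin_form m (\<lambda>b. if b = a then inverse (\<nu> $ a) else 0) \<nu> =
      (\<Sum>b<m. if b = a then inverse (\<nu> $ a) * \<nu> $ a else 0)"
    unfolding lin_form_def by (intro sum.cong) auto
  then show ?case using a by auto
next
  case (insert j S)
  then obtain l where l: "lin_form m l \<nu> = 1"
    "\<And>j t u. j \<in> S \<Longrightarrow> t \<noteq> 0 \<Longrightarrow> u \<in> carrier_vec m \<Longrightarrow>
      lin_form m l (R (coroot G j t) *\<^sub>v u) = (if j = i then t else 1) * lin_form m l u" by auto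
  let ?d = "if j = i then 1 else (0::nat)"
  have d: "(if j = i then t else 1) = t ^ ?d" for t :: complex by simp
  have lau: "laurent_fun (\<lambda>s. \<Sum>a<m. l a * R (coroot G j s) $$ (a, b))" if "b < m" for b
  proof (intro laurent_fun.sum laurent_fun.mult laurent_fun.const)
    fix a assume "a \<in> {..<m}"
    then show "laurent_fun (\<lambda>s. R (coroot G j s) $$ (a, b))"
      using coroot_laurent[of "rmap V a b" j] that by (simp add: mor_map_def)
  qed
  from laurent_common_denominator[of m "\<lambda>b s. \<Sum>a<m. l a * R (coroot G j s) $$ (a, b)", OF lau] obtain N p where
    p: "\<And>b s. b < m \<Longrightarrow> s \<noteq> 0 \<Longrightarrow> (\<Sum>a<m. l a * R (coroot G j s) $$ (a, b)) * s ^ N = poly (p b) s"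
    by blast
  \<comment> \<open>q u is the numerator of the Laurent polynomial in t obtained by applying l to
    the coroot at t acting on u. Because of the common denominator \<open>t ^ N\<close>, its
    coefficient of \<open>t ^ ?d\<close> sits at index N + ?d; l' extracts it.\<close>
  define q where "q u = (\<Sum>b<m. Polynomial.smult (u $ b) (p b))" for u
  define l' where "l' b = coeff (p b) (N + ?d)" for b
  have q: "lin_form m l (R (coroot G j s) *\<^sub>v u) * s ^ N = poly (q u) s"
    if "u \<in> carrier_vec m" "s \<noteq> 0" for u s
    unfolding lin_form_mat[OF mor_map_carrier that(1)] q_def poly_sum poly_smult
    using p that by (simp add: sum_distrib_right mult.assoc)
  have l': "lin_form m l' u = coeff (q u) (N + ?d)" for u
    by (simp add: lin_form_def l'_def q_def coeff_sum mult.commute)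
  \<comment> \<open>On \<nu> the coroot acts by exactly \<open>t ^ ?d\<close>, so the extraction
    keeps the normalisation.\<close>
  have "q \<nu> = monom 1 (N + ?d)"
  proof (rule poly_eq_off_0)
    fix s :: complex assume s: "s \<noteq> 0"
    show "poly (q \<nu>) s = poly (monom 1 (N + ?d)) s"
      unfolding q[OF hw_carrier s, symmetric] coroot_hw[OF s] lin_form_smult[OF hw_carrier] l(1) d
      by (simp add: poly_monom power_add)
  qed
  then have "lin_form m l' \<nu> = 1" unfolding l' by simp
  moreover have "lin_form m l' (R (coroot G k t) *\<^sub>v u) = (if k = i then t else 1) * lin_form m l' u"
    if k: "k \<in> insert j S" and t: "t \<noteq> 0" and u: "u \<in> carrier_vec m" for k t u
  proof (cases "k = j")
    case True
    \<comment> \<open>For the coroot just treated, acting by t substitutes s t for s in the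
      numerator, and the extracted coefficient is scaled by \<open>t ^ ?d\<close>.\<close>
    have "Polynomial.smult (t ^ N) (q (R (coroot G j t) *\<^sub>v u)) = pcompose (q u) [:0, t:]"
    proof (rule poly_eq_off_0)
      fix s :: complex assume s: "s \<noteq> 0"
      have "poly (q (R (coroot G j t) *\<^sub>v u)) s * t ^ N =
          lin_form m l (R (coroot G j s) *\<^sub>v (R (coroot G j t) *\<^sub>v u)) * s ^ N * t ^ N"
        unfolding q[OF R_vec_carrier[OF u] s] ..
      also have "R (coroot G j s) *\<^sub>v (R (coroot G j t) *\<^sub>v u) = R (coroot G j (s * t)) *\<^sub>v u"
        unfolding coroot_mult[OF s t]
        by (rule R_mult_vec[symmetric, OF coroot_in_grp(1)[OF s] coroot_in_grp(1)[OF t] u])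
      also have "lin_form m l \<dots> * s ^ N * t ^ N = lin_form m l \<dots> * (s * t) ^ N"
        by (simp only: power_mult_distrib mult.assoc)
      also have "\<dots> = poly (q u) (s * t)" using s t by (intro q[OF u]) simp
      finally show "poly (Polynomial.smult (t ^ N) (q (R (coroot G j t) *\<^sub>v u))) s =
          poly (pcompose (q u) [:0, t:]) s"
        by (simp add: poly_pcompose mult.commute[of "t ^ N"])
    qed
    from arg_cong[OF this, of "\<lambda>r. coeff r (N + ?d)"]
    have "t ^ N * lin_form m l' (R (coroot G j t) *\<^sub>v u) = t ^ N * (t ^ ?d * lin_form m l' u)"
      unfolding l' by (simp add: coeff_pcompose_linear power_add mult.assoc)
    then show ?thesis using t True by (simp add: d)
  next
    case False
    \<comment> \<open>A coroot treated before commutes with the new one, so the property of l passes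
      through the extraction unchanged.\<close>
    have "q (R (coroot G k t) *\<^sub>v u) = Polynomial.smult (if k = i then t else 1) (q u)"
    proof (rule poly_eq_off_0)
      fix s :: complex assume s: "s \<noteq> 0"
      have "R (coroot G j s) *\<^sub>v (R (coroot G k t) *\<^sub>v u) = R (coroot G k t) *\<^sub>v (R (coroot G j s) *\<^sub>v u)"
        unfolding R_mult_vec[OF coroot_in_grp(1)[OF s] coroot_in_grp(1)[OF t] u, symmetric]
          R_mult_vec[OF coroot_in_grp(1)[OF t] coroot_in_grp(1)[OF s] u, symmetric]
          torus_commute[OF coroot_in[OF s] coroot_in[OF t], of j k] ..
      then have "poly (q (R (coroot G k t) *\<^sub>v u)) s =
          lin_form m l (R (coroot G k t) *\<^sub>v (R (coroot G j s) *\<^sub>v u)) * s ^ N"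
        unfolding q[OF R_vec_carrier[OF u] s, symmetric] by (rule arg_cong)
      also have "\<dots> = (if k = i then t else 1) * (lin_form m l (R (coroot G j s) *\<^sub>v u) * s ^ N)"
        using l(2)[OF _ t R_vec_carrier[OF u]] k False by (simp only: insert_iff mult.assoc simp_thms)
      also have "\<dots> = poly (Polynomial.smult (if k = i then t else 1) (q u)) s"
        unfolding q[OF u s] by (rule poly_smult[symmetric])
      finally show "poly (q (R (coroot G k t) *\<^sub>v u)) s = poly (Polynomial.smult (if k = i then t else 1) (q u)) s" .
    qed
    then show ?thesis unfolding l' by simp
  qed
  ultimately show ?case by (intro exI[of _ l']) blast
qed

text \<open>Differentiating the equivariance under every coroot at t = 1 makes the form an
  eigenvector for Z on the whole representation, not only on W_i.\<close>

lemma ex_weight_form_diff: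
  "\<exists>l. lin_form m l \<nu> = 1 \<and> (\<forall>u\<in>carrier_vec m. lin_form m l (dR (coroot_sum G \<zeta>) *\<^sub>v u) = \<zeta> i * lin_form m l u)"
proof -
  from ex_weight_form[of UNIV] obtain l where l: "lin_form m l \<nu> = 1"
    "\<And>j t u. t \<noteq> 0 \<Longrightarrow> u \<in> carrier_vec m \<Longrightarrow>
      lin_form m l (R (coroot G j t) *\<^sub>v u) = (if j = i then t else 1) * lin_form m l u" by auto
  have h: "lin_form m l (dR (chev_h G j) *\<^sub>v u) = \<delta> j * lin_form m l u" if u: "u \<in> carrier_vec m" for j u
  proof -
    have 1: "((\<lambda>s. lin_form m l (R (coroot G j (1 + s)) *\<^sub>v u)) has_field_derivative
        lin_form m l (dR (chev_h G j) *\<^sub>v u)) (at 0)"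
      unfolding lin_form_def
      by (intro DERIV_sum DERIV_cmult mat_deriv_vec[of m m] act.rho_deriv coroot_deriv u)
        (auto simp: coroot_1)
    have "((\<lambda>s. (if j = i then 1 + s else 1) * lin_form m l u) has_field_derivative \<delta> j * lin_form m l u) (at 0)"
      by (auto intro!: derivative_eq_intros)
    moreover have "\<forall>\<^sub>F s in nhds 0. lin_form m l (R (coroot G j (1 + s)) *\<^sub>v u) =
        (if j = i then 1 + s else 1) * lin_form m l u"
      using eventually_one_plus_nonzero by eventually_elim (rule l(2)[OF _ u])
    ultimately have "((\<lambda>s. lin_form m l (R (coroot G j (1 + s)) *\<^sub>v u)) has_field_derivative
        \<delta> j * lin_form m l u) (at 0)"
      using DERIV_cong_ev[OF refl _ refl, of "\<lambda>s. lin_form m l (R (coroot G j (1 + s)) *\<^sub>v u)"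
        "\<lambda>s. (if j = i then 1 + s else 1) * lin_form m l u" 0] by blast
    with 1 show ?thesis by (rule DERIV_unique)
  qed
  have "lin_form m l (dR (coroot_sum G \<zeta>) *\<^sub>v u) = \<zeta> i * lin_form m l u" if u: "u \<in> carrier_vec m" for u
  proof -
    have "lin_form m l (dR (coroot_sum G \<zeta>) *\<^sub>v u) =
        (\<Sum>a<m. \<Sum>j\<in>UNIV. l a * (\<zeta> j * (dR (chev_h G j) *\<^sub>v u) $ a))"
      unfolding lin_form_def coroot_sum_def
      by (intro sum.cong refl) (use u in \<open>simp add: mor_diff_sum_vec sum_distrib_left del: index_mult_mat_vec\<close>)
    also have "\<dots> = (\<Sum>j\<in>UNIV. \<Sum>a<m. l a * (\<zeta> j * (dR (chev_h G j) *\<^sub>v u) $ a))"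
      by (rule sum.swap)
    also have "\<dots> = (\<Sum>j\<in>UNIV. \<zeta> j * lin_form m l (dR (chev_h G j) *\<^sub>v u))"
      by (simp add: lin_form_def sum_distrib_left mult_ac del: index_mult_mat_vec)
    also have "\<dots> = (\<Sum>j\<in>UNIV. if j = i then \<zeta> i * lin_form m l u else 0)"
      by (intro sum.cong refl) (simp add: h[OF u])
    finally show ?thesis by simp
  qed
  with l(1) show ?thesis by blast
qed

lemma oper_at_vec:
  assumes "u \<in> carrier_vec m" "a < m"
  shows "(dR (oper_at \<kappa> \<gamma>) *\<^sub>v u) $ a =
    (\<Sum>j\<in>UNIV. \<kappa> j * (dR (chev_e G j) *\<^sub>v u) $ a) + (\<Sum>j\<in>UNIV. \<gamma> j * (dR (chev_h G j) *\<^sub>v u) $ a)"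
proof -
  let ?E = "mat n n (\<lambda>ab. \<Sum>j\<in>UNIV. \<kappa> j * chev_e G j $$ ab)"
  let ?H = "mat n n (\<lambda>ab. \<Sum>j\<in>UNIV. \<gamma> j * chev_h G j $$ ab)"
  have "oper_at \<kappa> \<gamma> = ?E + ?H" unfolding oper_at_def by (rule eq_matI) auto
  then have "dR (oper_at \<kappa> \<gamma>) = dR ?E + dR ?H" by (simp add: mor_diff_add[of _ n])
  then have "dR (oper_at \<kappa> \<gamma>) *\<^sub>v u = dR ?E *\<^sub>v u + dR ?H *\<^sub>v u"
    using assms by (simp add: add_mult_distrib_mat_vec[of _ m m])
  then have "(dR (oper_at \<kappa> \<gamma>) *\<^sub>v u) $ a = (dR ?E *\<^sub>v u) $ a + (dR ?H *\<^sub>v u) $ a"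
    using assms carrier_vecD[OF dR_vec_carrier[OF assms(1)]] by (simp del: index_mult_mat_vec)
  then show ?thesis using assms by (simp add: mor_diff_sum_vec del: index_mult_mat_vec)
qed

lemma oper_at_hw: "dR (oper_at \<kappa> \<gamma>) *\<^sub>v \<nu> = \<gamma> i \<cdot>\<^sub>v \<nu>"
proof (rule eq_vecI)
  fix a assume "a < dim_vec (\<gamma> i \<cdot>\<^sub>v \<nu>)"
  then have a: "a < m" using carrier_vecD[OF hw_carrier] by simp
  have t: "\<gamma> j * (\<delta> j \<cdot>\<^sub>v \<nu>) $ a = (if j = i then \<gamma> i * \<nu> $ a else 0)" for j
    using a by simp
  have "(dR (oper_at \<kappa> \<gamma>) *\<^sub>v \<nu>) $ a = (\<Sum>j\<in>UNIV. if j = i then \<gamma> i * \<nu> $ a else 0)"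
    unfolding oper_at_vec[OF hw_carrier a] e_hw h_hw
    using a by (simp only: t) simp
  then show "(dR (oper_at \<kappa> \<gamma>) *\<^sub>v \<nu>) $ a = (\<gamma> i \<cdot>\<^sub>v \<nu>) $ a"
    using a carrier_vecD[OF hw_carrier] by simp
qed (use carrier_vecD[OF hw_carrier] in \<open>simp add: mor_diff_def\<close>)

text \<open>The Cartan part acts through the weight \<omega>_i - \<alpha>_i, and among the e_j only
  e_i leads from f_i \<nu> back to \<nu>.\<close>

lemma oper_at_\<nu>f:
  "dR (oper_at \<kappa> \<gamma>) *\<^sub>v \<nu>f = (\<gamma> i - (\<Sum>j\<in>UNIV. of_int (cartan G j i) * \<gamma> j)) \<cdot>\<^sub>v \<nu>f + \<kappa> i \<cdot>\<^sub>v \<nu>"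
proof (rule eq_vecI)
  let ?c = "\<gamma> i - (\<Sum>j\<in>UNIV. of_int (cartan G j i) * \<gamma> j)"
  note dims = carrier_vecD[OF hw_carrier] carrier_vecD[OF dR_vec_carrier[OF hw_carrier]]
  fix a assume "a < dim_vec (?c \<cdot>\<^sub>v \<nu>f + \<kappa> i \<cdot>\<^sub>v \<nu>)"
  then have a: "a < m" using dims by simp
  have "(dR (oper_at \<kappa> \<gamma>) *\<^sub>v \<nu>f) $ a = (\<Sum>j\<in>UNIV. if j = i then \<kappa> i * \<nu> $ a else 0) +
    (\<Sum>j\<in>UNIV. (if j = i then \<gamma> i * \<nu>f $ a else 0) - of_int (cartan G j i) * \<gamma> j * \<nu>f $ a)"
    unfolding oper_at_vec[OF dR_vec_carrier[OF hw_carrier] a] e_\<nu>f h_\<nu>f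
    using a dims by (intro arg_cong2[of _ _ _ _ "(+)"] sum.cong refl) (auto simp: algebra_simps simp del: index_mult_mat_vec)
  also have "\<dots> = \<kappa> i * \<nu> $ a + ?c * \<nu>f $ a"
    by (simp add: sum_subtractf left_diff_distrib sum_distrib_right del: index_mult_mat_vec)
  finally show "(dR (oper_at \<kappa> \<gamma>) *\<^sub>v \<nu>f) $ a = (?c \<cdot>\<^sub>v \<nu>f + \<kappa> i \<cdot>\<^sub>v \<nu>) $ a"
    using a dims by (simp del: index_mult_mat_vec)
qed (use carrier_vecD[OF hw_carrier] in \<open>simp add: mor_diff_def\<close>)

lemma coroot_sum_oper: "coroot_sum G \<zeta> = oper_at (\<lambda>_. 0) \<zeta>"
  unfolding coroot_sum_def oper_at_def by (rule eq_matI) auto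

lemma tangent_coroot_sum: "tangent n (grp G) (coroot_sum G \<zeta>)"
  unfolding coroot_sum_def by (rule grp.tangent_sum[OF tangent_h])

end

subsection \<open>Differentiation of rational functions\<close>

lemma ratfun_deriv_eqI:
  assumes "\<forall>\<^sub>\<infinity>x. ev F x = f x" "\<forall>\<^sub>\<infinity>x. (f has_field_derivative ev G x) (at x)"
  shows "ratfun_deriv F = G"
  by (rule ratfun_eqI[OF MOST_ev_deriv_eqI[OF assms]])

lemma ratfun_deriv_const [simp]: "ratfun_deriv (ratfun_const c) = 0"
  by (rule ratfun_deriv_eqI[of _ "\<lambda>_. c"]) auto

lemma ratfun_deriv_0_1 [simp]: "ratfun_deriv 0 = 0" "ratfun_deriv 1 = 0"
  using ratfun_deriv_const[of 0] ratfun_deriv_const[of 1] by simp_all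

lemma ratfun_deriv_to_fract [simp]: "ratfun_deriv (to_fract p) = to_fract (pderiv p)"
  by (rule ratfun_deriv_eqI[of _ "poly p"]) (auto intro: poly_DERIV)

lemma ratfun_deriv_add: "ratfun_deriv (F + G) = ratfun_deriv F + ratfun_deriv G"
proof (rule ratfun_deriv_eqI[OF MOST_ev_add])
  from MOST_ev_deriv[of F] MOST_ev_deriv[of G] MOST_ev_add[of "ratfun_deriv F" "ratfun_deriv G"]
  show "\<forall>\<^sub>\<infinity>x. ((\<lambda>x. ev F x + ev G x) has_field_derivative ev (ratfun_deriv F + ratfun_deriv G) x) (at x)"
    by eventually_elim (simp add: DERIV_add)
qed

lemma ratfun_deriv_diff: "ratfun_deriv (F - G) = ratfun_deriv F - ratfun_deriv G"
  using ratfun_deriv_add[of "F - G" G] by simp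

lemma ratfun_deriv_mult: "ratfun_deriv (F * G) = ratfun_deriv F * G + ratfun_deriv G * F"
proof (rule ratfun_deriv_eqI[OF MOST_ev_mult])
  from MOST_ev_deriv[of F] MOST_ev_deriv[of G] MOST_ev_mult[of "ratfun_deriv F" G]
    MOST_ev_mult[of "ratfun_deriv G" F] MOST_ev_add[of "ratfun_deriv F * G" "ratfun_deriv G * F"]
  show "\<forall>\<^sub>\<infinity>x. ((\<lambda>x. ev F x * ev G x) has_field_derivative ev (ratfun_deriv F * G + ratfun_deriv G * F) x) (at x)"
    by eventually_elim (simp add: DERIV_mult)
qed

lemma log_deriv_mult: "F \<noteq> 0 \<Longrightarrow> G \<noteq> 0 \<Longrightarrow> log_deriv (F * G) = log_deriv F + log_deriv G"
  by (simp add: log_deriv_def ratfun_deriv_mult field_simps)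

lemma log_deriv_1 [simp]: "log_deriv 1 = 0"
  by (simp add: log_deriv_def)

lemma log_deriv_inverse: "F \<noteq> 0 \<Longrightarrow> log_deriv (inverse F) = - log_deriv F"
  using log_deriv_mult[of F "inverse F"] by (simp add: eq_neg_iff_add_eq_0 add.commute)

lemma log_deriv_power: "F \<noteq> 0 \<Longrightarrow> log_deriv (F ^ k) = of_nat k * log_deriv F"
  by (induction k) (auto simp: log_deriv_mult algebra_simps)

lemma log_deriv_powi: "F \<noteq> 0 \<Longrightarrow> log_deriv (F powi k) = of_int k * log_deriv F"
  by (auto simp: power_int_def log_deriv_power log_deriv_inverse of_nat_nat)

lemma log_deriv_prod:
  "(\<And>i. i \<in> S \<Longrightarrow> F i \<noteq> 0) \<Longrightarrow> log_deriv (\<Prod>i\<in>S. F i) = (\<Sum>i\<in>S. log_deriv (F i))"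
  by (induction S rule: infinite_finite_induct) (auto simp: log_deriv_mult)

lemma ratfun_deriv_log: "F \<noteq> 0 \<Longrightarrow> ratfun_deriv F = log_deriv F * F"
  by (simp add: log_deriv_def)

lemma to_fract_eq_0 [simp]: "to_fract (p :: complex poly) = 0 \<longleftrightarrow> p = 0"
  by (simp add: to_fract_def Zero_fract_def eq_fract)

lemma to_fract_1 [simp]: "to_fract (1 :: complex poly) = 1"
  by (simp add: to_fract_def One_fract_def)

lemma pderiv_linear [simp]: "pderiv [:- x, 1:] = (1 :: complex poly)"
  by (simp add: pderiv_pCons one_pCons)

lemma regular_at_of_int [simp]: "regular_at (of_int k) x \<and> ev (of_int k) x = of_int k"
proof -
  have "regular_at (of_nat j) x \<and> ev (of_nat j) x = of_nat j" for j x
    by (induction j) (auto simp: regular_at_add ev_add)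
  then show ?thesis
    by (cases k) (auto simp: ev_uminus regular_at_uminus ev_add regular_at_add regular_at_diff)
qed

lemma to_fract_mult: "to_fract (p * q) = to_fract p * to_fract (q :: complex poly)"
  by (simp add: to_fract_def)

subsection \<open>Rational solutions of a first order equation\<close>

lemma ratfun_local_form:
  assumes "F \<noteq> 0"
  shows "\<exists>k S. F = S * to_fract [:- x, 1:] powi k \<and> regular_at S x \<and> ev S x \<noteq> 0"
proof -
  obtain p q where F: "q \<noteq> 0" "F = Fraction_Field.Fract p q" by (rule ratfun_cases)
  with assms have p: "p \<noteq> 0" by (auto simp: fract_collapse)
  let ?L = "[:- x, 1:]"
  obtain p' where p': "p = ?L ^ order x p * p'" "\<not> ?L dvd p'" using order_decomp[OF p, of x] by blast
  obtain q' where q': "q = ?L ^ order x q * q'" "\<not> ?L dvd q'" using order_decomp[OF F(1), of x] by blast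
  have nz: "poly p' x \<noteq> 0" "poly q' x \<noteq> 0" using p' q' by (simp_all add: poly_eq_0_iff_dvd)
  have pw: "to_fract (?L ^ k) = to_fract ?L ^ k" for k
    by (induction k) (simp_all add: to_fract_mult del: mult_pCons_left)
  have "F = to_fract p / to_fract q" using F by (simp add: to_fract_def)
  also have "\<dots> = (to_fract p' / to_fract q') * to_fract ?L powi (int (order x p) - int (order x q))"
    by (subst p'(1), subst q'(1)) (simp add: to_fract_mult pw power_int_diff mult.commute)
  finally show ?thesis
    using nz by (intro exI[of _ "int (order x p) - int (order x q)"] exI[of _ "to_fract p' / to_fract q'"])
      (auto simp: divide_inverse intro!: regular_at_mult regular_at_inverse simp: ev_mult ev_inverse regular_at_inverse)
qed

text \<open>After subtracting the value at a regular point x, a nonzero remainder has the form S (z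
  - x)^k with S(x) nonzero. Vanishing of the derivative gives k S(x) = 0, so k = 0, which
  contradicts the zero at x.\<close>

lemma ratfun_deriv_eq_0:
  assumes F: "ratfun_deriv F = 0"
  shows "\<exists>c. F = ratfun_const c"
proof -
  obtain p q where pq: "q \<noteq> 0" "F = Fraction_Field.Fract p q" by (rule ratfun_cases)
  have "\<exists>x. poly q x \<noteq> 0"
    using pq(1) poly_all_0_iff_0[of q] by blast
  then obtain x where x: "regular_at F x" using pq by (auto intro: regular_at_Fract)
  define H where "H = F - ratfun_const (ev F x)"
  have H: "regular_at H x" "ev H x = 0"
    unfolding H_def using x by (simp_all add: regular_at_diff)
  have "ratfun_deriv F = ratfun_deriv (H + ratfun_const (ev F x))" by (simp add: H_def)
  then have DH: "ratfun_deriv H = 0" using F by (simp add: ratfun_deriv_add)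
  have "H = 0"
  proof (rule ccontr)
    assume "H \<noteq> 0"
    then obtain k S where S: "H = S * to_fract [:- x, 1:] powi k" "regular_at S x" "ev S x \<noteq> 0"
      using ratfun_local_form by blast
    let ?L = "to_fract [:- x, 1:]"
    have S0: "S \<noteq> 0" using S by auto
    have "log_deriv S + of_int k * (1 / ?L) = 0"
      using DH \<open>H \<noteq> 0\<close> log_deriv_mult[OF S0, of "?L powi k"] log_deriv_powi[of ?L k]
      by (simp add: S(1) log_deriv_def)
    then have "?L * ratfun_deriv S + of_int k * S = 0"
      using S0 by (simp add: log_deriv_def field_simps)
    moreover have "ev (?L * ratfun_deriv S + of_int k * S) x = of_int k * ev S x"
      using S regular_at_deriv[OF S(2)] regular_at_of_int[of k x]
      by (simp add: ev_add ev_mult regular_at_mult)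
    ultimately have "k = 0" using S by simp
    then show False using S H by simp
  qed
  then show ?thesis by (auto simp: H_def)
qed

text \<open>The quotient is constant and monicity fixes the constant. Hence g_i determines the monic
  y_i.\<close>

lemma log_deriv_monic_inject:
  assumes "lead_coeff p = 1" "lead_coeff q = 1" "log_deriv (to_fract p) = log_deriv (to_fract q)"
  shows "p = q"
proof -
  have nz: "p \<noteq> 0" "q \<noteq> 0" using assms by auto
  have "log_deriv (to_fract p * inverse (to_fract q)) = 0"
    using assms nz by (simp add: log_deriv_mult log_deriv_inverse)
  then have "ratfun_deriv (to_fract p * inverse (to_fract q)) = 0"
    using nz by (simp add: log_deriv_def)
  then obtain c where "to_fract p * inverse (to_fract q) = ratfun_const c"
    using ratfun_deriv_eq_0 by blast
  then have "to_fract p = ratfun_const c * to_fract q"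
    using nz by (simp add: field_simps)
  then have "to_fract p = to_fract ([:c:] * q)"
    unfolding to_fract_mult ratfun_const_def .
  then have "p = [:c:] * q" by (simp add: to_fract_def eq_fract)
  then have "lead_coeff p = c" using assms(2) by (simp only: lead_coeff_mult) simp
  with assms(1) \<open>p = [:c:] * q\<close> show ?thesis by simp
qed

text \<open>Write T = S (z - x)^k with S(x) nonzero. The double pole on the right forces k = -1, and
  comparing the first two Taylor coefficients of N at x with those of the left-hand side yields the
  relation.\<close>

lemma residue_condition:
  assumes N: "regular_at N x" "ev N x \<noteq> 0"
    and eq: "ratfun_deriv T + ratfun_const \<kappa> * T = N / to_fract [:- x, 1:] ^ 2"
  shows "\<kappa> + ev (ratfun_deriv N) x / ev N x = 0"
proof -
  let ?L = "to_fract [:- x, 1:]"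
  have L: "?L \<noteq> 0" "regular_at ?L x" "ev ?L x = 0" "ratfun_deriv ?L = 1"
    by simp_all
  have "N \<noteq> 0" using N by auto
  then have "T \<noteq> 0" using eq L by auto
  then obtain k S where S: "T = S * ?L powi k" "regular_at S x" "ev S x \<noteq> 0"
    using ratfun_local_form by blast
  have S': "regular_at (ratfun_deriv S) x" by (rule regular_at_deriv[OF S(2)])
  have "S \<noteq> 0" using S by auto
  define U where "U = ?L * ratfun_deriv S + ratfun_const (of_int k) * S + ratfun_const \<kappa> * ?L * S"
  have U: "regular_at U x" "ev U x = of_int k * ev S x"
    unfolding U_def using S S' L
    by (auto simp: regular_at_add regular_at_mult ev_add ev_mult)
  have rk: "ratfun_const (of_int k) = of_int k"
    by (rule ratfun_eqI) simp
  have "ratfun_deriv (?L powi k) = of_int k * ?L powi k / ?L"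
  proof -
    have "?L powi k \<noteq> 0" using L(1) by simp
    from ratfun_deriv_log[OF this] show ?thesis
      unfolding log_deriv_powi[OF L(1)] by (simp add: log_deriv_def)
  qed
  then have "ratfun_deriv T + ratfun_const \<kappa> * T = U * (?L powi k / ?L)"
    unfolding S(1) U_def rk ratfun_deriv_mult using L(1) by (simp add: field_simps)
  then have N_eq: "N = U * ?L powi (k + 1)"
  proof -
    have "N = (ratfun_deriv T + ratfun_const \<kappa> * T) * ?L ^ 2" unfolding eq using L(1) by simp
    also have "\<dots> = U * ?L powi (k + 1)"
      using \<open>ratfun_deriv T + ratfun_const \<kappa> * T = U * (?L powi k / ?L)\<close> L(1)
      by (simp add: power_int_add power2_eq_square)
    finally show ?thesis .
  qed
  \<comment> \<open>N(x) is nonzero, which excludes k + 1 > 0. For k + 1 < 0 the factor U would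
    vanish at x, but U(x) = k S(x) and k is nonzero.\<close>
  have k: "k = -1"
  proof (rule ccontr)
    assume "k \<noteq> -1"
    then consider "k + 1 > 0" | "k + 1 < 0" by linarith
    then show False
    proof cases
      case 1
      then have "N = U * ?L ^ nat (k + 1)" using N_eq by (simp add: power_int_def)
      then have "ev N x = 0" using U L 1 by (simp add: ev_mult regular_at_power power_0_left)
      with N show False by simp
    next
      case 2
      then have "U = N * ?L ^ nat (- (k + 1))"
        using N_eq L(1) by (simp add: power_int_def field_simps)
      then have "ev U x = 0" using N L 2 by (simp add: ev_mult regular_at_power power_0_left)
      with U S 2 show False by simp
    qed
  qed
  then have NU: "N = U" using N_eq by simp
  \<comment> \<open>For k = -1 the two terms S' cancel. This cancellation is the absence of a
    logarithm: no further datum of T survives at x except S(x).\<close>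
  have "ratfun_deriv N = ?L * ratfun_deriv (ratfun_deriv S) + ratfun_const \<kappa> * (S + ?L * ratfun_deriv S)"
    unfolding NU U_def rk unfolding k
    by (simp add: ratfun_deriv_add ratfun_deriv_mult ratfun_deriv_diff L(4) algebra_simps)
  then have "ev (ratfun_deriv N) x = \<kappa> * ev S x"
    using S S' L regular_at_deriv[OF S'] by (simp add: ev_add ev_mult regular_at_add regular_at_mult)
  moreover have "ev N x = - ev S x" using NU U k by simp
  ultimately show ?thesis using S by simp
qed

text \<open>Deals with the polynomial remainder once all poles have been removed, so poles are the
  only obstruction to a rational solution.\<close>

lemma poly_ode_solvable:
  fixes Q :: "complex poly"
  shows "\<exists>R. pderiv R + Polynomial.smult \<kappa> R = Q"
proof (cases "\<kappa> = 0")
  case True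
  define R where "R = (\<Sum>i\<le>degree Q. monom (coeff Q i / of_nat (Suc i)) (Suc i))"
  have "pderiv R = Q"
  proof (rule poly_eqI)
    fix k
    have "coeff R (Suc k) = (\<Sum>i\<le>degree Q. if i = k then coeff Q k / of_nat (Suc k) else 0)"
      unfolding R_def coeff_sum by (intro sum.cong) auto
    also have "\<dots> = coeff Q k / of_nat (Suc k)"
      using le_degree[of Q k] by auto
    finally show "coeff (pderiv R) k = coeff Q k"
      by (simp add: coeff_pderiv del: of_nat_Suc)
  qed
  then show ?thesis using True by auto
next
  case False
  show ?thesis
  proof (induction "degree Q" arbitrary: Q rule: less_induct)
    case less
    show ?case
    proof (cases "degree Q = 0")
      case True
      then have "pderiv Q = 0" by (simp add: pderiv_eq_0_iff)
      then show ?thesis using False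
        by (intro exI[of _ "Polynomial.smult (1 / \<kappa>) Q"]) (simp add: pderiv_smult)
    next
      case deg: False
      \<comment> \<open>Q / \<kappa> solves the equation up to the error Q' / \<kappa>, whose degree
        is smaller.\<close>
      have "degree (- Polynomial.smult (1 / \<kappa>) (pderiv Q)) < degree Q"
        using deg False by (simp add: degree_pderiv)
      from less[OF this] obtain R where
        R: "pderiv R + Polynomial.smult \<kappa> R = - Polynomial.smult (1 / \<kappa>) (pderiv Q)" by blast
      have "pderiv (R + Polynomial.smult (1 / \<kappa>) Q) + Polynomial.smult \<kappa> (R + Polynomial.smult (1 / \<kappa>) Q)
          = (pderiv R + Polynomial.smult \<kappa> R) + Polynomial.smult (1 / \<kappa>) (pderiv Q) + Q"
        using False by (simp add: pderiv_add pderiv_smult smult_add_right)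
      then show ?thesis unfolding R by (intro exI) simp
    qed
  qed
qed

lemma rsquarefree_dvd:
  fixes y r :: "complex poly"
  assumes "rsquarefree y" "\<And>x. poly y x = 0 \<Longrightarrow> poly r x = 0"
  shows "y dvd r"
proof -
  have nz: "y \<noteq> 0" using assms by (simp add: rsquarefree_def)
  have prod_dvd: "(\<Prod>a\<in>A. [:- a, 1:]) dvd r" if "finite A" "\<And>a. a \<in> A \<Longrightarrow> poly r a = 0" for A and r :: "complex poly"
    using that
  proof (induction A arbitrary: r rule: finite_induct)
    case (insert a A)
    then have "[:- a, 1:] dvd r" by (simp add: poly_eq_0_iff_dvd)
    then obtain r' where r': "r = [:- a, 1:] * r'" by (elim dvdE)
    have "poly r' b = 0" if "b \<in> A" for b
      using insert.prems[of b] insert.hyps that by (auto simp: r')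
    then have "(\<Prod>a\<in>A. [:- a, 1:]) dvd r'" by (rule insert.IH)
    then show ?case using insert.hyps by (simp add: r' mult_dvd_mono del: mult_pCons_left)
  qed simp
  have "(\<Prod>a | poly y a = 0. [:- a, 1:]) dvd r"
    by (rule prod_dvd[OF poly_roots_finite[OF nz]]) (use assms(2) in simp)
  moreover have "y = Polynomial.smult (lead_coeff y) (\<Prod>a | poly y a = 0. [:- a, 1:])"
    using complex_poly_decompose_rsquarefree[OF assms(1)] by simp
  ultimately show ?thesis using nz by (metis smult_dvd_iff leading_coeff_0_iff)
qed

lemma poly_interpolation:
  fixes f :: "complex \<Rightarrow> complex"
  assumes "finite A"
  shows "\<exists>p. \<forall>a\<in>A. poly p a = f a"
  using assms
proof (induction A rule: finite_induct)
  case (insert a A)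
  then obtain p where p: "\<forall>b\<in>A. poly p b = f b" by blast
  let ?w = "\<Prod>b\<in>A. [:- b, 1:]"
  have "poly ?w a \<noteq> 0" using insert.hyps by (auto simp: poly_prod)
  moreover have "poly ?w b = 0" if "b \<in> A" for b using insert.hyps that by (auto simp: poly_prod)
  ultimately show ?case
    using p by (intro exI[of _ "p + Polynomial.smult ((f a - poly p a) / poly ?w a) ?w"]) auto
qed simp

text \<open>A solution is sought in the form \<open>P / y\<close> with a polynomial \<open>P\<close>: interpolation at the roots
  of \<open>y\<close> fixes \<open>P\<close> modulo \<open>y\<close>, and the condition on the residues makes what remains divisible by
  \<open>y\<close>.\<close>

lemma residue_condition_sufficient:
  fixes y N :: "complex poly"
  assumes y: "rsquarefree y"
    and N: "\<And>x. poly y x = 0 \<Longrightarrow> poly N x \<noteq> 0"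
    and res: "\<And>x. poly y x = 0 \<Longrightarrow> \<kappa> + poly (pderiv N) x / poly N x
        - poly (pderiv (pderiv y)) x / poly (pderiv y) x = 0"
  shows "\<exists>T. ratfun_deriv T + ratfun_const \<kappa> * T = to_fract N / to_fract y ^ 2"
proof -
  have nz: "y \<noteq> 0" and simple: "\<And>x. poly y x = 0 \<Longrightarrow> poly (pderiv y) x \<noteq> 0"
    using y rsquarefree_roots[of y] by (auto simp: rsquarefree_def)
  \<comment> \<open>For T = P / y the equation reads P' y - P y' + \<kappa> P y = N. At a root of y
    this leaves -P y' = N, which prescribes the value of P.\<close>
  obtain P0 where P0: "\<And>x. poly y x = 0 \<Longrightarrow> poly P0 x = - poly N x / poly (pderiv y) x"
    using poly_interpolation[OF poly_roots_finite[OF nz], of "\<lambda>x. - poly N x / poly (pderiv y) x"] by auto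
  have "y dvd N + P0 * pderiv y"
    by (rule rsquarefree_dvd[OF y]) (use P0 simple in simp)
  then obtain Q0 where Q0: "N + P0 * pderiv y = y * Q0" by (elim dvdE)
  \<comment> \<open>With P = P0 + y R the equation divided by y becomes P0' + \<kappa> P0 + y (R' +
    \<kappa> R) = Q0, so this difference must be a multiple of y. Here the residue condition
    enters.\<close>
  have "y dvd Q0 - pderiv P0 - Polynomial.smult \<kappa> P0"
  proof (rule rsquarefree_dvd[OF y])
    fix x assume x: "poly y x = 0"
    from arg_cong[OF Q0, of "\<lambda>r. poly r x"] have 1: "poly N x + poly P0 x * poly (pderiv y) x = 0"
      by (simp add: x)
    from arg_cong[OF Q0, of "\<lambda>r. poly (pderiv r) x"]
    have 2: "poly (pderiv N) x + (poly P0 x * poly (pderiv (pderiv y)) x + poly (pderiv P0) x * poly (pderiv y) x)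
        = poly Q0 x * poly (pderiv y) x"
      by (simp add: x pderiv_add pderiv_mult algebra_simps)
    have ny: "poly (pderiv y) x \<noteq> 0" by (rule simple[OF x])
    have P: "poly P0 x = - poly N x / poly (pderiv y) x"
      using 1 ny by (simp add: field_simps add_eq_0_iff)
    have 3: "\<kappa> * poly N x * poly (pderiv y) x + poly (pderiv N) x * poly (pderiv y) x
        - poly (pderiv (pderiv y)) x * poly N x = 0"
      using res[OF x] N[OF x] ny by (simp add: field_simps)
    have "(poly Q0 x - poly (pderiv P0) x - \<kappa> * poly P0 x) * poly (pderiv y) x * poly (pderiv y) x = 0"
    proof -
      have "(poly Q0 x - poly (pderiv P0) x - \<kappa> * poly P0 x) * poly (pderiv y) x
          = poly (pderiv N) x + poly P0 x * poly (pderiv (pderiv y)) x - \<kappa> * (poly P0 x * poly (pderiv y) x)"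
        using 2 by (simp add: algebra_simps)
      also have "poly P0 x * poly (pderiv y) x = - poly N x" using 1 by (simp add: add_eq_0_iff)
      finally have "(poly Q0 x - poly (pderiv P0) x - \<kappa> * poly P0 x) * poly (pderiv y) x * poly (pderiv y) x
          = poly (pderiv N) x * poly (pderiv y) x + (poly P0 x * poly (pderiv y) x) * poly (pderiv (pderiv y)) x
            + \<kappa> * poly N x * poly (pderiv y) x"
        by (simp add: algebra_simps)
      also have "\<dots> = 0"
        using 3 \<open>poly P0 x * poly (pderiv y) x = - poly N x\<close> by (simp add: algebra_simps)
      finally show ?thesis .
    qed
    then show "poly (Q0 - pderiv P0 - Polynomial.smult \<kappa> P0) x = 0" using ny by simp
  qed
  then obtain S where S: "Q0 - pderiv P0 - Polynomial.smult \<kappa> P0 = y * S" by (elim dvdE)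
  obtain R where R: "pderiv R + Polynomial.smult \<kappa> R = S" using poly_ode_solvable by blast
  define P where "P = P0 + y * R"
  have "pderiv P * y - P * pderiv y + Polynomial.smult \<kappa> (P * y)
      = y * (pderiv P0 + Polynomial.smult \<kappa> P0 + y * (pderiv R + Polynomial.smult \<kappa> R)) - P0 * pderiv y"
    unfolding P_def by (simp add: pderiv_add pderiv_mult algebra_simps smult_add_right)
  also have "\<dots> = N" using Q0 unfolding R S[symmetric] by (simp add: algebra_simps)
  finally have PN: "pderiv P * y - P * pderiv y + Polynomial.smult \<kappa> (P * y) = N" .
  have "ratfun_deriv (Fraction_Field.Fract P y) + ratfun_const \<kappa> * Fraction_Field.Fract P y
      = Fraction_Field.Fract (pderiv P * y - P * pderiv y + Polynomial.smult \<kappa> (P * y)) (y * y)"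
    using nz by (simp add: ratfun_deriv_Fract ratfun_const_def to_fract_def eq_fract algebra_simps)
  then show ?thesis unfolding PN
    using nz by (intro exI) (simp add: to_fract_def power2_eq_square)
qed

subsection \<open>The Bethe equations as solvability conditions\<close>

lemma ev_log_deriv:
  assumes "regular_at F x" "ev F x \<noteq> 0"
  shows "regular_at (log_deriv F) x" "ev (log_deriv F) x = ev (ratfun_deriv F) x / ev F x"
  using assms regular_at_deriv[OF assms(1)] regular_at_inverse[OF assms] ev_inverse[OF assms]
  by (simp_all add: log_deriv_def divide_inverse regular_at_mult ev_mult)

lemma to_fract_power: "to_fract (p ^ k) = to_fract (p :: complex poly) ^ k"
  by (induction k) (simp_all add: to_fract_mult)

lemma to_fract_prod: "to_fract (\<Prod>i\<in>A. p i) = (\<Prod>i\<in>A. to_fract (p i :: complex poly))"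
  by (induction A rule: infinite_finite_induct) (simp_all add: to_fract_mult)

text \<open>The index i is fixed and \<open>a j\<close> stands for a_ji. The assumptions make
  \<Lambda>_i / P_i a polynomial over the square of y_i, with a numerator that does not vanish at
  the roots of y_i: nonpositive \<open>a j\<close> keep the other y_j in the numerator, and
  \<open>a i = 2\<close> gives the double poles.\<close>

locale bethe_data =
  fixes a :: "'i::finite \<Rightarrow> int" and i :: 'i and y :: "'i \<Rightarrow> complex poly"
    and \<Lambda> :: "complex poly" and \<kappa> :: complex
  assumes a_i: "a i = 2" and a_nonpos: "\<And>j. j \<noteq> i \<Longrightarrow> a j \<le> 0"
    and y_nonzero: "\<And>j. y j \<noteq> 0" and \<Lambda>_nonzero: "\<Lambda> \<noteq> 0"
    and simple: "rsquarefree (y i)"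
    and no_common_\<Lambda>: "\<And>x. poly (y i) x = 0 \<Longrightarrow> poly \<Lambda> x \<noteq> 0"
    and no_common_y: "\<And>j x. poly (y i) x = 0 \<Longrightarrow> j \<noteq> i \<Longrightarrow> a j \<noteq> 0 \<Longrightarrow> poly (y j) x \<noteq> 0"
begin

definition M :: ratfun where
  "M = to_fract \<Lambda> * (\<Prod>j\<in>UNIV. to_fract (y j) powi (- a j))"

definition N0 :: "complex poly" where
  "N0 = \<Lambda> * (\<Prod>j\<in>UNIV - {i}. y j ^ nat (- a j))"

lemma M_eq: "M = to_fract N0 / to_fract (y i) ^ 2"
proof -
  have "(\<Prod>j\<in>UNIV. to_fract (y j) powi (- a j)) =
      to_fract (y i) powi (- a i) * (\<Prod>j\<in>UNIV - {i}. to_fract (y j) powi (- a j))"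
    by (rule prod.remove) auto
  also have "(\<Prod>j\<in>UNIV - {i}. to_fract (y j) powi (- a j)) = (\<Prod>j\<in>UNIV - {i}. to_fract (y j) ^ nat (- a j))"
    using a_nonpos by (intro prod.cong refl) (simp add: power_int_def)
  finally show ?thesis
    by (simp add: M_def N0_def to_fract_mult to_fract_prod to_fract_power a_i power_int_minus field_simps)
qed

context
  fixes x :: complex
  assumes x: "poly (y i) x = 0"
begin

lemma N0_value: "poly N0 x \<noteq> 0"
proof -
  have "poly (y j) x ^ nat (- a j) \<noteq> 0" if "j \<noteq> i" for j
    using no_common_y[OF x that] by (cases "a j = 0") auto
  then show ?thesis
    using no_common_\<Lambda>[OF x] by (auto simp: N0_def poly_prod)
qed

lemma residue_factor:
  obtains z where "y i = [:- x, 1:] * z" "poly z x \<noteq> 0"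
    "M * to_fract [:- x, 1:] ^ 2 = to_fract N0 / to_fract z ^ 2"
proof -
  from x have "[:- x, 1:] dvd y i" by (simp add: poly_eq_0_iff_dvd)
  then obtain z where z: "y i = [:- x, 1:] * z" by (elim dvdE)
  have "poly (pderiv (y i)) x \<noteq> 0" using simple x rsquarefree_roots by blast
  then have "poly z x \<noteq> 0" unfolding z pderiv_mult by simp
  moreover have "M * to_fract [:- x, 1:] ^ 2 = to_fract N0 / to_fract z ^ 2"
    unfolding M_eq z to_fract_mult by (simp add: power_mult_distrib)
  ultimately show ?thesis using that z by blast
qed

lemma local_regular:
  "regular_at (M * to_fract [:- x, 1:] ^ 2) x" "ev (M * to_fract [:- x, 1:] ^ 2) x \<noteq> 0"
proof -
  obtain z where z: "poly z x \<noteq> 0" "M * to_fract [:- x, 1:] ^ 2 = to_fract N0 / to_fract z ^ 2"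
    by (rule residue_factor)
  have "regular_at (to_fract z ^ 2) x" "ev (to_fract z ^ 2) x = poly z x ^ 2"
    by (simp_all add: regular_at_power)
  then show "regular_at (M * to_fract [:- x, 1:] ^ 2) x" "ev (M * to_fract [:- x, 1:] ^ 2) x \<noteq> 0"
    unfolding z(2) divide_inverse using z(1) N0_value
    by (auto simp: regular_at_mult regular_at_inverse ev_mult ev_inverse)
qed

lemma bethe_necessary:
  assumes T: "ratfun_deriv T + ratfun_const \<kappa> * T = ratfun_const c * M" and c: "c \<noteq> 0"
  shows "\<kappa> + ev (log_deriv (M * to_fract [:- x, 1:] ^ 2)) x = 0"
proof -
  let ?N = "M * to_fract [:- x, 1:] ^ 2"
  have "\<kappa> + ev (ratfun_deriv (ratfun_const c * ?N)) x / ev (ratfun_const c * ?N) x = 0"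
  proof (rule residue_condition)
    show "regular_at (ratfun_const c * ?N) x" "ev (ratfun_const c * ?N) x \<noteq> 0"
      using local_regular c by (simp_all add: regular_at_mult ev_mult)
    show "ratfun_deriv T + ratfun_const \<kappa> * T = ratfun_const c * ?N / to_fract [:- x, 1:] ^ 2"
      unfolding T by simp
  qed
  then show ?thesis
    using local_regular c regular_at_deriv[OF local_regular(1)]
    by (simp add: ratfun_deriv_mult ev_mult ev_log_deriv)
qed

text \<open>Dividing y_i by its factor at x leaves z with z(x) = y_i'(x) and 2 z'(x) = y_i''(x).
  This brings the Bethe expression into the form of
  \<open>residue_condition_sufficient\<close>.\<close>

lemma log_deriv_value:
  "ev (log_deriv (M * to_fract [:- x, 1:] ^ 2)) x =
    poly (pderiv N0) x / poly N0 x - poly (pderiv (pderiv (y i))) x / poly (pderiv (y i)) x"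
proof -
  obtain z where z: "y i = [:- x, 1:] * z" "poly z x \<noteq> 0"
    "M * to_fract [:- x, 1:] ^ 2 = to_fract N0 / to_fract z ^ 2"
    by (rule residue_factor)
  have nz: "to_fract N0 \<noteq> 0" "to_fract z \<noteq> 0" using N0_value z(2) by auto
  have ld: "regular_at (log_deriv (to_fract p)) x"
    "ev (log_deriv (to_fract p)) x = poly (pderiv p) x / poly p x" if "poly p x \<noteq> 0" for p
    using ev_log_deriv[of "to_fract p" x] that by simp_all
  have eq: "log_deriv (M * to_fract [:- x, 1:] ^ 2) = log_deriv (to_fract N0) - (log_deriv (to_fract z) + log_deriv (to_fract z))"
    unfolding z(3) divide_inverse using nz
    by (simp add: log_deriv_mult log_deriv_inverse log_deriv_power)
  have "ev (log_deriv (M * to_fract [:- x, 1:] ^ 2)) x =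
      poly (pderiv N0) x / poly N0 x - 2 * poly (pderiv z) x / poly z x"
    unfolding eq regular_at_diff(2)[OF ld(1)[OF N0_value] regular_at_add[OF ld(1)[OF z(2)] ld(1)[OF z(2)]]]
      ev_add[OF ld(1)[OF z(2)] ld(1)[OF z(2)]] ld(2)[OF N0_value] ld(2)[OF z(2)] by simp
  moreover have "poly (pderiv (y i)) x = poly z x" "poly (pderiv (pderiv (y i))) x = 2 * poly (pderiv z) x"
    unfolding z(1) by (simp_all add: pderiv_mult pderiv_add del: mult_pCons_left)
  ultimately show ?thesis by simp
qed

end

lemma bethe_sufficient:
  assumes "\<And>x. poly (y i) x = 0 \<Longrightarrow> \<kappa> + ev (log_deriv (M * to_fract [:- x, 1:] ^ 2)) x = 0"
  shows "\<exists>T. ratfun_deriv T + ratfun_const \<kappa> * T = M"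
  unfolding M_eq
  by (rule residue_condition_sufficient[OF simple N0_value])
    (use assms log_deriv_value in \<open>simp_all add: algebra_simps\<close>)

end

subsection \<open>The Pluecker condition\<close>

lemma MOST_gl_eval_mat:
  assumes "X \<in> carrier_mat k k" "\<forall>\<^sub>\<infinity>x. det (ev_mat X x) \<noteq> 0"
  shows "\<forall>\<^sub>\<infinity>x. ev_mat (mat m m (\<lambda>(a, b). gl_eval ratfun_const (P a b) X)) x = mor_map m P (ev_mat X x)"
  using assms(2) MOST_regular_mat[of X]
proof eventually_elim
  case (elim x)
  show ?case
    by (rule eq_matI) (use regular_gl_eval[OF assms(1) elim(2,1)] in \<open>auto simp: mor_map_def\<close>)
qed

definition ev_vec :: "ratfun vec \<Rightarrow> complex \<Rightarrow> complex vec" where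
  "ev_vec u x = map_vec (\<lambda>F. ev F x) u"

lemma MOST_ev_mat_vec:
  assumes A: "A \<in> carrier_mat m m" and u: "u \<in> carrier_vec m"
  shows "\<forall>\<^sub>\<infinity>x. ev_vec (A *\<^sub>v map_vec ratfun_const u) x = ev_mat A x *\<^sub>v u"
  using MOST_regular_mat[of A]
proof eventually_elim
  case (elim x)
  show ?case
  proof (rule eq_vecI)
    fix a assume "a < dim_vec (ev_mat A x *\<^sub>v u)"
    then have a: "a < m" using A by simp
    have "ev ((A *\<^sub>v map_vec ratfun_const u) $ a) x = ev (\<Sum>b\<in>{0..<m}. A $$ (a, b) * ratfun_const (u $ b)) x"
      using a A u by (simp add: scalar_prod_def)
    also have "\<dots> = (\<Sum>b\<in>{0..<m}. ev (A $$ (a, b) * ratfun_const (u $ b)) x)"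
      using a A elim by (intro regular_at_sum[THEN conjunct2] regular_at_mult) (auto simp: regular_mat_def)
    also have "\<dots> = (\<Sum>b\<in>{0..<m}. ev_mat A x $$ (a, b) * u $ b)"
      using a A elim by (intro sum.cong refl) (auto simp: regular_mat_def ev_mult)
    also have "\<dots> = (ev_mat A x *\<^sub>v u) $ a" using a A u by (simp add: scalar_prod_def)
    finally show "ev_vec (A *\<^sub>v map_vec ratfun_const u) x $ a = (ev_mat A x *\<^sub>v u) $ a"
      using a A by (simp add: ev_vec_def)
  qed (use A in \<open>simp add: ev_vec_def\<close>)
qed

lemma ratfun_vec_eq_iff:
  assumes "u \<in> carrier_vec m" "w \<in> carrier_vec m"
  shows "u = w \<longleftrightarrow> (\<forall>\<^sub>\<infinity>x. ev_vec u x = ev_vec w x)"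
proof
  assume e: "\<forall>\<^sub>\<infinity>x. ev_vec u x = ev_vec w x"
  show "u = w"
  proof (rule eq_vecI)
    fix a assume a: "a < dim_vec w"
    show "u $ a = w $ a"
    proof (rule ratfun_eqI)
      from e show "\<forall>\<^sub>\<infinity>x. ev (u $ a) x = ev (w $ a) x"
      proof eventually_elim
        case (elim x)
        from arg_cong[OF this, of "\<lambda>v. v $ a"] show ?case
          using a assms by (simp add: ev_vec_def)
      qed
    qed
  qed (use assms in auto)
qed simp

lemma MOST_mat_deriv:
  assumes "A \<in> carrier_mat n m"
  shows "\<forall>\<^sub>\<infinity>x. mat_deriv n m (ev_mat A) (ev_mat (map_mat ratfun_deriv A) x) x"
  using MOST_regular_mat[of A]
proof eventually_elim
  case (elim x)
  show ?case
  proof (rule mat_derivI)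
    fix a b assume "a < n" "b < m"
    then show "((\<lambda>s. ev_mat A s $$ (a, b)) has_field_derivative ev_mat (map_mat ratfun_deriv A) x $$ (a, b)) (at x)"
      using elim assms ev_deriv[of "A $$ (a, b)" x] by (auto simp: regular_mat_def)
  qed (use assms in auto)
qed

lemma MOST_ev_mat_mult:
  assumes "A \<in> carrier_mat n k" "B \<in> carrier_mat k m"
  shows "\<forall>\<^sub>\<infinity>x. ev_mat (A * B) x = ev_mat A x * ev_mat B x"
  using MOST_regular_mat[of A] MOST_regular_mat[of B] by eventually_elim (rule ev_mat_mult[OF assms])

lemma MOST_ev_mat_add:
  assumes "A \<in> carrier_mat n m" "B \<in> carrier_mat n m"
  shows "\<forall>\<^sub>\<infinity>x. ev_mat (A + B) x = ev_mat A x + ev_mat B x"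
  by (rule MOST_ev_mat_eqI[of _ n m]) (use assms MOST_ev_add in auto)

context fundamental
begin

text \<open>The derivative terms cancel and what remains is linear over the rational functions, so
  the two spanning vectors suffice. They are constant, so agreement can be tested on values.\<close>

lemma connection_agree_iff:
  assumes A: "A \<in> carrier_mat n n" "B \<in> carrier_mat n n"
  shows "(\<forall>s\<in>W_space G i V. connection_on V A s = connection_on V B s) \<longleftrightarrow>
    (\<forall>\<^sub>\<infinity>x. \<forall>u\<in>{\<nu>, \<nu>f}. dR (ev_mat A x) *\<^sub>v u = dR (ev_mat B x) *\<^sub>v u)"
proof -
  let ?c = "map_vec ratfun_const"
  define D where "D X = mor_diff ratfun_const m (rmap V) X" for X
  have Dc [simp]: "D X \<in> carrier_mat m m" for X by (simp add: D_def)
  have cc [simp]: "?c u \<in> carrier_vec m" if "u \<in> carrier_vec m" for u using that by simp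
  have W: "W_space G i V = {a \<cdot>\<^sub>v ?c \<nu> + b \<cdot>\<^sub>v ?c \<nu>f | a b. True}" by (simp add: W_space_def)
  have Dv [simp]: "D X *\<^sub>v s \<in> carrier_vec m" if "s \<in> carrier_vec m" for X s
    using that by (intro mult_mat_vec_carrier[of _ m m]) auto
  have conn: "connection_on V A s = connection_on V B s \<longleftrightarrow> D A *\<^sub>v s = D B *\<^sub>v s"
    if s: "s \<in> carrier_vec m" for s
  proof -
    have c: "map_vec ratfun_deriv s \<in> carrier_vec m" using s by simp
    show ?thesis
    proof
      assume "connection_on V A s = connection_on V B s"
      then have e: "map_vec ratfun_deriv s + D A *\<^sub>v s = map_vec ratfun_deriv s + D B *\<^sub>v s"
        by (simp add: connection_on_def D_def)
      show "D A *\<^sub>v s = D B *\<^sub>v s"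
      proof (rule eq_vecI)
        fix a assume "a < dim_vec (D B *\<^sub>v s)"
        then have a: "a < m" using carrier_vecD[OF Dv[OF s]] by simp
        from arg_cong[OF e, of "\<lambda>v. v $ a"] show "(D A *\<^sub>v s) $ a = (D B *\<^sub>v s) $ a"
          using a carrier_vecD[OF Dv[OF s]] by (simp del: index_mult_mat_vec)
      qed (simp add: D_def)
    qed (simp add: connection_on_def D_def)
  qed
  have eq_iff: "D A *\<^sub>v ?c u = D B *\<^sub>v ?c u \<longleftrightarrow> (\<forall>\<^sub>\<infinity>x. dR (ev_mat A x) *\<^sub>v u = dR (ev_mat B x) *\<^sub>v u)"
    if u: "u \<in> carrier_vec m" for u
  proof -
    have e: "\<forall>\<^sub>\<infinity>x. ev_vec (D X *\<^sub>v ?c u) x = dR (ev_mat X x) *\<^sub>v u" if "X \<in> carrier_mat n n" for X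
      using MOST_ev_mat_vec[OF Dc[of X] u] MOST_mor_diff[OF that, of m "rmap V"] unfolding D_def
      by eventually_elim simp
    have "D A *\<^sub>v ?c u = D B *\<^sub>v ?c u \<longleftrightarrow>
        (\<forall>\<^sub>\<infinity>x. ev_vec (D A *\<^sub>v ?c u) x = ev_vec (D B *\<^sub>v ?c u) x)"
      by (intro ratfun_vec_eq_iff[of _ m] Dv cc u)
    also have "\<dots> \<longleftrightarrow> (\<forall>\<^sub>\<infinity>x. dR (ev_mat A x) *\<^sub>v u = dR (ev_mat B x) *\<^sub>v u)"
      by (rule eventually_subst) (use e[OF A(1)] e[OF A(2)] in eventually_elim, simp)
    finally show ?thesis .
  qed
  have lin: "D X *\<^sub>v (a \<cdot>\<^sub>v ?c \<nu> + b \<cdot>\<^sub>v ?c \<nu>f) = a \<cdot>\<^sub>v (D X *\<^sub>v ?c \<nu>) + b \<cdot>\<^sub>v (D X *\<^sub>v ?c \<nu>f)" for X a b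
    by (simp add: mult_add_distrib_mat_vec[of _ m m] mult_mat_vec[of _ m m])
  have "(\<forall>s\<in>W_space G i V. connection_on V A s = connection_on V B s) \<longleftrightarrow>
      (\<forall>a b. D A *\<^sub>v (a \<cdot>\<^sub>v ?c \<nu> + b \<cdot>\<^sub>v ?c \<nu>f) = D B *\<^sub>v (a \<cdot>\<^sub>v ?c \<nu> + b \<cdot>\<^sub>v ?c \<nu>f))"
  proof -
    have Sc: "a \<cdot>\<^sub>v ?c \<nu> + b \<cdot>\<^sub>v ?c \<nu>f \<in> carrier_vec m" for a b
      by (intro add_carrier_vec smult_carrier_vec[THEN iffD2] cc hw_carrier dR_vec_carrier)
    show ?thesis unfolding W conn[OF Sc, symmetric] by blast
  qed
  also have "\<dots> \<longleftrightarrow> D A *\<^sub>v ?c \<nu> = D B *\<^sub>v ?c \<nu> \<and> D A *\<^sub>v ?c \<nu>f = D B *\<^sub>v ?c \<nu>f" (is "?L \<longleftrightarrow> ?R")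
  proof
    assume L: ?L
    have z: "0 \<cdot>\<^sub>v w = 0\<^sub>v m" "1 \<cdot>\<^sub>v w = w" if "w \<in> carrier_vec m" for w :: "ratfun vec"
      using that by auto
    show ?R using L[rule_format, of 1 0] L[rule_format, of 0 1] unfolding lin by (simp add: z)
  qed (simp add: lin)
  also have "\<dots> \<longleftrightarrow> (\<forall>\<^sub>\<infinity>x. \<forall>u\<in>{\<nu>, \<nu>f}. dR (ev_mat A x) *\<^sub>v u = dR (ev_mat B x) *\<^sub>v u)"
    unfolding eq_iff[OF hw_carrier] eq_iff[OF dR_vec_carrier[OF hw_carrier]]
    by (simp add: eventually_conj_iff)
  finally show ?thesis .
qed

text \<open>A rational matrix whose values represent those of W, so that the derivative of the
  represented curve is again rational.\<close>

definition rep_mat :: "ratfun mat \<Rightarrow> ratfun mat" where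
  "rep_mat W = mat m m (\<lambda>(a, b). gl_eval ratfun_const (rmap V a b) W)"

lemma rep_mat_carrier [simp]: "rep_mat W \<in> carrier_mat m m"
  by (simp add: rep_mat_def)

lemma MOST_rep_mat:
  assumes "W \<in> carrier (GL n)"
  shows "\<forall>\<^sub>\<infinity>x. ev_mat (rep_mat W) x = R (ev_mat W x)"
  unfolding rep_mat_def
proof (rule MOST_gl_eval_mat[OF GL_carrierD[OF assms]])
  show "\<forall>\<^sub>\<infinity>x. det (ev_mat W x) \<noteq> 0"
    using MOST_ev_mat_GL[OF assms] by eventually_elim (use GL_det(2) in blast)
qed

context
  fixes v W :: "ratfun mat"
  assumes v: "v \<in> ratfun_points n (borel_plus G)" and W_def: "W = inv\<^bsub>GL n\<^esub> v"
begin

lemma vW: "v \<in> carrier (GL n)" "W \<in> carrier (GL n)" "v \<in> carrier_mat n n" "W \<in> carrier_mat n n"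
proof -
  show v_GL: "v \<in> carrier (GL n)" using v by (simp add: ratfun_points_def)
  then show "W \<in> carrier (GL n)" "v \<in> carrier_mat n n" "W \<in> carrier_mat n n"
    unfolding W_def by (auto simp: GL_inv GL_carrierD)
qed

lemma MOST_vW: "\<forall>\<^sub>\<infinity>x. ev_mat v x \<in> borel_plus G \<and> ev_mat W x \<in> borel_plus G \<and>
    ev_mat v x * ev_mat W x = 1\<^sub>m n \<and> ev_mat W x * ev_mat v x = 1\<^sub>m n"
proof -
  have "\<forall>\<^sub>\<infinity>x. ev_mat v x \<in> borel_plus G"
    using v ratfun_points_iff[of n "borel_plus G" v] alg_groups(2) vW(3) by (simp add: alg_group_def)
  with MOST_ev_mat_GL[OF vW(1)] show ?thesis
  proof eventually_elim
    case (elim x)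
    then show ?case unfolding W_def
      using borel.inv_in[of "ev_mat v x"] GL_inv(3,4)[of "ev_mat v x" n] by auto
  qed
qed

text \<open>The representation carries the gauge action of v to that of its image: the conjugated Z
  comes from \<open>drho_conj\<close>, and the term with the derivative of the inverse from
  \<open>drho_left\<close>.\<close>

lemma gauge_action:
  "\<forall>\<^sub>\<infinity>x. \<forall>u\<in>carrier_vec m.
    dR (ev_mat (gauge n v (map_mat ratfun_const (coroot_sum G \<zeta>))) x) *\<^sub>v u =
    R (ev_mat v x) *\<^sub>v (dR (coroot_sum G \<zeta>) *\<^sub>v (R (ev_mat W x) *\<^sub>v u) + ev_mat (map_mat ratfun_deriv (rep_mat W)) x *\<^sub>v u)"
proof -
  let ?Z = "coroot_sum G \<zeta>" and ?Zr = "map_mat ratfun_const (coroot_sum G \<zeta>)"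
  let ?W' = "map_mat ratfun_deriv W"
  have Z: "?Z \<in> carrier_mat n n" "?Zr \<in> carrier_mat n n" by (simp_all add: coroot_sum_def)
  have Zr: "ev_mat ?Zr x = ?Z" for x using Z by (intro eq_matI) auto
  have W': "?W' \<in> carrier_mat n n" using vW by simp
  have 1: "\<forall>\<^sub>\<infinity>x. ev_mat (gauge n v ?Zr) x =
      ev_mat v x * ?Z * ev_mat W x + ev_mat v x * ev_mat ?W' x"
  proof -
    have c: "v * ?Zr \<in> carrier_mat n n" "v * ?Zr * W \<in> carrier_mat n n" "v * ?W' \<in> carrier_mat n n"
      using vW Z W' by (auto intro: mult_carrier_mat[of _ n n])
    from MOST_ev_mat_add[OF c(2,3)] MOST_ev_mat_mult[OF c(1) vW(4)]
      MOST_ev_mat_mult[OF vW(3) Z(2)] MOST_ev_mat_mult[OF vW(3) W']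
    show ?thesis by eventually_elim (simp add: gauge_def W_def Zr)
  qed
  from 1 MOST_vW MOST_nhds[OF MOST_vW] MOST_nhds[OF MOST_rep_mat[OF vW(2)]]
    MOST_mat_deriv[OF vW(4)] MOST_mat_deriv[OF rep_mat_carrier[of W]]
  show ?thesis
  proof eventually_elim
    case (elim x)
    let ?v = "ev_mat v x" and ?w = "ev_mat W x" and ?R' = "ev_mat (map_mat ratfun_deriv (rep_mat W)) x"
    have in_grp: "?v \<in> grp G" "?w \<in> grp G" using elim(2) borel_sub by auto
    have near: "\<forall>\<^sub>F s in nhds x. ev_mat W s \<in> grp G"
      using elim(3) by eventually_elim (use borel_sub in auto)
    have R': "?R' \<in> carrier_mat m m" by simp
    have "mat_deriv m m (\<lambda>s. R (ev_mat W s)) ?R' x"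
    proof (rule mat_derivI)
      fix a b assume ab: "a < m" "b < m"
      have "\<forall>\<^sub>F s in nhds x. ev_mat (rep_mat W) s $$ (a, b) = R (ev_mat W s) $$ (a, b)"
        using elim(4) by eventually_elim simp
      then show "((\<lambda>s. R (ev_mat W s) $$ (a, b)) has_field_derivative ?R' $$ (a, b)) (at x)"
        using mat_derivD(3)[OF elim(6) ab] DERIV_cong_ev[OF refl _ refl,
          of "\<lambda>s. ev_mat (rep_mat W) s $$ (a, b)" "\<lambda>s. R (ev_mat W s) $$ (a, b)" x] by blast
    qed auto
    then have left: "dR (?v * ev_mat ?W' x) = R ?v * ?R'"
      using elim(2) by (intro act.drho_left[OF in_grp(1) elim(5) _ near]) auto
    have conj: "dR (?v * ?Z * ?w) = R ?v * dR ?Z * R ?w"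
      using elim(2) by (intro act.drho_conj in_grp tangent_coroot_sum) auto
    show ?case
    proof
      fix u :: "complex vec" assume u: "u \<in> carrier_vec m"
      have "dR (ev_mat (gauge n v ?Zr) x) = R ?v * dR ?Z * R ?w + R ?v * ?R'"
        unfolding elim(1) left[symmetric] conj[symmetric]
        by (rule mor_diff_add[of _ n]) (use vW Z W' in \<open>auto intro!: mult_carrier_mat[of _ n n]\<close>)
      then show "dR (ev_mat (gauge n v ?Zr) x) *\<^sub>v u = R ?v *\<^sub>v (dR ?Z *\<^sub>v (R ?w *\<^sub>v u) + ?R' *\<^sub>v u)"
        using u R' mult_mat_vec_carrier[OF R' u]
        by (simp add: add_mult_distrib_mat_vec[of _ m m] mult_add_distrib_mat_vec[of _ m m]
            assoc_mult_mat_vec[of _ m m _ m] mult_carrier_mat[of _ m m])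
    qed
  qed
qed

text \<open>Multiplication by W moves v to the other side and leaves an intertwining relation that
  is linear in the action of W. A linear form can be applied to it directly.\<close>

lemma pluecker_iff:
  assumes A: "A \<in> carrier_mat n n"
  shows "(\<forall>s\<in>W_space G i V. connection_on V A s =
      connection_on V (gauge n v (map_mat ratfun_const (coroot_sum G \<zeta>))) s) \<longleftrightarrow>
    (\<forall>\<^sub>\<infinity>x. \<forall>u\<in>{\<nu>, \<nu>f}. R (ev_mat W x) *\<^sub>v (dR (ev_mat A x) *\<^sub>v u) =
      dR (coroot_sum G \<zeta>) *\<^sub>v (R (ev_mat W x) *\<^sub>v u) + ev_mat (map_mat ratfun_deriv (rep_mat W)) x *\<^sub>v u)"
proof -
  let ?B = "gauge n v (map_mat ratfun_const (coroot_sum G \<zeta>))"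
  have B: "?B \<in> carrier_mat n n"
    unfolding gauge_def using vW GL_inv(2)[OF vW(1)]
    by (auto intro!: add_carrier_mat mult_carrier_mat[of _ n n] simp: coroot_sum_def)
  show ?thesis
    unfolding connection_agree_iff[OF A B]
  proof (rule eventually_subst)
    from gauge_action[of \<zeta>] MOST_vW show "\<forall>\<^sub>\<infinity>x.
      (\<forall>u\<in>{\<nu>, \<nu>f}. dR (ev_mat A x) *\<^sub>v u = dR (ev_mat ?B x) *\<^sub>v u) =
      (\<forall>u\<in>{\<nu>, \<nu>f}. R (ev_mat W x) *\<^sub>v (dR (ev_mat A x) *\<^sub>v u) =
        dR (coroot_sum G \<zeta>) *\<^sub>v (R (ev_mat W x) *\<^sub>v u) + ev_mat (map_mat ratfun_deriv (rep_mat W)) x *\<^sub>v u)"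
    proof eventually_elim
      case (elim x)
      let ?v = "ev_mat v x" and ?w = "ev_mat W x"
      have in_grp: "?v \<in> grp G" "?w \<in> grp G" using elim(2) borel_sub by auto
      have "dR (ev_mat A x) *\<^sub>v u = dR (ev_mat ?B x) *\<^sub>v u \<longleftrightarrow> R ?w *\<^sub>v (dR (ev_mat A x) *\<^sub>v u) =
        dR (coroot_sum G \<zeta>) *\<^sub>v (R ?w *\<^sub>v u) + ev_mat (map_mat ratfun_deriv (rep_mat W)) x *\<^sub>v u"
        (is "?p = ?q \<longleftrightarrow> R ?w *\<^sub>v ?p = ?r") if u: "u \<in> carrier_vec m" for u
      proof -
        have q: "?q = R ?v *\<^sub>v ?r" using elim(1) u by blast
        have r: "?r \<in> carrier_vec m"
          using u mult_mat_vec_carrier[of "ev_mat (map_mat ratfun_deriv (rep_mat W)) x" m m u] by simp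
        have p: "?p \<in> carrier_vec m" using u by simp
        have "R ?w *\<^sub>v (R ?v *\<^sub>v ?r) = ?r" "R ?v *\<^sub>v (R ?w *\<^sub>v ?p) = ?p"
          using elim(2) by (auto intro!: R_inverse_vec in_grp r p)
        then show ?thesis unfolding q by metis
      qed
      then show ?case by simp
    qed
  qed
qed

end

end

lemma ratfun_const_add: "ratfun_const (a + b) = ratfun_const a + ratfun_const b"
  and ratfun_const_diff: "ratfun_const (a - b) = ratfun_const a - ratfun_const b"
  and ratfun_const_mult: "ratfun_const (a * b) = ratfun_const a * ratfun_const b"
  by (rule ratfun_eqI, simp add: ev_add ev_mult regular_at_diff)+

lemma ratfun_const_of_int: "ratfun_const (of_int k) = of_int k"
  by (rule ratfun_eqI) simp

lemma ratfun_const_sum: "ratfun_const (\<Sum>i\<in>A. f i) = (\<Sum>i\<in>A. ratfun_const (f i))"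
  by (induction A rule: infinite_finite_induct) (simp_all add: ratfun_const_add)

lemma ratfun_const_eq_0 [simp]: "ratfun_const c = 0 \<longleftrightarrow> c = 0"
  by (simp add: ratfun_const_def)

lemma MOST_ev_inverse: "\<forall>\<^sub>\<infinity>x. ev (inverse F) x = inverse (ev F x)"
proof (cases "F = 0")
  case False
  from MOST_regular[of F] MOST_nonzero_ev[OF this] show ?thesis
    by eventually_elim (rule ev_inverse)
qed simp

lemma MOST_ev_powi:
  assumes "F \<noteq> 0"
  shows "\<forall>\<^sub>\<infinity>x. ev (F powi k) x = ev F x powi k"
  using MOST_regular[of F] MOST_nonzero_ev[OF assms] by eventually_elim (rule regular_at_powi)

lemma MOST_ev_prod: "\<forall>\<^sub>\<infinity>x. ev (\<Prod>i\<in>A. F i) x = (\<Prod>i\<in>A. ev (F i) x)"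
proof (induction A rule: infinite_finite_induct)
  case (insert a A)
  from insert(3) MOST_ev_mult[of "F a" "prod F A"] show ?case
    by eventually_elim (use insert in simp)
qed simp_all

lemma ex_lin_form_ratfun:
  assumes A: "A \<in> carrier_mat m m" and u: "u \<in> carrier_vec m"
  shows "\<exists>F. (\<forall>\<^sub>\<infinity>x. ev F x = lin_form m l (ev_mat A x *\<^sub>v u)) \<and>
    (\<forall>\<^sub>\<infinity>x. ev (ratfun_deriv F) x = lin_form m l (ev_mat (map_mat ratfun_deriv A) x *\<^sub>v u))"
proof -
  define B where "B = A *\<^sub>v map_vec ratfun_const u"
  define F where "F = (\<Sum>a<m. ratfun_const (l a) * B $ a)"
  have B: "dim_vec B = m" using A by (simp add: B_def)
  have "\<forall>\<^sub>\<infinity>x. \<forall>a\<in>{..<m}. regular_at (B $ a) x"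
    by (intro eventually_ball_finite ballI MOST_regular) auto
  with MOST_ev_mat_vec[OF A u] have 1: "\<forall>\<^sub>\<infinity>x. ev F x = lin_form m l (ev_mat A x *\<^sub>v u)"
  proof eventually_elim
    case (elim x)
    have "ev F x = (\<Sum>a<m. ev (ratfun_const (l a) * B $ a) x)"
      unfolding F_def using elim(2) by (intro regular_at_sum[THEN conjunct2] regular_at_mult) auto
    also have "\<dots> = (\<Sum>a<m. l a * ev_vec B x $ a)"
      using elim(2) B by (intro sum.cong refl) (simp add: ev_mult ev_vec_def)
    finally show ?case unfolding lin_form_def elim(1)[folded B_def] .
  qed
  have "\<forall>\<^sub>\<infinity>x. ((\<lambda>x. lin_form m l (ev_mat A x *\<^sub>v u)) has_field_derivative
      lin_form m l (ev_mat (map_mat ratfun_deriv A) x *\<^sub>v u)) (at x)"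
    using MOST_mat_deriv[OF A]
  proof eventually_elim
    case (elim x)
    show ?case unfolding lin_form_def
      by (intro DERIV_sum DERIV_cmult mat_deriv_vec[OF elim u]) auto
  qed
  from MOST_ev_deriv_eqI[OF 1 this] 1 show ?thesis by blast
qed

context pinned
begin

lemma MOST_miura_oper:
  "\<forall>\<^sub>\<infinity>x. ev_mat (miura_oper G \<Lambda> g) x = oper_at (\<lambda>j. poly (\<Lambda> j) x) (\<lambda>j. ev (g j) x)"
proof -
  have "\<forall>\<^sub>\<infinity>x. \<forall>j\<in>UNIV. regular_at (g j) x"
    by (intro eventually_ball_finite ballI MOST_regular) auto
  then show ?thesis
  proof eventually_elim
    case (elim x)
    have g: "regular_at (g j) x" for j using elim by blast
    have 1: "regular_at (\<Sum>j\<in>UNIV. to_fract (\<Lambda> j) * ratfun_const (chev_e G j $$ ab)) x \<and>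
      ev (\<Sum>j\<in>UNIV. to_fract (\<Lambda> j) * ratfun_const (chev_e G j $$ ab)) x =
        (\<Sum>j\<in>UNIV. poly (\<Lambda> j) x * chev_e G j $$ ab)" for ab
      using regular_at_sum[of UNIV "\<lambda>j. to_fract (\<Lambda> j) * ratfun_const (chev_e G j $$ ab)" x]
      by (simp add: regular_at_mult ev_mult)
    have 2: "regular_at (\<Sum>j\<in>UNIV. g j * ratfun_const (chev_h G j $$ ab)) x \<and>
      ev (\<Sum>j\<in>UNIV. g j * ratfun_const (chev_h G j $$ ab)) x = (\<Sum>j\<in>UNIV. ev (g j) x * chev_h G j $$ ab)" for ab
      using regular_at_sum[of UNIV "\<lambda>j. g j * ratfun_const (chev_h G j $$ ab)" x] g
      by (simp add: regular_at_mult ev_mult)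
    show ?case
      by (rule eq_matI) (use 1 2 in \<open>auto simp: miura_oper_def oper_at_def ev_add\<close>)
  qed
qed

lemma miura_oper_carrier [simp]: "miura_oper G \<Lambda> g \<in> carrier_mat n n"
  by (simp add: miura_oper_def)

end

section \<open>The Pluecker condition in one fundamental representation as scalar equations\<close>

context fundamental
begin

text \<open>The oper acts on \<nu> by the scalar g_i, because the e_j annihilate \<nu> and its
  weight is \<omega>_i.\<close>

lemma miura_oper_coeff:
  assumes "miura_oper G \<Lambda> g = miura_oper G \<Lambda> g'"
  shows "g i = g' i"
proof (rule ratfun_eqI)
  obtain a where a: "a < m" "\<nu> $ a \<noteq> 0" by (rule hw_entry)
  from MOST_miura_oper[of \<Lambda> g] MOST_miura_oper[of \<Lambda> g'] show "\<forall>\<^sub>\<infinity>x. ev (g i) x = ev (g' i) x"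
  proof eventually_elim
    case (elim x)
    have "ev (g i) x \<cdot>\<^sub>v \<nu> = ev (g' i) x \<cdot>\<^sub>v \<nu>"
      using assms elim oper_at_hw[of "\<lambda>j. poly (\<Lambda> j) x" "\<lambda>j. ev (g j) x"]
        oper_at_hw[of "\<lambda>j. poly (\<Lambda> j) x" "\<lambda>j. ev (g' j) x"] by metis
    from arg_cong[OF this, of "\<lambda>v. v $ a"] show ?case using a by simp
  qed
qed

lemma MOST_ev_gamma:
  "\<forall>\<^sub>\<infinity>x. ev (g i - (\<Sum>j\<in>UNIV. of_int (cartan G j i) * g j)) x =
    ev (g i) x - (\<Sum>j\<in>UNIV. of_int (cartan G j i) * ev (g j) x)"
proof -
  have "\<forall>\<^sub>\<infinity>x. \<forall>j\<in>UNIV. regular_at (g j) x"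
    by (intro eventually_ball_finite ballI MOST_regular) auto
  then show ?thesis
  proof eventually_elim
    case (elim x)
    have "regular_at (\<Sum>j\<in>UNIV. of_int (cartan G j i) * g j) x \<and>
      ev (\<Sum>j\<in>UNIV. of_int (cartan G j i) * g j) x = (\<Sum>j\<in>UNIV. ev (of_int (cartan G j i) * g j) x)"
      using elim by (intro regular_at_sum regular_at_mult) auto
    then show ?case using elim by (simp add: regular_at_diff ev_mult)
  qed
qed

context
  fixes v W :: "ratfun mat"
  assumes v: "v \<in> ratfun_points n (borel_plus G)" and W_def: "W = inv\<^bsub>GL n\<^esub> v"
begin

text \<open>F0 and F1 are the components of the images of \<nu> and f_i \<nu> under W with respect
  to the weight form. As the form is an eigenvector for Z, the equations close up although the
  remaining components are unknown.\<close>

lemma pluecker_necessary: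
  assumes "\<forall>s\<in>W_space G i V. connection_on V (miura_oper G \<Lambda> g) s =
      connection_on V (gauge n v (map_mat ratfun_const (coroot_sum G \<zeta>))) s"
  shows "\<exists>F0 F1. F0 \<noteq> 0 \<and> g i * F0 = ratfun_const (\<zeta> i) * F0 + ratfun_deriv F0 \<and>
    (g i - (\<Sum>j\<in>UNIV. of_int (cartan G j i) * g j)) * F1 + to_fract (\<Lambda> i) * F0
      = ratfun_const (\<zeta> i) * F1 + ratfun_deriv F1"
proof -
  let ?Z = "coroot_sum G \<zeta>" and ?R' = "\<lambda>x. ev_mat (map_mat ratfun_deriv (rep_mat W)) x"
  let ?\<gamma> = "g i - (\<Sum>j\<in>UNIV. of_int (cartan G j i) * g j)"
  note main = assms[unfolded pluecker_iff[OF v W_def miura_oper_carrier]]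
  obtain l where l: "lin_form m l \<nu> = 1"
    "\<And>u. u \<in> carrier_vec m \<Longrightarrow> lin_form m l (dR ?Z *\<^sub>v u) = \<zeta> i * lin_form m l u"
    using ex_weight_form_diff by blast
  obtain F0 where F0: "\<forall>\<^sub>\<infinity>x. ev F0 x = lin_form m l (ev_mat (rep_mat W) x *\<^sub>v \<nu>)"
    "\<forall>\<^sub>\<infinity>x. ev (ratfun_deriv F0) x = lin_form m l (?R' x *\<^sub>v \<nu>)"
    using ex_lin_form_ratfun[OF rep_mat_carrier hw_carrier] by blast
  obtain F1 where F1: "\<forall>\<^sub>\<infinity>x. ev F1 x = lin_form m l (ev_mat (rep_mat W) x *\<^sub>v \<nu>f)"
    "\<forall>\<^sub>\<infinity>x. ev (ratfun_deriv F1) x = lin_form m l (?R' x *\<^sub>v \<nu>f)"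
    using ex_lin_form_ratfun[OF rep_mat_carrier dR_vec_carrier[OF hw_carrier]] by blast
  note rep = MOST_rep_mat[OF vW(2)[OF v W_def]]
  have R'c: "?R' x *\<^sub>v u \<in> carrier_vec m" if "u \<in> carrier_vec m" for x u
    using that by (intro mult_mat_vec_carrier[of _ m m]) auto
  have step: "lin_form m l (R (ev_mat W x) *\<^sub>v p) = \<zeta> i * lin_form m l (R (ev_mat W x) *\<^sub>v u) + lin_form m l (?R' x *\<^sub>v u)"
    if "R (ev_mat W x) *\<^sub>v p = dR ?Z *\<^sub>v (R (ev_mat W x) *\<^sub>v u) + ?R' x *\<^sub>v u" "u \<in> carrier_vec m" for x p u
    unfolding that(1) using that(2) by (simp add: lin_form_add R'c l(2))
  \<comment> \<open>Almost all values of W lie in B_+ and scale \<nu> by an invertible factor, which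
    the form reads off because it is 1 on \<nu>.\<close>
  have F0_nz: "F0 \<noteq> 0"
  proof
    assume "F0 = 0"
    from F0(1) rep MOST_vW[OF v W_def] have "\<forall>\<^sub>\<infinity>x::complex. False"
    proof eventually_elim
      case (elim x)
      obtain c where c: "R (ev_mat W x) *\<^sub>v \<nu> = c \<cdot>\<^sub>v \<nu>" using hw_borel elim(3) by blast
      have "lin_form m l (c \<cdot>\<^sub>v \<nu>) = 0" using elim(1,2) \<open>F0 = 0\<close> c by simp
      then have "c = 0" using l(1) by (simp add: lin_form_smult)
      then have "R (ev_mat W x) *\<^sub>v \<nu> = 0\<^sub>v m" using c by simp
      moreover have "R (ev_mat v x) *\<^sub>v (R (ev_mat W x) *\<^sub>v \<nu>) = \<nu>"
        using elim(3) borel_sub by (intro R_inverse_vec) auto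
      moreover have "R (ev_mat v x) *\<^sub>v 0\<^sub>v m = 0\<^sub>v m"
        by (rule eq_vecI) (auto simp: scalar_prod_def)
      ultimately show ?case using hw_nonzero by simp
    qed
    then show False using MOST_False_complex by blast
  qed
  have eq0: "g i * F0 = ratfun_const (\<zeta> i) * F0 + ratfun_deriv F0"
  proof (rule ratfun_eqI)
    from main rep F0 MOST_miura_oper[of \<Lambda> g] MOST_ev_mult[of "g i" F0] MOST_regular[of F0]
    show "\<forall>\<^sub>\<infinity>x. ev (g i * F0) x = ev (ratfun_const (\<zeta> i) * F0 + ratfun_deriv F0) x"
    proof eventually_elim
      case (elim x)
      have "R (ev_mat W x) *\<^sub>v (ev (g i) x \<cdot>\<^sub>v \<nu>) = dR ?Z *\<^sub>v (R (ev_mat W x) *\<^sub>v \<nu>) + ?R' x *\<^sub>v \<nu>"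
        using elim(1) unfolding elim(5) by (simp add: oper_at_hw)
      from step[OF this hw_carrier] show ?case
        using elim by (simp add: mult_mat_vec[of _ m m] lin_form_smult ev_add ev_mult regular_at_mult regular_at_deriv)
    qed
  qed
  have eq1: "?\<gamma> * F1 + to_fract (\<Lambda> i) * F0 = ratfun_const (\<zeta> i) * F1 + ratfun_deriv F1"
  proof (rule ratfun_eqI)
    from main rep F0(1) F1 MOST_miura_oper[of \<Lambda> g] MOST_ev_gamma[of g] MOST_regular[of ?\<gamma>] MOST_regular[of F0] MOST_regular[of F1]
    show "\<forall>\<^sub>\<infinity>x. ev (?\<gamma> * F1 + to_fract (\<Lambda> i) * F0) x = ev (ratfun_const (\<zeta> i) * F1 + ratfun_deriv F1) x"
    proof eventually_elim
      case (elim x)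
      have "R (ev_mat W x) *\<^sub>v (ev ?\<gamma> x \<cdot>\<^sub>v \<nu>f + poly (\<Lambda> i) x \<cdot>\<^sub>v \<nu>) =
          dR ?Z *\<^sub>v (R (ev_mat W x) *\<^sub>v \<nu>f) + ?R' x *\<^sub>v \<nu>f"
        using elim(1) unfolding elim(6,7) by (simp add: oper_at_\<nu>f)
      from step[OF this dR_vec_carrier[OF hw_carrier]] have
        "ev ?\<gamma> x * lin_form m l (R (ev_mat W x) *\<^sub>v \<nu>f) + poly (\<Lambda> i) x * lin_form m l (R (ev_mat W x) *\<^sub>v \<nu>)
          = \<zeta> i * lin_form m l (R (ev_mat W x) *\<^sub>v \<nu>f) + lin_form m l (?R' x *\<^sub>v \<nu>f)"
        by (simp add: mult_add_distrib_mat_vec[of _ m m] mult_mat_vec[of _ m m] lin_form_add lin_form_smult)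
      then have "ev ?\<gamma> x * ev F1 x + poly (\<Lambda> i) x * ev F0 x = \<zeta> i * ev F1 x + ev (ratfun_deriv F1) x"
        using elim(2,3,4,5) by (simp only:)
      then show ?case
        using elim(8,9,10) by (simp add: ev_add ev_mult regular_at_mult regular_at_deriv)
    qed
  qed
  from F0_nz eq0 eq1 show ?thesis by blast
qed

text \<open>W is assumed to act on W_i by a triangular block with diagonal F0, d and off-diagonal
  entry b. The three equations are the \<nu>-component on \<nu> and the f_i \<nu>- and
  \<nu>-components on f_i \<nu> of the intertwining relation.\<close>

lemma pluecker_sufficient:
  assumes hw: "\<forall>\<^sub>\<infinity>x. R (ev_mat W x) *\<^sub>v \<nu> = ev F0 x \<cdot>\<^sub>v \<nu>"
    and f: "\<forall>\<^sub>\<infinity>x. R (ev_mat W x) *\<^sub>v \<nu>f = ev d x \<cdot>\<^sub>v \<nu>f + ev b x \<cdot>\<^sub>v \<nu>"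
    and eq0: "g i * F0 = ratfun_const (\<zeta> i) * F0 + ratfun_deriv F0"
    and eq1: "(g i - (\<Sum>j\<in>UNIV. of_int (cartan G j i) * g j)) * d =
      ratfun_const (\<zeta> i - (\<Sum>j\<in>UNIV. of_int (cartan G j i) * \<zeta> j)) * d + ratfun_deriv d"
    and eq2: "(g i - (\<Sum>j\<in>UNIV. of_int (cartan G j i) * g j)) * b + to_fract (\<Lambda> i) * F0
      = ratfun_const (\<zeta> i) * b + ratfun_deriv b"
  shows "\<forall>s\<in>W_space G i V. connection_on V (miura_oper G \<Lambda> g) s =
      connection_on V (gauge n v (map_mat ratfun_const (coroot_sum G \<zeta>))) s"
  unfolding pluecker_iff[OF v W_def miura_oper_carrier]
proof -
  let ?Z = "coroot_sum G \<zeta>" and ?R' = "\<lambda>x. ev_mat (map_mat ratfun_deriv (rep_mat W)) x"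
  let ?\<gamma> = "g i - (\<Sum>j\<in>UNIV. of_int (cartan G j i) * g j)"
  let ?z = "\<zeta> i - (\<Sum>j\<in>UNIV. of_int (cartan G j i) * \<zeta> j)"
  note rep = MOST_rep_mat[OF vW(2)[OF v W_def]]
  have wc: "\<nu>f \<in> carrier_vec m" by simp
  have dw [simp]: "dim_vec \<nu>f = m" by simp
  have R'_hw: "\<forall>\<^sub>\<infinity>x. ?R' x *\<^sub>v \<nu> = ev (ratfun_deriv F0) x \<cdot>\<^sub>v \<nu>"
    using MOST_mat_deriv[OF rep_mat_carrier[of W]] MOST_nhds[OF hw] MOST_nhds[OF rep] MOST_ev_deriv[of F0]
  proof eventually_elim
    case (elim x)
    show ?case
    proof (rule mat_deriv_vec_eqI[OF elim(1) hw_carrier, where f = "\<lambda>s. ev F0 s \<cdot>\<^sub>v \<nu>"])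
      show "\<forall>\<^sub>F s in nhds x. ev_mat (rep_mat W) s *\<^sub>v \<nu> = ev F0 s \<cdot>\<^sub>v \<nu>"
        using elim(2,3) by eventually_elim simp
      show "((\<lambda>s. (ev F0 s \<cdot>\<^sub>v \<nu>) $ a) has_field_derivative (ev (ratfun_deriv F0) x \<cdot>\<^sub>v \<nu>) $ a) (at x)"
        if "a < m" for a
        using that DERIV_cmult_right[OF elim(4)] by simp
    qed simp
  qed
  have R'_f: "\<forall>\<^sub>\<infinity>x. ?R' x *\<^sub>v \<nu>f = ev (ratfun_deriv d) x \<cdot>\<^sub>v \<nu>f + ev (ratfun_deriv b) x \<cdot>\<^sub>v \<nu>"
    using MOST_mat_deriv[OF rep_mat_carrier[of W]] MOST_nhds[OF f] MOST_nhds[OF rep] MOST_ev_deriv[of d] MOST_ev_deriv[of b]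
  proof eventually_elim
    case (elim x)
    show ?case
    proof (rule mat_deriv_vec_eqI[OF elim(1) wc, where f = "\<lambda>s. ev d s \<cdot>\<^sub>v \<nu>f + ev b s \<cdot>\<^sub>v \<nu>"])
      show "\<forall>\<^sub>F s in nhds x. ev_mat (rep_mat W) s *\<^sub>v \<nu>f = ev d s \<cdot>\<^sub>v \<nu>f + ev b s \<cdot>\<^sub>v \<nu>"
        using elim(2,3) by eventually_elim simp
      show "((\<lambda>s. (ev d s \<cdot>\<^sub>v \<nu>f + ev b s \<cdot>\<^sub>v \<nu>) $ a) has_field_derivative
          (ev (ratfun_deriv d) x \<cdot>\<^sub>v \<nu>f + ev (ratfun_deriv b) x \<cdot>\<^sub>v \<nu>) $ a) (at x)"
        if "a < m" for a
        using that DERIV_add[OF DERIV_cmult_right[OF elim(4)] DERIV_cmult_right[OF elim(5)]]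
        by (simp del: index_mult_mat_vec)
    qed simp
  qed
  have Z: "dR ?Z *\<^sub>v \<nu> = \<zeta> i \<cdot>\<^sub>v \<nu>" "dR ?Z *\<^sub>v \<nu>f = ?z \<cdot>\<^sub>v \<nu>f"
    using right_zero_vec[of "?z \<cdot>\<^sub>v \<nu>f" m] by (simp_all add: coroot_sum_oper oper_at_hw oper_at_\<nu>f)
  note regs = MOST_regular[of F0] MOST_regular[of d] MOST_regular[of b] MOST_regular[of "g i"] MOST_regular[of ?\<gamma>]
  from hw f R'_hw R'_f MOST_miura_oper[of \<Lambda> g] MOST_ev_gamma[of g] regs
  show "\<forall>\<^sub>\<infinity>x. \<forall>u\<in>{\<nu>, \<nu>f}. R (ev_mat W x) *\<^sub>v (dR (ev_mat (miura_oper G \<Lambda> g) x) *\<^sub>v u) =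
      dR ?Z *\<^sub>v (R (ev_mat W x) *\<^sub>v u) + ?R' x *\<^sub>v u"
  proof eventually_elim
    case (elim x)
    have e0: "ev (g i) x * ev F0 x = \<zeta> i * ev F0 x + ev (ratfun_deriv F0) x"
      using arg_cong[OF eq0, of "\<lambda>F. ev F x"] elim(7-)
      by (simp add: ev_add ev_mult regular_at_mult regular_at_deriv)
    have e1: "ev ?\<gamma> x * ev d x = ?z * ev d x + ev (ratfun_deriv d) x"
      using arg_cong[OF eq1, of "\<lambda>F. ev F x"] elim(7-)
      by (simp add: ev_add ev_mult regular_at_mult regular_at_deriv)
    have e2: "ev ?\<gamma> x * ev b x + poly (\<Lambda> i) x * ev F0 x = \<zeta> i * ev b x + ev (ratfun_deriv b) x"
      using arg_cong[OF eq2, of "\<lambda>F. ev F x"] elim(7-)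
      by (simp add: ev_add ev_mult regular_at_mult regular_at_deriv)
    have "R (ev_mat W x) *\<^sub>v (dR (ev_mat (miura_oper G \<Lambda> g) x) *\<^sub>v \<nu>) = (ev (g i) x * ev F0 x) \<cdot>\<^sub>v \<nu>"
      unfolding elim(5) oper_at_hw
      by (simp add: mult_mat_vec[of _ m m] elim(1) smult_smult_assoc)
    moreover have "dR ?Z *\<^sub>v (R (ev_mat W x) *\<^sub>v \<nu>) + ?R' x *\<^sub>v \<nu> = (\<zeta> i * ev F0 x + ev (ratfun_deriv F0) x) \<cdot>\<^sub>v \<nu>"
      unfolding elim(1,3) by (simp add: mult_mat_vec[of _ m m] Z smult_smult_assoc add_smult_distrib_vec mult.commute)
    moreover have "R (ev_mat W x) *\<^sub>v (dR (ev_mat (miura_oper G \<Lambda> g) x) *\<^sub>v \<nu>f) =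
        (ev ?\<gamma> x * ev d x) \<cdot>\<^sub>v \<nu>f + (ev ?\<gamma> x * ev b x + poly (\<Lambda> i) x * ev F0 x) \<cdot>\<^sub>v \<nu>"
      unfolding elim(5) oper_at_\<nu>f elim(6)[symmetric]
        mult_add_distrib_mat_vec[OF mor_map_carrier smult_carrier_vec[THEN iffD2, OF wc] smult_carrier_vec[THEN iffD2, OF hw_carrier]]
        mult_mat_vec[OF mor_map_carrier wc] mult_mat_vec[OF mor_map_carrier hw_carrier] elim(1,2)
      by (rule eq_vecI) (simp_all add: algebra_simps del: index_mult_mat_vec)
    moreover have "dR ?Z *\<^sub>v (R (ev_mat W x) *\<^sub>v \<nu>f) + ?R' x *\<^sub>v \<nu>f =
        (?z * ev d x + ev (ratfun_deriv d) x) \<cdot>\<^sub>v \<nu>f + (\<zeta> i * ev b x + ev (ratfun_deriv b) x) \<cdot>\<^sub>v \<nu>"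
      unfolding elim(2,4)
        mult_add_distrib_mat_vec[OF mor_diff_carrier smult_carrier_vec[THEN iffD2, OF wc] smult_carrier_vec[THEN iffD2, OF hw_carrier]]
        mult_mat_vec[OF mor_diff_carrier wc] mult_mat_vec[OF mor_diff_carrier hw_carrier] Z
      by (rule eq_vecI) (simp_all add: algebra_simps del: index_mult_mat_vec)
    ultimately show ?case unfolding e0 e1 e2 by simp
  qed
qed

end

end

subsection \<open>Rational curves in the Borel subgroup\<close>

context pinned
begin

lemma ex_rational_coroot:
  assumes "F \<noteq> 0"
  shows "\<exists>W\<in>carrier_mat n n. \<forall>\<^sub>\<infinity>x. ev F x \<noteq> 0 \<and> ev_mat W x = coroot G j (ev F x)"
proof -
  define X where "X = mat 2 2 (\<lambda>(a, b). if a = b then if a = 0 then F else inverse F else 0)"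
  have X: "X \<in> carrier_mat 2 2" by (simp add: X_def)
  have e: "\<forall>\<^sub>\<infinity>x. ev_mat X x = mat2 (ev F x) 0 0 (inverse (ev F x))"
    by (rule MOST_ev_mat_eqI[OF X]) (use MOST_ev_inverse[of F] in \<open>auto simp: X_def less_2_split\<close>)
  have "\<forall>\<^sub>\<infinity>x. det (ev_mat X x) \<noteq> 0"
    using e MOST_nonzero_ev[OF assms] by eventually_elim (simp add: det_mat2)
  from MOST_gl_eval_mat[OF X this, of n "sl2_map G j"] e MOST_nonzero_ev[OF assms]
  have "\<forall>\<^sub>\<infinity>x. ev F x \<noteq> 0 \<and>
      ev_mat (mat n n (\<lambda>(a, b). gl_eval ratfun_const (sl2_map G j a b) X)) x = coroot G j (ev F x)"
    by eventually_elim (simp add: coroot_def)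
  then show ?thesis by (intro bexI) auto
qed

lemma ex_rational_up:
  "\<exists>W\<in>carrier_mat n n. \<forall>\<^sub>\<infinity>x. ev_mat W x = up j (ev F x)"
proof -
  define X where "X = mat 2 2 (\<lambda>(a, b). if a = b then 1 else if a = 0 then F else 0)"
  have X: "X \<in> carrier_mat 2 2" by (simp add: X_def)
  have e: "\<forall>\<^sub>\<infinity>x. ev_mat X x = mat2 1 (ev F x) 0 1"
    by (rule MOST_ev_mat_eqI[OF X]) (auto simp: X_def less_2_split)
  have "\<forall>\<^sub>\<infinity>x. det (ev_mat X x) \<noteq> 0"
    using e by eventually_elim (simp add: det_mat2)
  from MOST_gl_eval_mat[OF X this, of n "sl2_map G j"] e
  have "\<forall>\<^sub>\<infinity>x. ev_mat (mat n n (\<lambda>(a, b). gl_eval ratfun_const (sl2_map G j a b) X)) x = up j (ev F x)"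
    by eventually_elim (simp add: up_def)
  then show ?thesis by (intro bexI) auto
qed

end

locale pinned_reps = pinned G for G :: "('i::finite) pinned_group" +
  fixes V :: "'i \<Rightarrow> hw_rep"
  assumes fundamental: "\<And>i. fundamental_rep G i (V i)"
begin

sublocale fund: fundamental G i "V i" for i
  by unfold_locales (rule fundamental)

abbreviation "Rep i g \<equiv> mor_map (rdim (V i)) (rmap (V i)) g"
abbreviation "hw i \<equiv> hwvec (V i)"
abbreviation "fhw i \<equiv> mor_diff (\<lambda>c. c) (rdim (V i)) (rmap (V i)) (chev_f G i) *\<^sub>v hw i"

text \<open>The factor for j fixes every highest weight vector and shifts only f_j \<nu> in the
  representation of index j. On the spaces W_i the factors therefore act independently, and the
  parameters C can be prescribed freely.\<close>

lemma ex_rational_unipotent: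
  fixes C :: "'i \<Rightarrow> ratfun"
  assumes "finite S"
  shows "\<exists>W\<in>carrier_mat n n. \<forall>\<^sub>\<infinity>x. ev_mat W x \<in> borel_plus G \<and>
    (\<forall>i. Rep i (ev_mat W x) *\<^sub>v hw i = hw i \<and>
      Rep i (ev_mat W x) *\<^sub>v fhw i = fhw i + (if i \<in> S then ev (C i) x else 0) \<cdot>\<^sub>v hw i)"
  using assms
proof (induction S rule: finite_induct)
  case empty
  have "fhw i + 0 \<cdot>\<^sub>v hw i = fhw i" for i
    using right_zero_vec[OF fund.dR_vec_carrier[OF fund.hw_carrier]] by simp
  then show ?case
    using borel.one_in by (intro bexI[of _ "1\<^sub>m n"]) (simp_all add: ev_mat_one fund.act.rho_one)
next
  case (insert j S)
  then obtain W where W: "W \<in> carrier_mat n n" "\<forall>\<^sub>\<infinity>x. ev_mat W x \<in> borel_plus G \<and>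
    (\<forall>i. Rep i (ev_mat W x) *\<^sub>v hw i = hw i \<and>
      Rep i (ev_mat W x) *\<^sub>v fhw i = fhw i + (if i \<in> S then ev (C i) x else 0) \<cdot>\<^sub>v hw i)" by blast
  obtain U where U: "U \<in> carrier_mat n n" "\<forall>\<^sub>\<infinity>x. ev_mat U x = up j (ev (C j) x)"
    using ex_rational_up by blast
  from W(2) U(2) MOST_ev_mat_mult[OF U(1) W(1)]
  have "\<forall>\<^sub>\<infinity>x. ev_mat (U * W) x \<in> borel_plus G \<and>
    (\<forall>i. Rep i (ev_mat (U * W) x) *\<^sub>v hw i = hw i \<and>
      Rep i (ev_mat (U * W) x) *\<^sub>v fhw i = fhw i + (if i \<in> insert j S then ev (C i) x else 0) \<cdot>\<^sub>v hw i)"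
  proof eventually_elim
    case (elim x)
    have in_grp: "ev_mat W x \<in> grp G" using elim(1) borel_sub by auto
    have "Rep i (ev_mat (U * W) x) *\<^sub>v hw i = hw i" for i
      unfolding elim(2,3) fund.R_mult_vec[OF up_in(2) in_grp fund.hw_carrier]
      using elim(1) by (simp add: fund.up_hw)
    moreover have "Rep i (ev_mat (U * W) x) *\<^sub>v fhw i =
        fhw i + (if i \<in> insert j S then ev (C i) x else 0) \<cdot>\<^sub>v hw i" for i
    proof -
      have c: "fhw i \<in> carrier_vec (rdim (V i))" by simp
      have "Rep i (ev_mat (U * W) x) *\<^sub>v fhw i =
          Rep i (up j (ev (C j) x)) *\<^sub>v (fhw i + (if i \<in> S then ev (C i) x else 0) \<cdot>\<^sub>v hw i)"
        unfolding elim(2,3) fund.R_mult_vec[OF up_in(2) in_grp c] using elim(1) by simp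
      also have "\<dots> = fhw i + (if j = i then ev (C j) x else 0) \<cdot>\<^sub>v hw i + (if i \<in> S then ev (C i) x else 0) \<cdot>\<^sub>v hw i"
        unfolding mult_add_distrib_mat_vec[OF mor_map_carrier c smult_carrier_vec[THEN iffD2, OF fund.hw_carrier]]
          mult_mat_vec[OF mor_map_carrier fund.hw_carrier] fund.up_hw fund.up_\<nu>f ..
      also have "\<dots> = fhw i + (if i \<in> insert j S then ev (C i) x else 0) \<cdot>\<^sub>v hw i"
        using insert.hyps by (intro eq_vecI) (auto simp del: index_mult_mat_vec)
      finally show ?thesis .
    qed
    moreover have "ev_mat (U * W) x \<in> borel_plus G"
      unfolding elim(2,3) using elim(1) by (intro borel.mult_in up_in) auto
    ultimately show ?case by blast
  qed
  then show ?case using U W by (intro bexI[of _ "U * W"]) auto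
qed

lemma ex_rational_toral:
  fixes E :: "'i \<Rightarrow> ratfun"
  assumes "finite S" "\<And>j. E j \<noteq> 0"
  shows "\<exists>W\<in>carrier_mat n n. \<forall>\<^sub>\<infinity>x. ev_mat W x \<in> borel_plus G \<and>
    (\<forall>i. Rep i (ev_mat W x) *\<^sub>v hw i = (if i \<in> S then ev (E i) x else 1) \<cdot>\<^sub>v hw i \<and>
      Rep i (ev_mat W x) *\<^sub>v fhw i =
        (\<Prod>j\<in>S. ev (E j) x powi ((if j = i then 1 else 0) - cartan G j i)) \<cdot>\<^sub>v fhw i)"
  using assms(1)
proof (induction S rule: finite_induct)
  case empty
  show ?case
    using borel.one_in by (intro bexI[of _ "1\<^sub>m n"]) (simp_all add: ev_mat_one fund.act.rho_one)
next
  case (insert j S)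
  then obtain W where W: "W \<in> carrier_mat n n" "\<forall>\<^sub>\<infinity>x. ev_mat W x \<in> borel_plus G \<and>
    (\<forall>i. Rep i (ev_mat W x) *\<^sub>v hw i = (if i \<in> S then ev (E i) x else 1) \<cdot>\<^sub>v hw i \<and>
      Rep i (ev_mat W x) *\<^sub>v fhw i =
        (\<Prod>j\<in>S. ev (E j) x powi ((if j = i then 1 else 0) - cartan G j i)) \<cdot>\<^sub>v fhw i)" by blast
  obtain U where U: "U \<in> carrier_mat n n" "\<forall>\<^sub>\<infinity>x. ev (E j) x \<noteq> 0 \<and> ev_mat U x = coroot G j (ev (E j) x)"
    using ex_rational_coroot[OF assms(2)] by blast
  from W(2) U(2) MOST_ev_mat_mult[OF U(1) W(1)]
  have "\<forall>\<^sub>\<infinity>x. ev_mat (U * W) x \<in> borel_plus G \<and>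
    (\<forall>i. Rep i (ev_mat (U * W) x) *\<^sub>v hw i = (if i \<in> insert j S then ev (E i) x else 1) \<cdot>\<^sub>v hw i \<and>
      Rep i (ev_mat (U * W) x) *\<^sub>v fhw i =
        (\<Prod>j\<in>insert j S. ev (E j) x powi ((if j = i then 1 else 0) - cartan G j i)) \<cdot>\<^sub>v fhw i)"
  proof eventually_elim
    case (elim x)
    have in_grp: "ev_mat W x \<in> grp G" using elim(1) borel_sub by auto
    have t: "ev (E j) x \<noteq> 0" and U: "ev_mat U x = coroot G j (ev (E j) x)" using elim(2) by auto
    have "Rep i (ev_mat (U * W) x) *\<^sub>v hw i = (if i \<in> insert j S then ev (E i) x else 1) \<cdot>\<^sub>v hw i" for i
    proof -
      have "Rep i (ev_mat (U * W) x) *\<^sub>v hw i =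
          Rep i (coroot G j (ev (E j) x)) *\<^sub>v ((if i \<in> S then ev (E i) x else 1) \<cdot>\<^sub>v hw i)"
        unfolding U elim(3) fund.R_mult_vec[OF coroot_in_grp(1)[OF t] in_grp fund.hw_carrier]
        using elim(1) by simp
      also have "\<dots> = (if i \<in> S then ev (E i) x else 1) \<cdot>\<^sub>v ((if j = i then ev (E j) x else 1) \<cdot>\<^sub>v hw i)"
        unfolding mult_mat_vec[OF mor_map_carrier fund.hw_carrier] fund.coroot_hw[OF t] ..
      also have "\<dots> = (if i \<in> insert j S then ev (E i) x else 1) \<cdot>\<^sub>v hw i"
        using insert.hyps by auto
      finally show ?thesis .
    qed
    moreover have "Rep i (ev_mat (U * W) x) *\<^sub>v fhw i =
        (\<Prod>j\<in>insert j S. ev (E j) x powi ((if j = i then 1 else 0) - cartan G j i)) \<cdot>\<^sub>v fhw i" for i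
    proof -
      have c: "fhw i \<in> carrier_vec (rdim (V i))" by simp
      have "Rep i (ev_mat (U * W) x) *\<^sub>v fhw i = Rep i (coroot G j (ev (E j) x)) *\<^sub>v
          ((\<Prod>j\<in>S. ev (E j) x powi ((if j = i then 1 else 0) - cartan G j i)) \<cdot>\<^sub>v fhw i)"
        unfolding U elim(3) fund.R_mult_vec[OF coroot_in_grp(1)[OF t] in_grp c]
        using elim(1) by simp
      also have "\<dots> = (\<Prod>j\<in>S. ev (E j) x powi ((if j = i then 1 else 0) - cartan G j i)) \<cdot>\<^sub>v
          ((ev (E j) x powi ((if j = i then 1 else 0) - cartan G j i)) \<cdot>\<^sub>v fhw i)"
        unfolding mult_mat_vec[OF mor_map_carrier c] fund.coroot_\<nu>f[OF t] ..
      finally show ?thesis using insert.hyps by (simp add: smult_smult_assoc mult.commute)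
    qed
    moreover have "ev_mat (U * W) x \<in> borel_plus G"
      unfolding U elim(3) using elim(1) t by (intro borel.mult_in coroot_in_grp) auto
    ultimately show ?case by blast
  qed
  then show ?case using U W by (intro bexI[of _ "U * W"]) auto
qed

subsection \<open>The correspondence\<close>

context
  fixes \<zeta> :: "'i \<Rightarrow> complex" and \<Lambda> y :: "'i \<Rightarrow> complex poly" and g :: "'i \<Rightarrow> ratfun"
  assumes y: "\<And>i. y i \<noteq> 0"
    and g: "\<And>i. g i = ratfun_const (\<zeta> i) - log_deriv (to_fract (y i))"
begin

definition \<kappa> :: "'i \<Rightarrow> complex" where
  "\<kappa> i = (\<Sum>j\<in>UNIV. \<zeta> j * of_int (cartan G j i))"

definition P :: "'i \<Rightarrow> ratfun" where
  "P i = (\<Prod>j\<in>UNIV. to_fract (y j) powi cartan G j i)"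

text \<open>The factor by which the product of the coroots at 1 / y_j scales f_i \<nu>, of weight
  \<omega>_i - \<alpha>_i.\<close>

definition d :: "'i \<Rightarrow> ratfun" where
  "d i = P i / to_fract (y i)"

definition M :: "'i \<Rightarrow> ratfun" where
  "M i = to_fract (\<Lambda> i) * (\<Prod>j\<in>UNIV. to_fract (y j) powi (- cartan G j i))"

lemma y_nonzero [simp]: "y j \<noteq> 0"
  by (rule y)

lemma to_fract_y_nonzero: "to_fract (y j) \<noteq> 0"
  by simp

lemma P_nonzero [simp]: "P i \<noteq> 0"
  by (simp add: P_def)

lemma d_nonzero [simp]: "d i \<noteq> 0"
  by (simp add: d_def)

lemma M_eq: "M i = to_fract (\<Lambda> i) / P i"
  by (simp add: M_def P_def power_int_minus prod_inversef[symmetric] divide_inverse)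

lemma log_deriv_d: "log_deriv (d i) =
    (\<Sum>j\<in>UNIV. of_int (cartan G j i) * log_deriv (to_fract (y j))) - log_deriv (to_fract (y i))"
proof -
  have "log_deriv (P i) = (\<Sum>j\<in>UNIV. of_int (cartan G j i) * log_deriv (to_fract (y j)))"
    unfolding P_def by (subst log_deriv_prod) (simp_all add: log_deriv_powi)
  then show ?thesis
    by (simp add: d_def divide_inverse log_deriv_mult log_deriv_inverse)
qed

text \<open>The left-hand side is the coefficient of the oper on f_i \<nu>. It splits into the
  weight \<zeta>_i - \<kappa>_i of Z and a logarithmic derivative, which d_i absorbs.\<close>

lemma gamma_eq: "g i - (\<Sum>j\<in>UNIV. of_int (cartan G j i) * g j) =
    ratfun_const (\<zeta> i) - ratfun_const (\<kappa> i) + log_deriv (d i)"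
proof -
  have "(\<Sum>j\<in>UNIV. of_int (cartan G j i) * g j) =
      ratfun_const (\<kappa> i) - (\<Sum>j\<in>UNIV. of_int (cartan G j i) * log_deriv (to_fract (y j)))"
    by (simp add: g \<kappa>_def ratfun_const_sum ratfun_const_mult ratfun_const_of_int right_diff_distrib
        sum_subtractf mult.commute)
  then show ?thesis by (simp add: log_deriv_d g)
qed

lemma deriv_d_mult: "ratfun_deriv (d i * T) = d i * (log_deriv (d i) * T + ratfun_deriv T)"
  by (simp add: ratfun_deriv_mult ratfun_deriv_log[of "d i"] algebra_simps)

lemma miura_pluecker_imp_ode:
  assumes "miura_pluecker G V (coroot_sum G \<zeta>) \<Lambda> (miura_oper G \<Lambda> g)"
  shows "\<exists>T c. c \<noteq> 0 \<and> ratfun_deriv T + ratfun_const (\<kappa> i) * T = ratfun_const c * M i"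
proof -
  from assms obtain v where v: "v \<in> ratfun_points n (borel_plus G)"
    "\<forall>s\<in>W_space G i (V i). connection_on (V i) (miura_oper G \<Lambda> g) s =
      connection_on (V i) (gauge n v (map_mat ratfun_const (coroot_sum G \<zeta>))) s"
    unfolding miura_pluecker_def by blast
  from fund.pluecker_necessary[OF v(1) refl v(2)] obtain F0 F1 where F: "F0 \<noteq> 0"
    "g i * F0 = ratfun_const (\<zeta> i) * F0 + ratfun_deriv F0"
    "(g i - (\<Sum>j\<in>UNIV. of_int (cartan G j i) * g j)) * F1 + to_fract (\<Lambda> i) * F0
      = ratfun_const (\<zeta> i) * F1 + ratfun_deriv F1" by blast
  \<comment> \<open>The first scalar equation says that F0 and 1 / y_i have the same logarithmic
    derivative, so F0 y_i is a constant c, nonzero because F0 is.\<close>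
  have DF0: "ratfun_deriv F0 = - log_deriv (to_fract (y i)) * F0"
    using F(2) by (simp add: g algebra_simps eq_neg_iff_add_eq_0)
  have "ratfun_deriv (F0 * to_fract (y i)) =
      ratfun_deriv F0 * to_fract (y i) + log_deriv (to_fract (y i)) * to_fract (y i) * F0"
    unfolding ratfun_deriv_mult using ratfun_deriv_log[OF to_fract_y_nonzero, of i] by simp
  then have "ratfun_deriv (F0 * to_fract (y i)) = 0"
    unfolding DF0 by simp
  then obtain c where c: "F0 * to_fract (y i) = ratfun_const c" using ratfun_deriv_eq_0 by blast
  have "c \<noteq> 0" using c F(1) to_fract_y_nonzero[of i] by (metis mult_eq_0_iff ratfun_const_eq_0)
  \<comment> \<open>Variation of constants: d_i cancels the logarithmic derivative, and F0 / d_i = c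
    / P_i leaves the stated right-hand side.\<close>
  define T where "T = F1 / d i"
  have F1: "F1 = d i * T" by (simp add: T_def)
  have "d i * (ratfun_deriv T + ratfun_const (\<kappa> i) * T) = to_fract (\<Lambda> i) * F0"
    using F(3) unfolding gamma_eq F1 deriv_d_mult by (simp add: algebra_simps)
  moreover have "to_fract (\<Lambda> i) * F0 = d i * (ratfun_const c * M i)"
    using c[symmetric] by (simp add: M_eq d_def)
  ultimately have "d i * (ratfun_deriv T + ratfun_const (\<kappa> i) * T) = d i * (ratfun_const c * M i)"
    by simp
  then have "ratfun_deriv T + ratfun_const (\<kappa> i) * T = ratfun_const c * M i"
    by simp
  with \<open>c \<noteq> 0\<close> show ?thesis by blast
qed

lemma ode_imp_miura_pluecker:
  assumes "\<And>i. \<exists>T. ratfun_deriv T + ratfun_const (\<kappa> i) * T = M i"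
  shows "miura_pluecker G V (coroot_sum G \<zeta>) \<Lambda> (miura_oper G \<Lambda> g)"
proof -
  obtain T where T: "\<And>i. ratfun_deriv (T i) + ratfun_const (\<kappa> i) * T i = M i"
    using assms by metis
  \<comment> \<open>E_i and d_i are the diagonal entries of the block for W, and b_i = d_i T_i is
    the off-diagonal entry that the equation for T requires. In the product D * U the torus part
    scales \<nu> by E_i, so the unipotent parameter must be C_i = b_i / E_i.\<close>
  define E where "E i = inverse (to_fract (y i))" for i
  define b where "b i = d i * T i" for i
  define C where "C i = to_fract (y i) * b i" for i
  have E: "E i \<noteq> 0" for i by (simp add: E_def)
  have d_E: "d i = (\<Prod>j\<in>UNIV. E j powi ((if j = i then 1 else 0) - cartan G j i))" for i
  proof -
    have "(\<Prod>j\<in>UNIV. E j powi ((if j = i then 1 else 0) - cartan G j i)) =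
        (\<Prod>j\<in>UNIV. (if j = i then E j else 1) * to_fract (y j) powi cartan G j i)"
      using E by (intro prod.cong refl) (auto simp: power_int_diff E_def power_int_inverse divide_inverse)
    then show ?thesis by (simp add: prod.distrib d_def P_def E_def divide_inverse mult.commute)
  qed
  obtain U where U: "U \<in> carrier_mat n n" "\<forall>\<^sub>\<infinity>x. ev_mat U x \<in> borel_plus G \<and>
    (\<forall>i. Rep i (ev_mat U x) *\<^sub>v hw i = hw i \<and>
      Rep i (ev_mat U x) *\<^sub>v fhw i = fhw i + (if i \<in> UNIV then ev (C i) x else 0) \<cdot>\<^sub>v hw i)"
    using ex_rational_unipotent[of UNIV C] by auto
  obtain D where D: "D \<in> carrier_mat n n" "\<forall>\<^sub>\<infinity>x. ev_mat D x \<in> borel_plus G \<and>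
    (\<forall>i. Rep i (ev_mat D x) *\<^sub>v hw i = (if i \<in> UNIV then ev (E i) x else 1) \<cdot>\<^sub>v hw i \<and>
      Rep i (ev_mat D x) *\<^sub>v fhw i =
        (\<Prod>j\<in>UNIV. ev (E j) x powi ((if j = i then 1 else 0) - cartan G j i)) \<cdot>\<^sub>v fhw i)"
    using ex_rational_toral[of UNIV E] E by auto
  define W where "W = D * U"
  have W: "W \<in> carrier_mat n n" unfolding W_def using D U by auto
  have EC: "E i * C i = b i" for i by (simp add: E_def C_def)
  have ev_d: "\<forall>\<^sub>\<infinity>x. ev (d i) x = (\<Prod>j\<in>UNIV. ev (E j) x powi ((if j = i then 1 else 0) - cartan G j i))" for i
  proof -
    have "\<forall>\<^sub>\<infinity>x. \<forall>j\<in>UNIV. ev (E j powi ((if j = i then 1 else 0) - cartan G j i)) x =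
        ev (E j) x powi ((if j = i then 1 else 0) - cartan G j i)"
      by (intro eventually_ball_finite ballI MOST_ev_powi E) auto
    with MOST_ev_prod[of "\<lambda>j. E j powi ((if j = i then 1 else 0) - cartan G j i)" UNIV] show ?thesis
      unfolding d_E by eventually_elim simp
  qed
  have W_act: "\<forall>\<^sub>\<infinity>x. ev_mat W x \<in> borel_plus G \<and> (\<forall>i. Rep i (ev_mat W x) *\<^sub>v hw i = ev (E i) x \<cdot>\<^sub>v hw i \<and>
      Rep i (ev_mat W x) *\<^sub>v fhw i = ev (d i) x \<cdot>\<^sub>v fhw i + ev (b i) x \<cdot>\<^sub>v hw i)"
  proof -
    have 1: "\<forall>\<^sub>\<infinity>x. \<forall>i\<in>UNIV. ev (d i) x = (\<Prod>j\<in>UNIV. ev (E j) x powi ((if j = i then 1 else 0) - cartan G j i))"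
      by (intro eventually_ball_finite ballI ev_d) auto
    have 2: "\<forall>\<^sub>\<infinity>x. \<forall>i\<in>UNIV. ev (b i) x = ev (E i) x * ev (C i) x"
      unfolding EC[symmetric] by (intro eventually_ball_finite ballI MOST_ev_mult) auto
    from U(2) D(2) MOST_ev_mat_mult[OF D(1) U(1)] 1 2 show ?thesis
    proof eventually_elim
      case (elim x)
      have in_grp: "ev_mat U x \<in> grp G" "ev_mat D x \<in> grp G" using elim(1,2) borel_sub by auto
      have "ev_mat W x \<in> borel_plus G" unfolding W_def elim(3) using elim(1,2) borel.mult_in by blast
      moreover have "Rep i (ev_mat W x) *\<^sub>v hw i = ev (E i) x \<cdot>\<^sub>v hw i" for i
        unfolding W_def elim(3) fund.R_mult_vec[OF in_grp(2,1) fund.hw_carrier] using elim(1,2) by simp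
      moreover have "Rep i (ev_mat W x) *\<^sub>v fhw i = ev (d i) x \<cdot>\<^sub>v fhw i + ev (b i) x \<cdot>\<^sub>v hw i" for i
      proof -
        have c: "fhw i \<in> carrier_vec (rdim (V i))" by simp
        have "Rep i (ev_mat W x) *\<^sub>v fhw i = Rep i (ev_mat D x) *\<^sub>v (fhw i + ev (C i) x \<cdot>\<^sub>v hw i)"
          unfolding W_def elim(3) fund.R_mult_vec[OF in_grp(2,1) c] using elim(1) by simp
        also have "\<dots> = Rep i (ev_mat D x) *\<^sub>v fhw i + ev (C i) x \<cdot>\<^sub>v (Rep i (ev_mat D x) *\<^sub>v hw i)"
          unfolding mult_add_distrib_mat_vec[OF mor_map_carrier c smult_carrier_vec[THEN iffD2, OF fund.hw_carrier]]
            mult_mat_vec[OF mor_map_carrier fund.hw_carrier] ..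
        also have "\<dots> = ev (d i) x \<cdot>\<^sub>v fhw i + ev (C i) x \<cdot>\<^sub>v (ev (E i) x \<cdot>\<^sub>v hw i)"
          using elim(2,4) by simp
        finally show ?thesis using elim(5) by (simp add: smult_smult_assoc mult.commute)
      qed
      ultimately show ?case by blast
    qed
  qed
  then have W_borel: "\<forall>\<^sub>\<infinity>x. ev_mat W x \<in> borel_plus G" by (rule eventually_mono) blast
  have closed: "zariski_closed n (borel_plus G)" using alg_groups(2) by (simp add: alg_group_def)
  have W_GL: "W \<in> carrier (GL n)"
    using W_borel ratfun_points_iff[OF closed W] by (simp add: ratfun_points_def)
  define v where "v = inv\<^bsub>GL n\<^esub> W"
  have v: "v \<in> carrier_mat n n" using GL_inv(2)[OF W_GL] by (simp add: v_def)
  have "\<forall>\<^sub>\<infinity>x. ev_mat v x \<in> borel_plus G"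
    using W_borel MOST_ev_mat_GL[OF W_GL] unfolding v_def
    by eventually_elim (metis borel.inv_in)
  then have v_pt: "v \<in> ratfun_points n (borel_plus G)" using ratfun_points_iff[OF closed v] by simp
  have Wv: "W = inv\<^bsub>GL n\<^esub> v"
    unfolding v_def using group.inv_inv[OF group_GL W_GL] by simp
  have "\<forall>s\<in>W_space G i (V i). connection_on (V i) (miura_oper G \<Lambda> g) s =
      connection_on (V i) (gauge n v (map_mat ratfun_const (coroot_sum G \<zeta>))) s" for i
  proof (rule fund.pluecker_sufficient[OF v_pt Wv])
    show "\<forall>\<^sub>\<infinity>x. Rep i (ev_mat W x) *\<^sub>v hw i = ev (E i) x \<cdot>\<^sub>v hw i"
      using W_act by (rule eventually_mono) blast
    show "\<forall>\<^sub>\<infinity>x. Rep i (ev_mat W x) *\<^sub>v fhw i = ev (d i) x \<cdot>\<^sub>v fhw i + ev (b i) x \<cdot>\<^sub>v hw i"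
      using W_act by (rule eventually_mono) blast
    have "ratfun_deriv (E i) = - log_deriv (to_fract (y i)) * E i"
      using ratfun_deriv_log[OF E, of i] log_deriv_inverse[OF to_fract_y_nonzero, of i] by (simp add: E_def)
    then show "g i * E i = ratfun_const (\<zeta> i) * E i + ratfun_deriv (E i)"
      by (simp add: g algebra_simps)
    have k: "(\<Sum>j\<in>UNIV. of_int (cartan G j i) * \<zeta> j) = \<kappa> i"
      by (simp add: \<kappa>_def mult.commute)
    show "(g i - (\<Sum>j\<in>UNIV. of_int (cartan G j i) * g j)) * d i =
        ratfun_const (\<zeta> i - (\<Sum>j\<in>UNIV. of_int (cartan G j i) * \<zeta> j)) * d i + ratfun_deriv (d i)"
      unfolding gamma_eq k ratfun_const_diff using ratfun_deriv_log[OF d_nonzero, of i]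
      by (simp add: algebra_simps)
    have Db: "ratfun_deriv (b i) = d i * (log_deriv (d i) * T i + (M i - ratfun_const (\<kappa> i) * T i))"
      unfolding b_def deriv_d_mult T[of i, symmetric] by simp
    have "d i * M i = to_fract (\<Lambda> i) * E i"
      by (simp add: M_eq d_def E_def divide_inverse)
    then show "(g i - (\<Sum>j\<in>UNIV. of_int (cartan G j i) * g j)) * b i + to_fract (\<Lambda> i) * E i
        = ratfun_const (\<zeta> i) * b i + ratfun_deriv (b i)"
      unfolding gamma_eq Db by (simp add: b_def algebra_simps)
  qed
  with v_pt show ?thesis unfolding miura_pluecker_def by blast
qed

lemma miura_pluecker_iff_bethe:
  assumes \<Lambda>: "\<And>i. \<Lambda> i \<noteq> 0" and simple: "\<And>i. rsquarefree (y i)"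
    and no_\<Lambda>: "\<And>i x. poly (y i) x = 0 \<Longrightarrow> poly (\<Lambda> i) x \<noteq> 0"
    and no_y: "\<And>i j x. i \<noteq> j \<Longrightarrow> cartan G j i \<noteq> 0 \<Longrightarrow> poly (y i) x = 0 \<Longrightarrow> poly (y j) x \<noteq> 0"
  shows "miura_pluecker G V (coroot_sum G \<zeta>) \<Lambda> (miura_oper G \<Lambda> g) \<longleftrightarrow>
    (\<forall>i x. poly (y i) x = 0 \<longrightarrow> root_pairing G i (coroot_sum G \<zeta>) +
      ev (log_deriv (M i * to_fract [:- x, 1:] ^ 2)) x = 0)"
proof -
  have data: "bethe_data (\<lambda>j. cartan G j i) i y (\<Lambda> i)" for i
  proof
    show "poly (y j) x \<noteq> 0" if "poly (y i) x = 0" "j \<noteq> i" "cartan G j i \<noteq> 0" for j x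
      by (rule no_y[OF that(2)[symmetric] that(3,1)])
  qed (use cartan_diag cartan_nonpos \<Lambda> simple no_\<Lambda> in auto)
  have M: "bethe_data.M (\<lambda>j. cartan G j i) y (\<Lambda> i) = M i" for i
    by (simp add: bethe_data.M_def[OF data] M_def)
  have k: "root_pairing G i (coroot_sum G \<zeta>) = \<kappa> i" for i
    by (simp add: root_pairing_coroot_sum \<kappa>_def)
  show ?thesis
  proof
    assume L: "miura_pluecker G V (coroot_sum G \<zeta>) \<Lambda> (miura_oper G \<Lambda> g)"
    show "\<forall>i x. poly (y i) x = 0 \<longrightarrow> root_pairing G i (coroot_sum G \<zeta>) +
      ev (log_deriv (M i * to_fract [:- x, 1:] ^ 2)) x = 0"
    proof (intro allI impI)
      fix i x assume x: "poly (y i) x = 0"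
      obtain T c where "c \<noteq> 0" "ratfun_deriv T + ratfun_const (\<kappa> i) * T = ratfun_const c * M i"
        using miura_pluecker_imp_ode[OF L] by blast
      then show "root_pairing G i (coroot_sum G \<zeta>) + ev (log_deriv (M i * to_fract [:- x, 1:] ^ 2)) x = 0"
        using bethe_data.bethe_necessary[OF data x, of T "\<kappa> i" c] by (simp add: M k)
    qed
  next
    assume B: "\<forall>i x. poly (y i) x = 0 \<longrightarrow> root_pairing G i (coroot_sum G \<zeta>) +
      ev (log_deriv (M i * to_fract [:- x, 1:] ^ 2)) x = 0"
    show "miura_pluecker G V (coroot_sum G \<zeta>) \<Lambda> (miura_oper G \<Lambda> g)"
    proof (rule ode_imp_miura_pluecker)
      fix i
      show "\<exists>T. ratfun_deriv T + ratfun_const (\<kappa> i) * T = M i"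
        using bethe_data.bethe_sufficient[OF data, of i "\<kappa> i"] B by (simp add: M k)
    qed
  qed
qed

end

end

section \<open>Monic polynomials as multisets of roots\<close>

lemma root_poly_empty [simp]: "root_poly {#} = 1"
  and root_poly_add [simp]: "root_poly (add_mset x w) = [:- x, 1:] * root_poly w"
  by (simp_all add: root_poly_def)

lemma root_poly_monic: "lead_coeff (root_poly w) = 1"
  by (induction w) (simp_all add: lead_coeff_mult del: mult_pCons_left)

lemma root_poly_nonzero [simp]: "root_poly w \<noteq> 0"
  using root_poly_monic[of w] by auto

lemma proots_root_poly: "proots (root_poly w) = w"
  by (induction w) (simp_all add: proots_mult del: mult_pCons_left)

lemma root_poly_eq_0_iff: "poly (root_poly w) x = 0 \<longleftrightarrow> x \<in># w"
  by (induction w) auto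

lemma ex_root_poly:
  assumes "lead_coeff p = 1"
  obtains w where "root_poly w = p"
proof -
  have "p \<noteq> 0" using assms by auto
  then obtain w where "p = Polynomial.smult (lead_coeff p) (root_poly w)"
    using alg_closed_imp_factorization[of p] unfolding root_poly_def by blast
  then show ?thesis using that assms by simp
qed

lemma rsquarefree_root_poly: "rsquarefree (root_poly w) \<longleftrightarrow> (\<forall>x\<in>#w. x \<notin># w - {#x#})"
proof -
  have "order x (root_poly w) = count w x" for x
    using count_proots[of "root_poly w" x] by (simp add: proots_root_poly)
  moreover have "count w x = 0 \<or> count w x = 1 \<longleftrightarrow> (x \<in># w \<longrightarrow> x \<notin># w - {#x#})" for x
    by (auto simp: in_diff_count not_less count_eq_zero_iff[symmetric])
  ultimately show ?thesis by (auto simp: rsquarefree_def)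
qed

theorem theorem5p15:
  fixes G :: "('i::finite) pinned_group"
    and V :: "'i \<Rightarrow> hw_rep"
    and Z :: "complex mat"
    and \<zeta> :: "'i \<Rightarrow> complex"
    and \<Lambda> :: "'i \<Rightarrow> complex poly"
  assumes "pinned_simple_group G"
    and "\<And>i. fundamental_rep G i (V i)"
    and "Z \<in> lie_algebra (gsize G) (torus G)"
    and "Z = coroot_sum G \<zeta>"
    and "\<And>i. lead_coeff (\<Lambda> i) = 1"
  shows "\<exists>\<Phi> :: ratfun mat \<Rightarrow> 'i \<Rightarrow> complex multiset.
    bij_betw \<Phi> {A. miura_pluecker G V Z \<Lambda> A \<and> nondegenerate G \<zeta> \<Lambda> A}
      {w. bethe_solution G Z \<Lambda> w} \<and>
    (\<forall>A. miura_pluecker G V Z \<Lambda> A \<and> nondegenerate G \<zeta> \<Lambda> A \<longrightarrow>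
      A = miura_oper G \<Lambda>
            (\<lambda>i. ratfun_const (\<zeta> i) - log_deriv (to_fract (root_poly (\<Phi> A i)))))"
proof -
  interpret pinned_reps G V
    by unfold_locales (use assms in auto)
  define gw where "gw w i = ratfun_const (\<zeta> i) - log_deriv (to_fract (root_poly (w i)))"
    for w :: "'i \<Rightarrow> complex multiset" and i
  \<comment> \<open>The explicit map goes from root multisets to opers; the bijection of the theorem
    is its inverse, restricted to Bethe solutions.\<close>
  define \<Psi> where "\<Psi> w = miura_oper G \<Lambda> (gw w)" for w
  let ?X = "{A. miura_pluecker G V Z \<Lambda> A \<and> nondegenerate G \<zeta> \<Lambda> A}"
  let ?B = "{w. bethe_solution G Z \<Lambda> w}"
  define good where "good w \<longleftrightarrow> (\<forall>i. rsquarefree (root_poly (w i))) \<and>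
      (\<forall>i x. \<not> (poly (root_poly (w i)) x = 0 \<and> poly (\<Lambda> i) x = 0)) \<and>
      (\<forall>i j x. i \<noteq> j \<and> cartan G i j \<noteq> 0 \<longrightarrow>
        \<not> (poly (root_poly (w i)) x = 0 \<and> poly (root_poly (w j)) x = 0))" for w
  have \<Psi>_inj: "w = w'" if "\<Psi> w = \<Psi> w'" for w w'
  proof
    fix i
    have "gw w i = gw w' i" using fund.miura_oper_coeff that unfolding \<Psi>_def by blast
    then have "root_poly (w i) = root_poly (w' i)"
      unfolding gw_def by (intro log_deriv_monic_inject root_poly_monic) simp
    then show "w i = w' i" by (metis proots_root_poly)
  qed
  have nondeg: "nondegenerate G \<zeta> \<Lambda> A \<longleftrightarrow> (\<exists>w. A = \<Psi> w \<and> good w)" for A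
  proof
    assume "nondegenerate G \<zeta> \<Lambda> A"
    then obtain g y where gy: "A = miura_oper G \<Lambda> g"
      "\<forall>i. g i = ratfun_const (\<zeta> i) - log_deriv (to_fract (y i))"
      "\<forall>i. lead_coeff (y i) = 1" "\<forall>i. rsquarefree (y i)"
      "\<forall>i x. \<not> (poly (y i) x = 0 \<and> poly (\<Lambda> i) x = 0)"
      "\<forall>i j x. i \<noteq> j \<and> cartan G i j \<noteq> 0 \<longrightarrow> \<not> (poly (y i) x = 0 \<and> poly (y j) x = 0)"
      unfolding nondegenerate_def by (elim exE conjE) (rule that)
    have "\<forall>i. \<exists>u. root_poly u = y i" using gy(3) by (metis ex_root_poly)
    then obtain w where w: "\<And>i. root_poly (w i) = y i" by metis
    have "g = gw w" using gy(2) w by (intro ext) (simp add: gw_def)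
    then have "A = \<Psi> w" using gy(1) by (simp add: \<Psi>_def)
    moreover have "good w" unfolding good_def w by (intro conjI gy(4-6))
    ultimately show "\<exists>w. A = \<Psi> w \<and> good w" by blast
  next
    assume "\<exists>w. A = \<Psi> w \<and> good w"
    then obtain w where w: "A = \<Psi> w" "good w" by blast
    show "nondegenerate G \<zeta> \<Lambda> A"
      unfolding nondegenerate_def
      by (rule exI[of _ "gw w"], rule exI[of _ "\<lambda>i. root_poly (w i)"])
        (use w in \<open>simp add: \<Psi>_def gw_def root_poly_monic good_def\<close>)
  qed
  have good_iff: "good w \<longleftrightarrow> (\<forall>i. \<forall>x\<in>#w i. poly (\<Lambda> i) x \<noteq> 0) \<and>
      (\<forall>i j. cartan G j i \<noteq> 0 \<longrightarrow> (\<forall>x\<in>#w i. x \<notin># (if j = i then w i - {#x#} else w j)))" for w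
  proof -
    \<comment> \<open>Since a_ii = 2 is nonzero, the case j = i is never vacuous; it says that the
      roots are simple.\<close>
    have c: "(\<forall>i j. cartan G j i \<noteq> 0 \<longrightarrow> (\<forall>x\<in>#w i. x \<notin># (if j = i then w i - {#x#} else w j))) \<longleftrightarrow>
        (\<forall>i. \<forall>x\<in>#w i. x \<notin># w i - {#x#}) \<and> (\<forall>i j. j \<noteq> i \<and> cartan G j i \<noteq> 0 \<longrightarrow> (\<forall>x\<in>#w i. x \<notin># w j))"
      using cartan_diag by (smt (verit) zero_neq_numeral)
    have l: "(\<forall>i x. \<not> (x \<in># w i \<and> poly (\<Lambda> i) x = 0)) \<longleftrightarrow> (\<forall>i. \<forall>x\<in>#w i. poly (\<Lambda> i) x \<noteq> 0)"
      by blast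
    \<comment> \<open>Nondegeneracy tests a_ij and the Bethe condition a_ji. Both range over all
      ordered pairs and disjointness is symmetric, so exchanging i and j matches them.\<close>
    have y: "(\<forall>i j x. i \<noteq> j \<and> cartan G i j \<noteq> 0 \<longrightarrow> \<not> (x \<in># w i \<and> x \<in># w j)) \<longleftrightarrow>
        (\<forall>i j. j \<noteq> i \<and> cartan G j i \<noteq> 0 \<longrightarrow> (\<forall>x\<in>#w i. x \<notin># w j))"
      (is "?L \<longleftrightarrow> ?R")
    proof (intro iffI allI impI ballI notI)
      fix i j x assume L: "?L" and "j \<noteq> i \<and> cartan G j i \<noteq> 0" and "x \<in># w i" "x \<in># w j"
      then show False using L[THEN spec[of _ j], THEN spec[of _ i], THEN spec[of _ x]] by simp
    next
      fix i j x assume R: "?R" and "i \<noteq> j \<and> cartan G i j \<noteq> 0" and "x \<in># w i \<and> x \<in># w j"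
      then show False using R[THEN spec[of _ j], THEN spec[of _ i]] by blast
    qed
    have "good w \<longleftrightarrow> (\<forall>i. \<forall>x\<in>#w i. x \<notin># w i - {#x#}) \<and>
        (\<forall>i. \<forall>x\<in>#w i. poly (\<Lambda> i) x \<noteq> 0) \<and>
        (\<forall>i j. j \<noteq> i \<and> cartan G j i \<noteq> 0 \<longrightarrow> (\<forall>x\<in>#w i. x \<notin># w j))"
      unfolding good_def rsquarefree_root_poly root_poly_eq_0_iff
      by (rule conj_cong[OF refl conj_cong[OF l y]])
    then show ?thesis unfolding c by (simp only: conj_left_commute)
  qed
  have mp: "miura_pluecker G V Z \<Lambda> (\<Psi> w) \<longleftrightarrow> (\<forall>i. \<forall>x\<in>#w i. root_pairing G i Z +
      ratfun_value (log_deriv (to_fract (\<Lambda> i) *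
          (\<Prod>j\<in>UNIV. to_fract (root_poly (w j)) powi (- cartan G j i)) * to_fract [:- x, 1:] ^ 2)) x = 0)"
    if "good w" for w
  proof -
    note gd = that[unfolded good_def]
    have \<Lambda>: "\<Lambda> i \<noteq> 0" for i using assms(5)[of i] by auto
    have no_\<Lambda>: "poly (\<Lambda> i) x \<noteq> 0" if "poly (root_poly (w i)) x = 0" for i x
      using gd[THEN conjunct2, THEN conjunct1, THEN spec[of _ i], THEN spec[of _ x]] that by simp
    have no_y: "poly (root_poly (w j)) x \<noteq> 0"
      if "i \<noteq> j" "cartan G j i \<noteq> 0" "poly (root_poly (w i)) x = 0" for i j x
      using gd[THEN conjunct2, THEN conjunct2, THEN spec[of _ j], THEN spec[of _ i], THEN spec[of _ x]] that
      by simp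
    have sq: "rsquarefree (root_poly (w i))" for i by (rule gd[THEN conjunct1, THEN spec])
    have "miura_pluecker G V (coroot_sum G \<zeta>) \<Lambda> (miura_oper G \<Lambda> (gw w)) \<longleftrightarrow>
        (\<forall>i x. poly (root_poly (w i)) x = 0 \<longrightarrow> root_pairing G i (coroot_sum G \<zeta>) +
          ratfun_value (log_deriv (M \<Lambda> (\<lambda>i. root_poly (w i)) i * to_fract [:- x, 1:] ^ 2)) x = 0)"
      by (rule miura_pluecker_iff_bethe[OF root_poly_nonzero gw_def \<Lambda> sq no_\<Lambda> no_y])
    then show ?thesis
      unfolding M_def[of "\<lambda>i. root_poly (w i)" "gw w", OF root_poly_nonzero gw_def] root_poly_eq_0_iff
        \<Psi>_def assms(4) Ball_def .
  qed
  have "bethe_solution G Z \<Lambda> w \<longleftrightarrow> good w \<and> miura_pluecker G V Z \<Lambda> (\<Psi> w)" for w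
    unfolding bethe_solution_def conj_assoc[symmetric] good_iff[symmetric]
    by (rule conj_cong[OF refl mp[symmetric]])
  then have \<Psi>_image: "\<Psi> ` ?B = ?X"
    using nondeg by auto
  have bij: "bij_betw \<Psi> ?B ?X"
    unfolding bij_betw_def using \<Psi>_image \<Psi>_inj by (auto intro: inj_onI)
  show ?thesis
  proof (intro exI[of _ "inv_into ?B \<Psi>"] conjI allI impI)
    show "bij_betw (inv_into ?B \<Psi>) ?X ?B" by (rule bij_betw_inv_into[OF bij])
    fix A assume "miura_pluecker G V Z \<Lambda> A \<and> nondegenerate G \<zeta> \<Lambda> A"
    then have "\<Psi> (inv_into ?B \<Psi> A) = A"
      by (intro bij_betw_inv_into_right[OF bij]) simp
    then show "A = miura_oper G \<Lambda>
        (\<lambda>i. ratfun_const (\<zeta> i) - log_deriv (to_fract (root_poly (inv_into ?B \<Psi> A i))))"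
      unfolding \<Psi>_def gw_def[abs_def] by simp
  qed
qed

end
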